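(* Let $X$ be a quasi-Banach space of cotype $q<\infty$. Then every quasi-Banach space which is subordinate to $X$ (and, in particular, $X$ itself) is Sidon-regular.
   Context: Spaces are complex quasi-Banach spaces (complete quasi-normed spaces, not necessarily locally convex). By the Aoki–Rolewicz theorem quasi-norms may be taken, up to equivalence, to be $r$-norms for some $0<r\le1$, i.e. $\|x+y\|^r\le\|x\|^r+\|y\|^r$; in particular they may be taken continuous. Let $D_n=\{-1,+1\}^n$ with normalized counting measure $\lambda$, and let $\epsilon_k(t)=t_k$. For $q\ge2$, $X$ has cotype $q$ if there is a constant $C$ such that for all $n$ and all $x_1,\dots,x_n\in X$, $\left(\sum_{k=1}^n\|x_k\|^q\right)^{1/q}\le C\|\sum_{k=1}^n\epsilon_kx_k\|_{L_q(D_n,X)}$. A quasi-Banach space $Y$ is subordinate to $X$ if $Y$ is isomorphic to a closed subspace of $\ell_\infty(I;X)$ (bounded $X$-valued families with the supremum quasi-norm) for some index set $I$. Let $G$ be a compact abelian group with normalized Haar measure and dual group $\Gamma$. A subset $E\subset\Gamma$ is a Sidon set if for every choice of signs $\epsilon_\gamma=\pm1$ ($\gamma\in E$) there is a (finite regular Borel) measure $\nu\in\mathcal M(G)$ whose Fourier transform satisfies $\hat\nu(\gamma)=\epsilon_\gamma$ for all $\gamma\in E$. For $0<p\le\infty$ and a quasi-Banach space $Y$, $E$ has property $\mathcal C_p(Y)$ if there is a constant $M$ such that for all distinct $\gamma_1,\dots,\gamma_n\in E$ and all $y_1,\dots,y_n\in Y$, $$M^{-1}\Big\|\sum_{k=1}^n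 y_k\epsilon_k\Big\|_{L_p(D_n,Y)}\le\Big\|\sum_{k=1}^n y_k\gamma_k\Big\|_{L_p(G,Y)}\le M\Big\|\sum_{k=1}^n y_k\epsilon_k\Big\|_{L_p(D_n,Y)}.$$ $Y$ is Sidon-regular if for every compact abelian group $G$, every Sidon set $E\subset\Gamma$ has property $\mathcal C_p(Y)$ for every $0<p\le\infty$. *)

theory Defs
  imports "HOL-Analysis.Analysis" "HOL-Library.Function_Algebras"
begin

text \<open>
  The quasi-norm is an arbitrary one: it need be neither an \<open>r\<close>-norm nor continuous.
\<close>

locale quasi_banach = vector_space smul
  for smul :: "complex \<Rightarrow> 'a::ab_group_add \<Rightarrow> 'a" +
  fixes N :: "'a \<Rightarrow> real"
  assumes qnorm_nonneg: "0 \<le> N x"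
    and qnorm_eq_0_iff: "N x = 0 \<longleftrightarrow> x = 0"
    and qnorm_scale: "N (smul c x) = cmod c * N x"
    and qnorm_add: "\<exists>K. \<forall>x y. N (x + y) \<le> K * (N x + N y)"
    and complete: "\<lbrakk>\<forall>e>0. \<exists>m0. \<forall>m\<ge>m0. \<forall>n\<ge>m0. N (u m - u n) < e\<rbrakk>
                     \<Longrightarrow> \<exists>l. (\<lambda>n. N (u n - l)) \<longlonglongrightarrow> 0"

text \<open>
  The quasi-norm of \<open>L\<^sub>p(M, Y)\<close> for \<open>0 < p \<le> \<infinity>\<close>, where \<open>N\<close> is the quasi-norm of \<open>Y\<close>.
  If \<open>N\<close> is not continuous, \<open>N \<circ> f\<close> may fail to be measurable even for trigonometric
  polynomials \<open>f\<close>; \<open>nn_integral\<close> is then the lower integral and \<open>Limsup (ae_filter M)\<close> the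
  least essential upper bound.  Both are monotone without measurability, so replacing \<open>N\<close> by an
  equivalent \<open>r\<close>-norm changes the value by at most a constant factor.
\<close>

definition Lp_qnorm :: "'t measure \<Rightarrow> ennreal \<Rightarrow> ('a \<Rightarrow> real) \<Rightarrow> ('t \<Rightarrow> 'a) \<Rightarrow> ennreal" where
  "Lp_qnorm M p N f =
     (if p = \<infinity> then Limsup (ae_filter M) (\<lambda>t. ennreal (N (f t)))
      else let J = (\<integral>\<^sup>+ t. ennreal (N (f t) powr enn2real p) \<partial>M)
           in if J = \<infinity> then \<infinity> else ennreal (enn2real J powr (1 / enn2real p)))"

text \<open>
  The cube \<open>{-1, 1}\<^sup>n\<close>, as functions on \<open>{..<n}\<close>, with normalized counting measure; the
  coordinates are taken in \<open>complex\<close> so that they can act as scalars.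
\<close>

definition sign_cube :: "nat \<Rightarrow> (nat \<Rightarrow> complex) measure" where
  "sign_cube n = uniform_count_measure ({..<n} \<rightarrow>\<^sub>E {-1, 1})"

definition has_cotype :: "real \<Rightarrow> (complex \<Rightarrow> 'a::ab_group_add \<Rightarrow> 'a) \<Rightarrow> ('a \<Rightarrow> real) \<Rightarrow> bool" where
  "has_cotype q smul N \<longleftrightarrow>
     (\<exists>C::real. \<forall>n (x :: nat \<Rightarrow> 'a).
        ennreal ((\<Sum>k<n. N (x k) powr q) powr (1 / q))
          \<le> ennreal C * Lp_qnorm (sign_cube n) (ennreal q) N (\<lambda>t. \<Sum>k<n. smul (t k) (x k)))"

text \<open>
  The index set is the universe of the type \<open>'i\<close>; the vector space operations on families are
  pointwise.
\<close>

definition linf :: "('x \<Rightarrow> real) \<Rightarrow> ('i \<Rightarrow> 'x) set" where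
  "linf N = {f. bdd_above (range (\<lambda>i. N (f i)))}"

definition linf_qnorm :: "('x \<Rightarrow> real) \<Rightarrow> ('i \<Rightarrow> 'x) \<Rightarrow> real" where
  "linf_qnorm N f = (SUP i. N (f i))"

definition fun_scale :: "(complex \<Rightarrow> 'x \<Rightarrow> 'x) \<Rightarrow> complex \<Rightarrow> ('i \<Rightarrow> 'x) \<Rightarrow> ('i \<Rightarrow> 'x)" where
  "fun_scale smul c f = (\<lambda>i. smul c (f i))"

definition closed_subspace_linf ::
    "(complex \<Rightarrow> 'x::ab_group_add \<Rightarrow> 'x) \<Rightarrow> ('x \<Rightarrow> real) \<Rightarrow> ('i \<Rightarrow> 'x) set \<Rightarrow> bool" where
  "closed_subspace_linf smul N Z \<longleftrightarrow>
     Z \<subseteq> linf N \<and> module.subspace (fun_scale smul) Z \<and>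
     (\<forall>u f. (\<forall>n. u n \<in> Z) \<and> f \<in> linf N \<and> (\<lambda>n. linf_qnorm N (u n - f)) \<longlonglongrightarrow> 0
        \<longrightarrow> f \<in> Z)"

text \<open>
  As types cannot be quantified, ``for some index set'' in a hypothesis is rendered by leaving \<open>'i\<close> a free type
  variable.  The empty index set only yields the zero space, which is subordinate through any
  other index set.
\<close>

definition subordinate ::
    "'i itself \<Rightarrow> (complex \<Rightarrow> 'y::ab_group_add \<Rightarrow> 'y) \<Rightarrow> ('y \<Rightarrow> real)
      \<Rightarrow> (complex \<Rightarrow> 'x::ab_group_add \<Rightarrow> 'x) \<Rightarrow> ('x \<Rightarrow> real) \<Rightarrow> bool" where
  "subordinate I sY NY sX NX \<longleftrightarrow>
     (\<exists>(Z :: ('i \<Rightarrow> 'x) set) T. closed_subspace_linf sX NX Z \<and>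
        Vector_Spaces.linear sY (fun_scale sX) T \<and> bij_betw T UNIV Z \<and>
        (\<exists>C>0. \<forall>y. linf_qnorm NX (T y) \<le> C * NY y \<and> NY y \<le> C * linf_qnorm NX (T y)))"

definition regular_set_fun :: "('g::topological_space set \<Rightarrow> ennreal) \<Rightarrow> bool" where
  "regular_set_fun m \<longleftrightarrow>
     (\<forall>A\<in>sets borel. \<forall>e::real. e > 0 \<longrightarrow>
        (\<exists>K U. compact K \<and> open U \<and> K \<subseteq> A \<and> A \<subseteq> U \<and> m (U - K) < ennreal e))"

definition normalized_haar :: "'g::{topological_ab_group_add, t2_space} measure \<Rightarrow> bool" where
  "normalized_haar \<mu> \<longleftrightarrow>
     sets \<mu> = sets borel \<and> emeasure \<mu> UNIV = 1 \<and> regular_set_fun (emeasure \<mu>) \<and>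
     (\<forall>a. distr \<mu> borel (\<lambda>x. a + x) = \<mu>)"

text \<open>
  Complex measures are countably additive set functions on the Borel sets; values outside the
  Borel sets are irrelevant.
\<close>

definition total_variation :: "('g::topological_space set \<Rightarrow> complex) \<Rightarrow> 'g set \<Rightarrow> ennreal" where
  "total_variation \<nu> A =
     (SUP P\<in>{P. finite P \<and> disjoint P \<and> P \<subseteq> sets borel \<and> \<Union>P = A}. \<Sum>B\<in>P. ennreal (cmod (\<nu> B)))"

definition regular_complex_measure :: "('g::topological_space set \<Rightarrow> complex) \<Rightarrow> bool" where
  "regular_complex_measure \<nu> \<longleftrightarrow>
     (\<forall>A :: nat \<Rightarrow> 'g set. range A \<subseteq> sets borel \<and> disjoint_family A
        \<longrightarrow> (\<lambda>n. \<nu> (A n)) sums \<nu> (\<Union>n. A n)) \<and>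
     regular_set_fun (total_variation \<nu>)"

text \<open>
  Integration against a complex measure, through the Jordan decompositions of its real and
  imaginary parts.  The upper variation of a real countably additive \<open>\<phi>\<close> at \<open>A\<close> is the supremum
  of \<open>\<phi>\<close> over the Borel subsets of \<open>A\<close>; negative values are clipped by \<open>ennreal\<close>, which is
  harmless because the empty set has value 0.
\<close>

definition upper_variation :: "('g::topological_space set \<Rightarrow> real) \<Rightarrow> 'g measure" where
  "upper_variation \<phi> =
     measure_of UNIV (sets borel) (\<lambda>A. SUP B\<in>{B \<in> sets borel. B \<subseteq> A}. ennreal (\<phi> B))"

definition complex_measure_integral ::
    "('g::topological_space set \<Rightarrow> complex) \<Rightarrow> ('g \<Rightarrow> complex) \<Rightarrow> complex" where
  "complex_measure_integral \<nu> f =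
     ((LINT t|upper_variation (\<lambda>A. Re (\<nu> A)). f t) - (LINT t|upper_variation (\<lambda>A. - Re (\<nu> A)). f t))
     + \<i> * ((LINT t|upper_variation (\<lambda>A. Im (\<nu> A)). f t)
             - (LINT t|upper_variation (\<lambda>A. - Im (\<nu> A)). f t))"

definition dual_group :: "('g::topological_ab_group_add \<Rightarrow> complex) set" where
  "dual_group = {\<gamma>. continuous_on UNIV \<gamma> \<and> (\<forall>x. cmod (\<gamma> x) = 1) \<and> (\<forall>x y. \<gamma> (x + y) = \<gamma> x * \<gamma> y)}"

definition fourier_transform ::
    "('g::topological_space set \<Rightarrow> complex) \<Rightarrow> ('g \<Rightarrow> complex) \<Rightarrow> complex" where
  "fourier_transform \<nu> \<gamma> = complex_measure_integral \<nu> (\<lambda>t. cnj (\<gamma> t))"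

definition sidon_set :: "('g::topological_ab_group_add \<Rightarrow> complex) set \<Rightarrow> bool" where
  "sidon_set E \<longleftrightarrow> E \<subseteq> dual_group \<and>
     (\<forall>\<epsilon>. (\<forall>\<gamma>\<in>E. \<epsilon> \<gamma> \<in> {-1, 1}) \<longrightarrow>
        (\<exists>\<nu>. regular_complex_measure \<nu> \<and> (\<forall>\<gamma>\<in>E. fourier_transform \<nu> \<gamma> = \<epsilon> \<gamma>)))"

definition property_C ::
    "'g measure \<Rightarrow> ('g \<Rightarrow> complex) set \<Rightarrow> ennreal
      \<Rightarrow> (complex \<Rightarrow> 'y::ab_group_add \<Rightarrow> 'y) \<Rightarrow> ('y \<Rightarrow> real) \<Rightarrow> bool" where
  "property_C \<mu> E p smul N \<longleftrightarrow>
     (\<exists>M::real. M > 0 \<and> (\<forall>n (\<gamma> :: nat \<Rightarrow> 'g \<Rightarrow> complex) (y :: nat \<Rightarrow> 'y).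
        inj_on \<gamma> {..<n} \<and> \<gamma> ` {..<n} \<subseteq> E \<longrightarrow>
        (let S = Lp_qnorm (sign_cube n) p N (\<lambda>t. \<Sum>k<n. smul (t k) (y k));
             T = Lp_qnorm \<mu> p N (\<lambda>t. \<Sum>k<n. smul (\<gamma> k t) (y k))
         in ennreal (inverse M) * S \<le> T \<and> T \<le> ennreal M * S)))"

text \<open>
  The group is the type \<open>'g\<close>, so ``every compact abelian group'' means all instances of \<open>'g\<close>
  that are compact.
\<close>

definition sidon_regular ::
    "'g::{topological_ab_group_add, t2_space} itself
      \<Rightarrow> (complex \<Rightarrow> 'y::ab_group_add \<Rightarrow> 'y) \<Rightarrow> ('y \<Rightarrow> real) \<Rightarrow> bool" where
  "sidon_regular G smul N \<longleftrightarrow>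
     (compact (UNIV :: 'g set) \<longrightarrow>
      (\<forall>(\<mu> :: 'g measure) E p. normalized_haar \<mu> \<and> sidon_set E \<and> 0 < p
         \<longrightarrow> property_C \<mu> E p smul N))"

end

theory Submission
  imports Defs "HOL-Probability.Product_PMF"
begin

text \<open>
  For a Banach space one interpolates the signs \<open>t\<close> on the Sidon set by a measure \<open>\<nu>\<close> and
  convolves with it.  Without local convexity, convolution with a measure is in general not
  bounded on \<open>L\<^sub>p(G, Y)\<close>.  Cotype replaces convexity here.

  \<^bold>\<open>The core.\<close>  Fix \<open>x\<^sub>1, \<dots>, x\<^sub>n\<close> in \<open>X\<close>, let \<open>\<Psi> a\<close> be the quasi-norm of \<open>\<Sum> a\<^sub>k x\<^sub>k\<close>, and let \<open>\<Phi> A\<close> be the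
  supremum of \<open>\<Psi>\<close> over the coefficients of modulus at most 1 supported in \<open>A\<close>.  The claim is that
  \<open>\<Phi> {1..n}\<close> is at most a constant times the supremum \<open>S\<close> of \<open>\<Psi> (\<gamma>\<^sub>1 g, \<dots>, \<gamma>\<^sub>n g)\<close> over \<open>g\<close>.  The Sidon
  property says that a vector \<open>t\<close> of the polydisc lies in \<open>M\<close> times the absolutely convex hull of the
  points \<open>(\<gamma>\<^sub>1 g, \<dots>, \<gamma>\<^sub>n g)\<close> (\<open>sidon_polydisc_hull\<close>).  Replace this combination by an average of \<open>N\<close>
  random points of the hull, with \<open>N\<close> independent of \<open>n\<close>: since only \<open>N\<close> points occur, \<open>\<Psi>\<close> of the
  average is at most a constant times \<open>S\<close>.  The error of the average is smaller than \<open>\<delta>\<close> in each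
  coordinate with high probability, so it is the sum of a vector bounded by \<open>\<delta>\<close> and a bounded
  vector supported in a random set \<open>A\<close> that contains each coordinate with small probability.

  Cotype makes \<open>\<Phi>\<close> exhaustive: among \<open>m\<close> disjoint sets one has \<open>\<Phi> \<le> C m\<^sup>-\<^sup>\<theta> \<Phi> {1..n}\<close>.  As
  for exhaustive submeasures, which have control measures, this forces \<open>\<Phi> A\<close> to be small for some
  outcome of the random set (\<open>random_set_small\<close>).  So the error contributes at most
  \<open>\<Phi> {1..n} / 2\<close>, which is absorbed (\<open>polydisc_bound_from_hull\<close>).

  \<^bold>\<open>From suprema to \<open>L\<^sub>p\<close>.\<close>  The core applies to \<open>\<ell>\<^sub>p(W; X)\<close>, where \<open>W\<close> is a finite weighted set, because
  Kahane's inequality (\<open>khintchine_kahane\<close>) transfers cotype to it in the weak form above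
  (\<open>cotype_exhaustive\<close>).  If \<open>Y\<close> embeds into \<open>\<ell>\<^sub>\<infinity>(I; X)\<close>, choosing for each point of \<open>W\<close> an almost
  norming coordinate in \<open>I\<close> yields the same bound in \<open>\<ell>\<^sub>p(W; Y)\<close> (\<open>sidon_dominated_norming\<close>).  Let
  now \<open>W\<close> be a fine discretization of \<open>G\<close> and take the vectors \<open>\<gamma>\<^sub>k y\<^sub>k\<close>.  Translation by \<open>g\<close> multiplies
  them by the scalars \<open>\<gamma>\<^sub>k g\<close> and preserves the norm in \<open>L\<^sub>p(G, Y)\<close>.  Hence all sums \<open>\<Sum> \<plusminus>\<gamma>\<^sub>k y\<^sub>k\<close> have
  equivalent norms there.  The average of these norms over the signs is equivalent to the norm of
  \<open>\<Sum> \<epsilon>\<^sub>k y\<^sub>k\<close>, by the contraction principle at each point of \<open>G\<close>.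

  Quasi-norms enter only through the constant of the quasi-triangle inequality.  As they may be
  discontinuous, integrands are compared with simple functions.
\<close>

section \<open>Weighted power means\<close>

text \<open>
  The \<open>L\<^sub>p\<close>-quasi-norm of a nonnegative function on a finite weighted set.
\<close>

definition lpn :: "'w set \<Rightarrow> ('w \<Rightarrow> real) \<Rightarrow> real \<Rightarrow> ('w \<Rightarrow> real) \<Rightarrow> real" where
  "lpn A w p f = (\<Sum>x\<in>A. w x * f x powr p) powr (1 / p)"

lemma lpn_nonneg: "0 \<le> lpn A w p f"
  by (simp add: lpn_def)

lemma powr_add_le:
  fixes a b p :: real
  assumes "0 \<le> a" "0 \<le> b" "0 < p"
  shows "(a + b) powr p \<le> 2 powr p * (a powr p + b powr p)"
proof -
  have "(a + b) powr p \<le> (2 * max a b) powr p"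
    using assms by (intro powr_mono2) auto
  also have "\<dots> = 2 powr p * max a b powr p"
    using assms by (simp add: powr_mult)
  also have "\<dots> \<le> 2 powr p * (a powr p + b powr p)"
    by (intro mult_left_mono) (auto simp: max_def)
  finally show ?thesis .
qed

lemma lpn_powr:
  assumes "0 < p" "\<And>x. x \<in> A \<Longrightarrow> 0 \<le> w x"
  shows "lpn A w p f powr p = (\<Sum>x\<in>A. w x * f x powr p)"
proof -
  have "0 \<le> (\<Sum>x\<in>A. w x * f x powr p)"
    using assms by (intro sum_nonneg) auto
  then show ?thesis
    using assms by (simp add: lpn_def powr_powr)
qed

lemma lpn_mono:
  assumes "0 < p" "\<And>x. x \<in> A \<Longrightarrow> 0 \<le> w x" "\<And>x. x \<in> A \<Longrightarrow> 0 \<le> f x" "\<And>x. x \<in> A \<Longrightarrow> f x \<le> g x"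
  shows "lpn A w p f \<le> lpn A w p g"
  unfolding lpn_def using assms
  by (intro powr_mono2 sum_mono mult_left_mono sum_nonneg) auto

lemma lpn_scale:
  assumes "0 < p" "0 \<le> c" "\<And>x. x \<in> A \<Longrightarrow> 0 \<le> w x" "\<And>x. x \<in> A \<Longrightarrow> 0 \<le> f x"
  shows "lpn A w p (\<lambda>x. c * f x) = c * lpn A w p f"
proof -
  have "(\<Sum>x\<in>A. w x * (c * f x) powr p) = c powr p * (\<Sum>x\<in>A. w x * f x powr p)"
    using assms by (simp add: sum_distrib_left powr_mult mult_ac)
  moreover have "0 \<le> (\<Sum>x\<in>A. w x * f x powr p)"
    using assms by (intro sum_nonneg) auto
  ultimately show ?thesis
    using assms by (simp add: lpn_def powr_mult powr_powr)
qed

lemma lpn_add: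
  assumes p: "0 < p" and w: "\<And>x. x \<in> A \<Longrightarrow> 0 \<le> w x"
    and f: "\<And>x. x \<in> A \<Longrightarrow> 0 \<le> f x" and g: "\<And>x. x \<in> A \<Longrightarrow> 0 \<le> g x"
  shows "lpn A w p (\<lambda>x. f x + g x) \<le> 2 powr (1 + 1 / p) * (lpn A w p f + lpn A w p g)"
proof -
  define F where "F = (\<Sum>x\<in>A. w x * f x powr p)"
  define G where "G = (\<Sum>x\<in>A. w x * g x powr p)"
  have FG: "0 \<le> F" "0 \<le> G"
    unfolding F_def G_def using w by (auto intro!: sum_nonneg)
  have "(\<Sum>x\<in>A. w x * (f x + g x) powr p) \<le> (\<Sum>x\<in>A. w x * (2 powr p * (f x powr p + g x powr p)))"
    using assms by (intro sum_mono mult_left_mono powr_add_le) auto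
  also have "\<dots> = 2 powr p * (F + G)"
    by (simp add: F_def G_def sum_distrib_left sum.distrib algebra_simps)
  finally have "lpn A w p (\<lambda>x. f x + g x) \<le> (2 powr p * (F + G)) powr (1 / p)"
    unfolding lpn_def using p w by (intro powr_mono2 sum_nonneg) auto
  also have "\<dots> = 2 * (F + G) powr (1 / p)"
    using p FG by (simp add: powr_mult powr_powr)
  also have "\<dots> \<le> 2 * (2 powr (1 / p) * (F powr (1 / p) + G powr (1 / p)))"
    using p FG by (intro mult_left_mono powr_add_le) auto
  also have "\<dots> = 2 powr (1 + 1 / p) * (lpn A w p f + lpn A w p g)"
    by (simp add: lpn_def F_def G_def powr_add)
  finally show ?thesis .
qed

lemma lpn_le_const:
  assumes "0 < p" "\<And>x. x \<in> A \<Longrightarrow> 0 \<le> w x" "(\<Sum>x\<in>A. w x) \<le> 1" "0 \<le> c"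
    and "\<And>x. x \<in> A \<Longrightarrow> 0 \<le> f x" "\<And>x. x \<in> A \<Longrightarrow> f x \<le> c"
  shows "lpn A w p f \<le> c"
proof -
  have "(\<Sum>x\<in>A. w x * f x powr p) \<le> (\<Sum>x\<in>A. w x * c powr p)"
    using assms by (intro sum_mono mult_left_mono powr_mono2) auto
  also have "\<dots> = (\<Sum>x\<in>A. w x) * c powr p"
    by (simp add: sum_distrib_right)
  also have "\<dots> \<le> 1 * c powr p"
    using assms by (intro mult_right_mono) auto
  finally have "lpn A w p f \<le> (c powr p) powr (1 / p)"
    unfolding lpn_def using assms by (intro powr_mono2 sum_nonneg) auto
  also have "\<dots> = c"
    using assms by (simp add: powr_powr)
  finally show ?thesis .
qed

section \<open>Quasi-seminorms of coefficient vectors\<close>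

text \<open>
  All spaces enter through the quasi-seminorms \<open>a \<mapsto> N (\<Sum>k<n. a k x k)\<close> of coefficient vectors.  Vectors are
  functions on all of \<open>nat\<close>, of which only the first \<open>n\<close> values count, so that bounds can be uniform
  in \<open>n\<close>.
\<close>

locale coefficient_quasi_seminorm =
  fixes n :: nat and K :: real and \<Psi> :: "(nat \<Rightarrow> complex) \<Rightarrow> real"
  assumes K_ge_1: "1 \<le> K"
    and nonneg: "0 \<le> \<Psi> a"
    and triangle: "\<Psi> (\<lambda>k. a k + b k) \<le> K * (\<Psi> a + \<Psi> b)"
    and scale: "\<Psi> (\<lambda>k. c * a k) = cmod c * \<Psi> a"
    and local: "(\<And>k. k < n \<Longrightarrow> a k = b k) \<Longrightarrow> \<Psi> a = \<Psi> b"
begin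

lemma zero: "\<Psi> (\<lambda>k. 0) = 0"
  using scale[of 0 "\<lambda>k. 0"] by simp

lemma sum_le: "\<Psi> (\<lambda>k. \<Sum>i<m. f i k) \<le> K ^ m * (\<Sum>i<m. \<Psi> (f i))"
proof (induction m)
  case 0
  then show ?case by (simp add: zero)
next
  case (Suc m)
  have "\<Psi> (\<lambda>k. \<Sum>i<Suc m. f i k) \<le> K * (\<Psi> (\<lambda>k. \<Sum>i<m. f i k) + \<Psi> (f m))"
    using triangle[of "\<lambda>k. \<Sum>i<m. f i k" "f m"] by simp
  also have "\<dots> \<le> K * (K ^ m * (\<Sum>i<m. \<Psi> (f i)) + K ^ m * \<Psi> (f m))"
    using K_ge_1 nonneg[of "f m"] mult_right_mono[of 1 "K ^ m" "\<Psi> (f m)"] Suc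
    by (intro mult_left_mono add_mono) auto
  also have "\<dots> = K ^ Suc m * (\<Sum>i<Suc m. \<Psi> (f i))"
    by (simp add: algebra_simps)
  finally show ?case .
qed

lemma bounded_on_polydisc: "\<exists>B\<ge>0. \<forall>a. (\<forall>k<n. cmod (a k) \<le> 1) \<longrightarrow> \<Psi> a \<le> B"
proof -
  define e :: "nat \<Rightarrow> nat \<Rightarrow> complex" where "e i = (\<lambda>k. if k = i then 1 else 0)" for i
  define B where "B = K ^ n * (\<Sum>i<n. \<Psi> (e i))"
  have "\<Psi> a \<le> B" if a: "\<forall>k<n. cmod (a k) \<le> 1" for a
  proof -
    have "\<Psi> a = \<Psi> (\<lambda>k. \<Sum>i<n. a i * e i k)"
      by (rule local) (simp add: e_def if_distrib cong: if_cong)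
    also have "\<dots> \<le> K ^ n * (\<Sum>i<n. \<Psi> (\<lambda>k. a i * e i k))"
      using sum_le[where f = "\<lambda>i k. a i * e i k"] .
    also have "\<dots> \<le> B"
      unfolding B_def scale using K_ge_1 a nonneg
      by (intro mult_left_mono sum_mono) (auto intro: mult_left_le_one_le)
    finally show ?thesis .
  qed
  moreover have "0 \<le> B"
    unfolding B_def using K_ge_1 nonneg by (auto intro!: sum_nonneg mult_nonneg_nonneg)
  ultimately show ?thesis by blast
qed

end

text \<open>
  The leading \<open>m\<close> binary digits of real coefficients form a combination of \<open>m\<close> sign vectors, so that
  the constant \<open>D\<close> depends on \<open>m\<close> and \<open>K\<close> alone.
\<close>

lemma binary_digits_bound:
  fixes K :: real
  assumes K: "1 \<le> K"
  shows "\<exists>D\<ge>0. \<forall>n \<Psi> R a. coefficient_quasi_seminorm n K \<Psi> \<and>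
           (\<forall>\<theta>. (\<forall>k. \<theta> k \<in> {-1, 1}) \<longrightarrow> \<Psi> \<theta> \<le> R) \<and> (\<forall>k. \<bar>a k\<bar> \<le> (1::real)) \<longrightarrow>
           (\<exists>d a'. (\<forall>k. of_real (a k) = d k + of_real (a' k / 2 ^ m)) \<and> (\<forall>k. \<bar>a' k\<bar> \<le> (1::real))
              \<and> \<Psi> d \<le> D * R)"
proof (induction m)
  case 0
  show ?case
  proof (rule exI[of _ "0::real"], intro conjI allI impI)
    fix n :: nat and \<Psi> R and a :: "nat \<Rightarrow> real"
    assume *: "coefficient_quasi_seminorm n K \<Psi> \<and>
           (\<forall>\<theta>. (\<forall>k. \<theta> k \<in> {-1, 1}) \<longrightarrow> \<Psi> \<theta> \<le> R) \<and> (\<forall>k. \<bar>a k\<bar> \<le> 1)"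
    then interpret coefficient_quasi_seminorm n K \<Psi> by blast
    show "\<exists>d a'. (\<forall>k. of_real (a k) = d k + of_real (a' k / 2 ^ 0)) \<and> (\<forall>k. \<bar>a' k\<bar> \<le> (1::real)) \<and> \<Psi> d \<le> 0 * R"
      using * zero by (intro exI[of _ "\<lambda>k. 0"] exI[of _ a]) auto
  qed auto
next
  case (Suc m)
  then obtain D where D: "D \<ge> 0" and IH: "\<And>n \<Psi> R a. coefficient_quasi_seminorm n K \<Psi> \<Longrightarrow>
           (\<forall>\<theta>. (\<forall>k. \<theta> k \<in> {-1, 1}) \<longrightarrow> \<Psi> \<theta> \<le> R) \<Longrightarrow> (\<forall>k. \<bar>a k\<bar> \<le> (1::real)) \<Longrightarrow>
           (\<exists>d a'. (\<forall>k. of_real (a k) = d k + of_real (a' k / 2 ^ m)) \<and> (\<forall>k. \<bar>a' k\<bar> \<le> (1::real))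
              \<and> \<Psi> d \<le> D * R)"
    by blast
  show ?case
  proof (intro exI[of _ "K * (D + 1)"] conjI allI impI)
    show "0 \<le> K * (D + 1)" using K D by auto
    fix n :: nat and \<Psi> R and a :: "nat \<Rightarrow> real"
    assume *: "coefficient_quasi_seminorm n K \<Psi> \<and>
           (\<forall>\<theta>. (\<forall>k. \<theta> k \<in> {-1, 1}) \<longrightarrow> \<Psi> \<theta> \<le> R) \<and> (\<forall>k. \<bar>a k\<bar> \<le> 1)"
    then interpret coefficient_quasi_seminorm n K \<Psi> by blast
    obtain d a' where d: "\<And>k. of_real (a k) = d k + of_real (a' k / 2 ^ m)"
      and a': "\<And>k. \<bar>a' k\<bar> \<le> 1" and dD: "\<Psi> d \<le> D * R"
      using IH[of n \<Psi> R a] * by auto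
    define \<theta> :: "nat \<Rightarrow> real" where "\<theta> = (\<lambda>k. if a' k \<ge> 0 then 1 else -1)"
    define c :: complex where "c = of_real (1 / 2 ^ Suc m)"
    have R: "\<Psi> (\<lambda>k. of_real (\<theta> k)) \<le> R"
      using * by (auto simp: \<theta>_def)
    have "cmod c \<le> 1"
      using one_le_power[of "2::real" "Suc m"] unfolding c_def norm_of_real by simp
    then have "cmod c * \<Psi> (\<lambda>k. of_real (\<theta> k)) \<le> 1 * R"
      using R nonneg by (intro mult_mono) auto
    then have "\<Psi> (\<lambda>k. d k + c * of_real (\<theta> k)) \<le> K * (D * R + R)"
      using triangle[of d "\<lambda>k. c * of_real (\<theta> k)"] dD K
      by (elim order_trans) (auto simp: scale intro!: mult_left_mono)
    moreover have "of_real (a k) = (d k + c * of_real (\<theta> k)) + of_real ((2 * a' k - \<theta> k) / 2 ^ Suc m)" for k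
      by (simp add: d c_def field_simps)
    moreover have "\<bar>2 * a' k - \<theta> k\<bar> \<le> 1" for k
      using a'[of k] by (auto simp: \<theta>_def)
    ultimately show "\<exists>d a'. (\<forall>k. of_real (a k) = d k + of_real (a' k / 2 ^ Suc m)) \<and> (\<forall>k. \<bar>a' k\<bar> \<le> (1::real)) \<and> \<Psi> d \<le> K * (D + 1) * R"
      by (intro exI[of _ "\<lambda>k. d k + c * of_real (\<theta> k)"] exI[of _ "\<lambda>k. 2 * a' k - \<theta> k"])
        (auto simp: algebra_simps)
  qed
qed

text \<open>
  Signs dominate all coefficients of modulus at most 1.  Without convexity one cannot average
  over signs; instead a real coefficient vector is split into its leading \<open>m\<close> binary digits and a
  remainder \<open>2\<^sup>-\<^sup>m a'\<close>, where \<open>m\<close> is so large that the remainder is absorbed despite the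
  constant of the quasi-triangle inequality.
\<close>

theorem contraction_principle:
  fixes K :: real
  assumes K: "1 \<le> K"
  shows "\<exists>C\<ge>0. \<forall>n \<Psi> R a. coefficient_quasi_seminorm n K \<Psi> \<and>
           (\<forall>\<theta>. (\<forall>k. \<theta> k \<in> {-1, 1}) \<longrightarrow> \<Psi> \<theta> \<le> R) \<and> (\<forall>k<n. cmod (a k) \<le> 1) \<longrightarrow> \<Psi> a \<le> C * R"
proof -
  obtain m :: nat where m: "2 * K \<le> 2 ^ m"
    using real_arch_pow[of 2 "2 * K"] by (auto intro: less_imp_le)
  obtain D where D: "D \<ge> 0" and digits: "\<And>n \<Psi> R a. coefficient_quasi_seminorm n K \<Psi> \<Longrightarrow>
           (\<forall>\<theta>. (\<forall>k. \<theta> k \<in> {-1, 1}) \<longrightarrow> \<Psi> \<theta> \<le> R) \<Longrightarrow> (\<forall>k. \<bar>a k\<bar> \<le> (1::real)) \<Longrightarrow>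
           (\<exists>d a'. (\<forall>k. of_real (a k) = d k + of_real (a' k / 2 ^ m)) \<and> (\<forall>k. \<bar>a' k\<bar> \<le> (1::real))
              \<and> \<Psi> d \<le> D * R)"
    using binary_digits_bound[OF K, of m] by blast
  show ?thesis
  proof (intro exI[of _ "4 * K * K * D"] conjI allI impI)
    show "0 \<le> 4 * K * K * D" using K D by auto
    fix n \<Psi> R and a :: "nat \<Rightarrow> complex"
    assume *: "coefficient_quasi_seminorm n K \<Psi> \<and>
           (\<forall>\<theta>. (\<forall>k. \<theta> k \<in> {-1, 1}) \<longrightarrow> \<Psi> \<theta> \<le> R) \<and> (\<forall>k<n. cmod (a k) \<le> 1)"
    then interpret coefficient_quasi_seminorm n K \<Psi> by blast
    obtain B where B: "\<And>a. (\<forall>k<n. cmod (a k) \<le> 1) \<Longrightarrow> \<Psi> a \<le> B"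
      using bounded_on_polydisc by blast
    define V where "V = Sup {\<Psi> (\<lambda>k. of_real (b k)) | b. \<forall>k. \<bar>b k\<bar> \<le> (1::real)}"
    have bdd: "bdd_above {\<Psi> (\<lambda>k. of_real (b k)) | b. \<forall>k. \<bar>b k\<bar> \<le> (1::real)}"
      by (rule bdd_aboveI[of _ B]) (auto intro!: B)
    have upper: "\<Psi> (\<lambda>k. of_real (b k)) \<le> V" if "\<forall>k. \<bar>b k\<bar> \<le> 1" for b :: "nat \<Rightarrow> real"
      unfolding V_def using that bdd by (intro cSup_upper) auto
    have step: "\<Psi> (\<lambda>k. of_real (b k)) \<le> K * D * R + V / 2" if b: "\<forall>k. \<bar>b k\<bar> \<le> 1" for b :: "nat \<Rightarrow> real"
    proof -
      obtain d b' where d: "\<And>k. of_real (b k) = d k + of_real (b' k / 2 ^ m)"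
        and b': "\<And>k. \<bar>b' k\<bar> \<le> 1" and dD: "\<Psi> d \<le> D * R"
        using digits[of n \<Psi> R b] * b by auto
      have "(\<lambda>k. of_real (b k)) = (\<lambda>k. d k + of_real (1 / 2 ^ m) * of_real (b' k))"
        by (rule ext) (simp add: d)
      then have "\<Psi> (\<lambda>k. of_real (b k)) = \<Psi> (\<lambda>k. d k + of_real (1 / 2 ^ m) * of_real (b' k))"
        by simp
      also have "\<dots> \<le> K * (\<Psi> d + 1 / 2 ^ m * \<Psi> (\<lambda>k. of_real (b' k)))"
        using triangle[of d "\<lambda>k. of_real (1 / 2 ^ m) * of_real (b' k)"]
        unfolding scale norm_of_real by simp
      also have "\<dots> \<le> K * (D * R + 1 / (2 * K) * V)"
        using K m dD upper[of b'] b' nonneg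
        by (intro mult_left_mono add_mono mult_mono) (auto simp: field_simps)
      also have "\<dots> = K * D * R + V / 2"
        using K by (simp add: field_simps)
      finally show ?thesis .
    qed
    have "V \<le> K * D * R + V / 2"
      unfolding V_def
    proof (rule cSup_least)
      show "{\<Psi> (\<lambda>k. of_real (b k)) | b. \<forall>k. \<bar>b k\<bar> \<le> (1::real)} \<noteq> {}"
        by (auto intro!: exI[of _ "\<lambda>k. 0"])
    qed (use step in \<open>auto simp: V_def\<close>)
    then have V: "V \<le> 2 * K * D * R" by simp
    define a0 where "a0 = (\<lambda>k. if k < n then a k else 0)"
    have a0: "cmod (a0 k) \<le> 1" for k
      using * by (auto simp: a0_def)
    have "\<Psi> a = \<Psi> (\<lambda>k. of_real (Re (a0 k)) + \<i> * of_real (Im (a0 k)))"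
      by (rule local) (simp add: a0_def complex_eq)
    also have "\<dots> \<le> K * (\<Psi> (\<lambda>k. of_real (Re (a0 k))) + \<Psi> (\<lambda>k. of_real (Im (a0 k))))"
      using triangle[of "\<lambda>k. of_real (Re (a0 k))" "\<lambda>k. \<i> * of_real (Im (a0 k))"]
      unfolding scale by simp
    also have "\<dots> \<le> K * (V + V)"
      using K a0 abs_Re_le_cmod abs_Im_le_cmod order_trans
      by (intro mult_left_mono add_mono upper) (blast, blast, simp)
    also have "\<dots> \<le> K * (4 * K * D * R)"
      using V K by (intro mult_left_mono) linarith+
    finally show "\<Psi> a \<le> 4 * K * K * D * R" by (simp add: mult_ac)
  qed
qed

section \<open>Rademacher sums in quasi-normed spaces\<close>

locale quasi_normed = vector_space smul
  for smul :: "complex \<Rightarrow> 'a::ab_group_add \<Rightarrow> 'a" +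
  fixes N :: "'a \<Rightarrow> real" and K :: real
  assumes const_ge_1: "1 \<le> K"
    and N_nonneg: "0 \<le> N x"
    and N_scale: "N (smul c x) = cmod c * N x"
    and N_add: "N (x + y) \<le> K * (N x + N y)"
begin

lemma N_zero: "N 0 = 0"
  using N_scale[of 0 0] by simp

lemma linear_combination_quasi_seminorm:
  "coefficient_quasi_seminorm n K (\<lambda>a. N (\<Sum>k<n. smul (a k) (x k)))"
proof
  show "N (\<Sum>k<n. smul (a k + b k) (x k))
      \<le> K * (N (\<Sum>k<n. smul (a k) (x k)) + N (\<Sum>k<n. smul (b k) (x k)))" for a b
    using N_add[of "\<Sum>k<n. smul (a k) (x k)" "\<Sum>k<n. smul (b k) (x k)"]
    by (simp add: scale_left_distrib sum.distrib)
  show "N (\<Sum>k<n. smul (c * a k) (x k)) = cmod c * N (\<Sum>k<n. smul (a k) (x k))" for c a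
    by (simp flip: N_scale scale_scale scale_sum_right)
  show "N (\<Sum>k<n. smul (a k) (x k)) = N (\<Sum>k<n. smul (b k) (x k))"
    if "\<And>k. k < n \<Longrightarrow> a k = b k" for a b
    using that by (metis (no_types, lifting) lessThan_iff sum.cong)
qed (use const_ge_1 N_nonneg in auto)

end

definition cube :: "nat \<Rightarrow> (nat \<Rightarrow> complex) set" where
  "cube n = {..<n} \<rightarrow>\<^sub>E {-1, 1}"

lemma finite_cube: "finite (cube n)"
  unfolding cube_def by (intro finite_PiE) auto

lemma card_cube: "card (cube n) = 2 ^ n"
  by (simp add: cube_def card_PiE numeral_2_eq_2)

lemma cube_I:
  "(\<And>k. k < n \<Longrightarrow> t k \<in> {-1, 1}) \<Longrightarrow> (\<And>k. \<not> k < n \<Longrightarrow> t k = undefined) \<Longrightarrow> t \<in> cube n"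
  unfolding cube_def by (rule PiE_I) simp_all

lemma cube_outside: "t \<in> cube n \<Longrightarrow> \<not> k < n \<Longrightarrow> t k = undefined"
  using PiE_arb[of t "{..<n}" "\<lambda>_. {-1, 1}" k] by (simp add: cube_def)

definition sign_mult :: "nat \<Rightarrow> (nat \<Rightarrow> complex) \<Rightarrow> (nat \<Rightarrow> complex) \<Rightarrow> nat \<Rightarrow> complex" where
  "sign_mult n \<theta> t = (\<lambda>k\<in>{..<n}. \<theta> k * t k)"

lemma cube_sign: "t \<in> cube n \<Longrightarrow> k < n \<Longrightarrow> t k = -1 \<or> t k = 1"
  using PiE_mem[of t "{..<n}" "\<lambda>_. {-1, 1}" k] by (simp add: cube_def)

lemma sign_mult_cube:
  assumes "\<And>k. k < n \<Longrightarrow> \<theta> k \<in> {-1, 1}" "t \<in> cube n"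
  shows "sign_mult n \<theta> t \<in> cube n"
proof (rule cube_I)
  fix k assume "k < n"
  then show "sign_mult n \<theta> t k \<in> {-1, 1}"
    using assms(1)[of k] cube_sign[OF assms(2), of k] by (auto simp: sign_mult_def)
qed (simp add: sign_mult_def)

lemma sign_mult_involution:
  assumes "\<And>k. k < n \<Longrightarrow> \<theta> k \<in> {-1, 1}" "t \<in> cube n"
  shows "sign_mult n \<theta> (sign_mult n \<theta> t) = t"
proof
  fix k
  show "sign_mult n \<theta> (sign_mult n \<theta> t) k = t k"
  proof (cases "k < n")
    case True
    then show ?thesis using assms(1)[of k] by (auto simp: sign_mult_def)
  next
    case False
    then show ?thesis using cube_outside[OF assms(2), of k] by (simp add: sign_mult_def)
  qed
qed

lemma sign_mult_bij:
  assumes "\<And>k. k < n \<Longrightarrow> \<theta> k \<in> {-1, 1}"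
  shows "bij_betw (sign_mult n \<theta>) (cube n) (cube n)"
  using assms by (intro bij_betw_byWitness[where f' = "sign_mult n \<theta>"])
    (auto simp: sign_mult_involution intro!: sign_mult_cube)

text \<open>
  Events that depend on disjoint sets of coordinates are independent: exchanging the tails
  of two points of the cube is an involution.
\<close>

lemma cube_independent:
  assumes A: "A \<subseteq> cube n" and B: "B \<subseteq> cube n"
    and A_head: "\<And>s t. s \<in> A \<Longrightarrow> t \<in> cube n \<Longrightarrow> (\<forall>k<j. s k = t k) \<Longrightarrow> t \<in> A"
    and B_tail: "\<And>s t. s \<in> B \<Longrightarrow> t \<in> cube n \<Longrightarrow> (\<forall>k\<ge>j. s k = t k) \<Longrightarrow> t \<in> B"
  shows "card (A \<inter> B) * 2 ^ n = card A * card B"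
proof -
  define swap where "swap = (\<lambda>(s :: nat \<Rightarrow> complex, t :: nat \<Rightarrow> complex).
    (\<lambda>k. if k < j then s k else t k, \<lambda>k. if k < j then t k else s k))"
  have swap2: "swap (swap z) = z" for z
    by (cases z) (simp add: swap_def fun_eq_iff)
  have mix: "(\<lambda>k. if k < j then s k else t k) \<in> cube n" if "s \<in> cube n" "t \<in> cube n" for s t
  proof (rule cube_I)
    fix k assume "k < n"
    then show "(if k < j then s k else t k) \<in> {-1, 1}"
      using cube_sign[OF that(1), of k] cube_sign[OF that(2), of k] by auto
  next
    fix k assume "\<not> k < n"
    then show "(if k < j then s k else t k) = undefined"
      using cube_outside[OF that(1), of k] cube_outside[OF that(2), of k] by simp
  qed
  have "bij_betw swap (A \<times> B) ((A \<inter> B) \<times> cube n)"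
  proof (rule bij_betw_byWitness[where f' = swap])
    show "swap ` (A \<times> B) \<subseteq> (A \<inter> B) \<times> cube n"
    proof
      fix z assume "z \<in> swap ` (A \<times> B)"
      then obtain s t where st: "s \<in> A" "t \<in> B" and z: "z = swap (s, t)" by blast
      have c: "s \<in> cube n" "t \<in> cube n" using st A B by blast+
      have "(\<lambda>k. if k < j then s k else t k) \<in> A"
        by (rule A_head[OF st(1)]) (simp_all add: mix[OF c])
      moreover have "(\<lambda>k. if k < j then s k else t k) \<in> B"
        by (rule B_tail[OF st(2)]) (simp_all add: mix[OF c])
      moreover have "(\<lambda>k. if k < j then t k else s k) \<in> cube n"
        by (rule mix[OF c(2) c(1)])
      ultimately show "z \<in> (A \<inter> B) \<times> cube n"
        unfolding z swap_def by (simp only: prod.case mem_Sigma_iff Int_iff simp_thms)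
    qed
    show "swap ` ((A \<inter> B) \<times> cube n) \<subseteq> A \<times> B"
    proof
      fix z assume "z \<in> swap ` ((A \<inter> B) \<times> cube n)"
      then obtain s t where st: "s \<in> A" "s \<in> B" "t \<in> cube n" and z: "z = swap (s, t)" by blast
      have c: "s \<in> cube n" using st A by blast
      have "(\<lambda>k. if k < j then s k else t k) \<in> A"
        by (rule A_head[OF st(1)]) (simp_all add: mix[OF c st(3)])
      moreover have "(\<lambda>k. if k < j then t k else s k) \<in> B"
        by (rule B_tail[OF st(2)]) (simp_all add: mix[OF st(3) c])
      ultimately show "z \<in> A \<times> B"
        unfolding z swap_def by (simp only: prod.case mem_Sigma_iff Int_iff simp_thms)
    qed
  qed (simp_all add: swap2)
  then have "card (A \<times> B) = card ((A \<inter> B) \<times> cube n)"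
    by (rule bij_betw_same_card)
  then show ?thesis
    by (simp add: card_cartesian_product card_cube)
qed

text \<open>
  \<open>E\<close> is covered by its part in \<open>T\<close> and the mirror image of that part.
\<close>

lemma card_le_twice_by_flip:
  assumes "E \<subseteq> cube n" and \<theta>: "\<And>k. k < n \<Longrightarrow> \<theta> k \<in> {-1, 1}"
    and inv: "\<And>t. t \<in> E \<Longrightarrow> sign_mult n \<theta> t \<in> E"
    and T: "\<And>t. t \<in> E \<Longrightarrow> t \<in> T \<or> sign_mult n \<theta> t \<in> T"
  shows "card E \<le> 2 * card (E \<inter> T)"
proof -
  have fin: "finite E" using assms(1) finite_cube finite_subset by blast
  have "E \<subseteq> (E \<inter> T) \<union> sign_mult n \<theta> ` (E \<inter> T)"
  proof
    fix t assume t: "t \<in> E"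
    have "t = sign_mult n \<theta> (sign_mult n \<theta> t)"
      using sign_mult_involution[OF \<theta>] t assms(1) by auto
    then show "t \<in> (E \<inter> T) \<union> sign_mult n \<theta> ` (E \<inter> T)"
      using T[OF t] inv[OF t] t by blast
  qed
  then have "card E \<le> card ((E \<inter> T) \<union> sign_mult n \<theta> ` (E \<inter> T))"
    using fin by (intro card_mono) auto
  also have "\<dots> \<le> card (E \<inter> T) + card (sign_mult n \<theta> ` (E \<inter> T))"
    by (rule card_Un_le)
  also have "\<dots> \<le> 2 * card (E \<inter> T)"
    using card_image_le[of "E \<inter> T" "sign_mult n \<theta>"] fin by simp
  finally show ?thesis .
qed

context quasi_normed
begin

text \<open>
  Kahane's inequality.  If the full sum is large, let \<open>j\<close> be the first index at which a partial
  sum exceeds \<open>K u\<close>.  The terms from \<open>j\<close> on must have a large sum as well, and this is independent of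
  the past: multiplying the later signs by the sign of index \<open>j\<close> preserves the event of first
  passage at \<open>j\<close> and turns the size of that sum into a function of the later signs alone.  Both the partial sums and the
  remainders are half-sums of the full sum and of a flipped copy of it, which is equidistributed.
\<close>

lemma kahane_tail:
  fixes x :: "nat \<Rightarrow> 'a" and u :: real and n :: nat
  assumes u: "0 \<le> u"
  defines "S \<equiv> \<lambda>t. \<Sum>k<n. smul (t k) (x k)"
  shows "card {t\<in>cube n. N (S t) > 2 * K\<^sup>2 * u} * 2 ^ n \<le> 4 * (card {t\<in>cube n. N (S t) > u})\<^sup>2"
proof -
  define P where "P j t = (\<Sum>k<j. smul (t k) (x k))" for j and t :: "nat \<Rightarrow> complex"
  define R where "R j t = (\<Sum>k=j..<n. smul (t k) (x k))" for j and t :: "nat \<Rightarrow> complex"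
  define T where "T = {t\<in>cube n. N (S t) > u}"
  define E where "E j = {t\<in>cube n. N (P (Suc j) t) > K * u \<and> (\<forall>i\<le>j. N (P i t) \<le> K * u)}" for j
  define H where "H j = {t\<in>cube n. N (R j t) > K * u}" for j
  have S_split: "S t = P j t + R j t" if "j \<le> n" for j t
    unfolding S_def P_def R_def using that
    by (metis atLeast0LessThan le0 sum.atLeastLessThan_concat)
  \<comment> \<open>a large half-sum of two vectors forces one of them to be large\<close>
  have half: "N y > u \<or> N z > u" if "y + z = smul 2 v" "N v > K * u" for y z v
  proof (rule ccontr)
    assume "\<not> (N y > u \<or> N z > u)"
    then have "K * (N y + N z) \<le> K * (u + u)"
      using const_ge_1 by (intro mult_left_mono) auto
    moreover have "2 * N v = N (y + z)"
      using that(1) N_scale[of 2 v] by simp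
    ultimately show False
      using N_add[of y z] that(2) by simp
  qed
  have two: "smul 2 v = v + v" for v
    using scale_left_distrib[of 1 1 v] by simp
  have P_cong: "P i s = P i t" if "\<forall>k<j. s k = t k" "i \<le> j" for i j s t
    unfolding P_def using that by (intro sum.cong) auto
  have finT: "finite T" and finE: "finite (E j)" for j
    unfolding T_def E_def using finite_cube by auto
  have E_sub: "E j \<subseteq> cube n" for j by (auto simp: E_def)
  have E_head: "t \<in> E j" if "s \<in> E j" "t \<in> cube n" "\<forall>k<Suc j. s k = t k" for s t j
    using that P_cong[OF that(3)] by (auto simp: E_def)

  have cardE: "card (E j) \<le> 2 * card (E j \<inter> T)" if j: "j < n" for j
  proof (rule card_le_twice_by_flip[where n = n and \<theta> = "\<lambda>k. if k \<le> j then 1 else -1"])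
    let ?f = "sign_mult n (\<lambda>k. if k \<le> j then 1 else -1)"
    fix t assume t: "t \<in> E j"
    have ft: "?f t \<in> cube n"
      using t E_sub by (intro sign_mult_cube) auto
    show "?f t \<in> E j"
      by (rule E_head[OF t ft]) (use j in \<open>auto simp: sign_mult_def\<close>)
    have "P (Suc j) (?f t) = P (Suc j) t"
      unfolding P_def by (intro sum.cong) (use j in \<open>auto simp: sign_mult_def\<close>)
    moreover have "R (Suc j) (?f t) = - R (Suc j) t"
      unfolding R_def sum_negf[symmetric] by (intro sum.cong) (auto simp: sign_mult_def)
    ultimately have "S t + S (?f t) = smul 2 (P (Suc j) t)"
      using S_split[of "Suc j"] j by (simp add: two)
    then show "t \<in> T \<or> ?f t \<in> T"
      using half[of "S t" "S (?f t)" "P (Suc j) t"] t ft by (auto simp: E_def T_def)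
  qed (use E_sub in auto)

  have cardH: "card (H j) \<le> 2 * card T" if j: "j < n" for j
  proof -
    have "card (H j) \<le> 2 * card (H j \<inter> T)"
    proof (rule card_le_twice_by_flip[where n = n and \<theta> = "\<lambda>k. if k < j then -1 else 1"])
      let ?f = "sign_mult n (\<lambda>k. if k < j then -1 else 1)"
      fix t assume t: "t \<in> H j"
      have ft: "?f t \<in> cube n"
        using t by (intro sign_mult_cube) (auto simp: H_def)
      have Rf: "R j (?f t) = R j t"
        unfolding R_def by (intro sum.cong) (auto simp: sign_mult_def)
      then show "?f t \<in> H j"
        using t ft by (auto simp: H_def)
      have "P j (?f t) = - P j t"
        unfolding P_def sum_negf[symmetric] by (intro sum.cong) (use j in \<open>auto simp: sign_mult_def\<close>)
      then have "S t + S (?f t) = smul 2 (R j t)"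
        using Rf S_split[of j] j by (simp add: two)
      then show "t \<in> T \<or> ?f t \<in> T"
        using half[of "S t" "S (?f t)" "R j t"] t ft by (auto simp: H_def T_def)
    qed (auto simp: H_def)
    also have "\<dots> \<le> 2 * card T"
      using finT by (intro mult_left_mono card_mono) auto
    finally show ?thesis .
  qed

  have indep: "card (E j \<inter> H j) * 2 ^ n = card (E j) * card (H j)" if j: "j < n" for j
  proof -
    \<comment> \<open>\<open>\<phi>\<close> multiplies the later signs by the sign at \<open>j\<close>; it turns \<open>H j\<close> into \<open>H'\<close>, which does not
      depend on the signs up to \<open>j\<close>\<close>
    define H' where "H' = {t\<in>cube n. N (x j + R (Suc j) t) > K * u}"
    define \<phi> where "\<phi> t = (\<lambda>k\<in>{..<n}. if k \<le> j then t k else t j * t k)" for t :: "nat \<Rightarrow> complex"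
    have \<phi>_cube: "\<phi> t \<in> cube n" if "t \<in> cube n" for t
    proof (rule cube_I)
      fix k assume "k < n"
      then show "\<phi> t k \<in> {-1, 1}"
        using cube_sign[OF that, of k] cube_sign[OF that j] by (auto simp: \<phi>_def)
    qed (simp add: \<phi>_def)
    have \<phi>2: "\<phi> (\<phi> t) = t" if "t \<in> cube n" for t
    proof
      fix k
      have "t j * t j = 1" using cube_sign[OF that j] by auto
      then show "\<phi> (\<phi> t) k = t k"
        using cube_outside[OF that, of k] j by (cases "k < n") (auto simp: \<phi>_def simp flip: mult.assoc)
    qed
    have NR: "N (R j (\<phi> t)) = N (x j + R (Suc j) t)" if t: "t \<in> cube n" for t
    proof -
      have "R j (\<phi> t) = smul (t j) (x j) + (\<Sum>k=Suc j..<n. smul (t j * t k) (x k))"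
        unfolding R_def using j by (subst sum.atLeast_Suc_lessThan) (auto simp: \<phi>_def)
      also have "\<dots> = smul (t j) (x j + R (Suc j) t)"
        by (simp add: R_def scale_right_distrib scale_sum_right)
      finally show ?thesis
        using cube_sign[OF t j] by (auto simp: N_scale)
    qed
    have card_eq: "card (A \<inter> H j) = card (A \<inter> H')"
      if A: "A \<subseteq> cube n" "\<And>t. t \<in> A \<Longrightarrow> \<phi> t \<in> A" for A
    proof -
      have "bij_betw \<phi> (A \<inter> H') (A \<inter> H j)"
      proof (rule bij_betw_byWitness[where f' = \<phi>])
        show "\<phi> ` (A \<inter> H') \<subseteq> A \<inter> H j"
          using A(2) NR \<phi>_cube by (auto simp: H_def H'_def)
        show "\<phi> ` (A \<inter> H j) \<subseteq> A \<inter> H'"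
          using A(2) NR[OF \<phi>_cube] \<phi>_cube by (auto simp: H_def H'_def \<phi>2)
      qed (use A \<phi>2 in auto)
      then show ?thesis using bij_betw_same_card by fastforce
    qed
    have E\<phi>: "\<phi> t \<in> E j" if "t \<in> E j" for t
      by (rule E_head[OF that \<phi>_cube]) (use that E_sub j in \<open>auto simp: \<phi>_def\<close>)
    have "card (E j \<inter> H j) * 2 ^ n = card (E j \<inter> H') * 2 ^ n"
      using card_eq[OF E_sub E\<phi>] by simp
    also have "\<dots> = card (E j) * card H'"
    proof (rule cube_independent[where j = "Suc j"])
      fix s t assume st: "s \<in> H'" "t \<in> cube n" "\<forall>k\<ge>Suc j. s k = t k"
      have "R (Suc j) s = R (Suc j) t"
        unfolding R_def using st(3) by (intro sum.cong) auto
      then show "t \<in> H'" using st by (auto simp: H'_def)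
    next
      fix s t assume "s \<in> E j" "t \<in> cube n" "\<forall>k<Suc j. s k = t k"
      then show "t \<in> E j" by (rule E_head)
    qed (auto simp: H'_def E_def)
    also have "card H' = card (cube n \<inter> H')"
      by (rule arg_cong[where f = card]) (auto simp: H'_def)
    also have "\<dots> = card (cube n \<inter> H j)"
      using card_eq[of "cube n"] \<phi>_cube by auto
    also have "\<dots> = card (H j)"
      by (rule arg_cong[where f = card]) (auto simp: H_def)
    finally show ?thesis .
  qed

  have cover: "{t\<in>cube n. N (S t) > 2 * K\<^sup>2 * u} \<subseteq> (\<Union>j<n. E j \<inter> H j)"
  proof
    fix t assume "t \<in> {t\<in>cube n. N (S t) > 2 * K\<^sup>2 * u}"
    then have t: "t \<in> cube n" and big: "N (S t) > 2 * K\<^sup>2 * u" by auto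
    \<comment> \<open>the full sum is itself a partial sum exceeding \<open>K u\<close>, so a first passage occurs\<close>
    have "K * u \<le> K * (K * u)"
      using const_ge_1 u mult_right_mono[of 1 K "K * u"] by auto
    also have "\<dots> \<le> 2 * K\<^sup>2 * u"
      using const_ge_1 u by (auto simp: power2_eq_square mult_ac)
    finally have "N (P n t) > K * u"
      using big by (simp add: S_def P_def)
    then have ex: "\<exists>i. N (P i t) > K * u" by blast
    define i where "i = (LEAST i. N (P i t) > K * u)"
    have i: "N (P i t) > K * u" and least: "\<And>l. l < i \<Longrightarrow> N (P l t) \<le> K * u"
      unfolding i_def using LeastI_ex[OF ex] not_less_Least by force+
    have "i \<le> n"
      unfolding i_def using \<open>N (P n t) > K * u\<close> by (rule Least_le)
    have "0 \<le> K * u" using u const_ge_1 by simp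
    then have "i \<noteq> 0"
      using i by (intro notI) (simp add: P_def N_zero)
    then obtain j where j: "i = Suc j" by (cases i) auto
    have "t \<in> E j"
      using t i least by (auto simp: E_def j)
    moreover have "N (R j t) > K * u"
    proof (rule ccontr)
      assume "\<not> N (R j t) > K * u"
      then have "K * (N (P j t) + N (R j t)) \<le> K * (K * u + K * u)"
        using least[of j] const_ge_1 by (intro mult_left_mono add_mono) (auto simp: j)
      then have "N (S t) \<le> 2 * K\<^sup>2 * u"
        using N_add[of "P j t" "R j t"] S_split[of j t] \<open>i \<le> n\<close>
        by (simp add: j power2_eq_square algebra_simps)
      then show False using big by simp
    qed
    ultimately show "t \<in> (\<Union>j<n. E j \<inter> H j)"
      using \<open>i \<le> n\<close> t by (auto simp: H_def j intro!: bexI[of _ j])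
  qed
  have disj: "E i \<inter> E j = {}" if "i \<noteq> j" for i j
  proof -
    have "E a \<inter> E b = {}" if "a < b" for a b :: nat
      using that unfolding E_def by (auto dest!: spec[of _ "Suc a"])
    then show ?thesis using that by (metis inf_commute linorder_neqE_nat)
  qed
  have "card {t\<in>cube n. N (S t) > 2 * K\<^sup>2 * u} * 2 ^ n \<le> card (\<Union>j<n. E j \<inter> H j) * 2 ^ n"
    using cover finE by (intro mult_right_mono card_mono) auto
  also have "\<dots> \<le> (\<Sum>j<n. card (E j \<inter> H j)) * 2 ^ n"
    by (intro mult_right_mono card_UN_le) auto
  also have "\<dots> = (\<Sum>j<n. card (E j) * card (H j))"
    by (simp add: sum_distrib_right indep)
  also have "\<dots> \<le> (\<Sum>j<n. (2 * card (E j \<inter> T)) * (2 * card T))"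
    by (intro sum_mono mult_mono cardE cardH) auto
  also have "\<dots> = 4 * card T * (\<Sum>j<n. card (E j \<inter> T))"
    by (simp add: sum_distrib_left sum_distrib_right mult_ac)
  also have "(\<Sum>j<n. card (E j \<inter> T)) = card (\<Union>j<n. E j \<inter> T)"
    using finE disj by (intro card_UN_disjoint[symmetric]) auto
  also have "4 * card T * card (\<Union>j<n. E j \<inter> T) \<le> 4 * card T * card T"
    using finT by (intro mult_left_mono card_mono) auto
  finally show ?thesis
    by (simp add: T_def power2_eq_square mult_ac)
qed

end

abbreviation rademacher_norm ::
    "(complex \<Rightarrow> 'a::ab_group_add \<Rightarrow> 'a) \<Rightarrow> ('a \<Rightarrow> real) \<Rightarrow> real \<Rightarrow> nat \<Rightarrow> (nat \<Rightarrow> 'a) \<Rightarrow> real" where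
  "rademacher_norm smul N p n x \<equiv>
     lpn (cube n) (\<lambda>_. 1 / 2 ^ n) p (\<lambda>t. N (\<Sum>k<n. smul (t k) (x k)))"

text \<open>
  A discrete layer-cake formula, with levels in geometric progression.
\<close>

lemma powr_layer_bound:
  fixes L t y q :: real
  assumes "0 < t" "1 \<le> L" "0 < q" "0 \<le> y" "y \<le> L ^ J * t"
  shows "y powr q \<le> t powr q + (\<Sum>j<J. (L ^ Suc j * t) powr q * of_bool (L ^ j * t < y))"
  using assms(5)
proof (induction J)
  case 0
  then show ?case using assms by (auto intro: powr_mono2)
next
  case (Suc J)
  define g where "g j = (L ^ Suc j * t) powr q * of_bool (L ^ j * t < y)" for j
  have g: "0 \<le> g j" for j by (simp add: g_def)
  have "y powr q \<le> t powr q + ((\<Sum>j<J. g j) + g J)"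
  proof (cases "y \<le> L ^ J * t")
    case True
    then show ?thesis using Suc.IH g[of J] unfolding g_def[symmetric] by linarith
  next
    case False
    then have "y powr q \<le> g J"
      using assms Suc.prems unfolding g_def by (auto intro!: powr_mono2)
    moreover have "0 \<le> (\<Sum>j<J. g j)"
      by (intro sum_nonneg g)
    moreover have "0 \<le> t powr q" by simp
    ultimately show ?thesis by linarith
  qed
  then show ?case unfolding g_def[symmetric] by simp
qed

text \<open>
  Kahane's tail estimate makes the tails decay faster than any given geometric rate, starting
  from a level that Markov's inequality compares with the \<open>p\<close>-th moment.
\<close>

theorem khintchine_kahane:
  fixes p q K :: real
  assumes K: "1 \<le> K" and p: "0 < p" and q: "0 < q"
  shows "\<exists>C\<ge>0. \<forall>(smul :: complex \<Rightarrow> 'a::ab_group_add \<Rightarrow> 'a) N n x. quasi_normed smul N K \<longrightarrow>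
           rademacher_norm smul N q n x \<le> C * rademacher_norm smul N p n x"
proof -
  define L where "L = 2 * K\<^sup>2"
  have L: "2 \<le> L" unfolding L_def using K by (simp add: one_le_power)
  \<comment> \<open>\<open>\<kappa>\<close> is a rate at which the tails beat the factor \<open>L\<^sup>q\<close> of the layers; \<open>4 \<epsilon> = \<kappa>\<close> starts the
    quadratic decay\<close>
  define \<kappa> where "\<kappa> = 1 / (2 * L powr q)"
  define \<epsilon> where "\<epsilon> = \<kappa> / 4"
  have Lq: "1 \<le> L powr q" using L q by (intro ge_one_powr_ge_zero) auto
  have \<kappa>: "0 < \<kappa>" "\<kappa> \<le> 1" using L Lq by (auto simp: \<kappa>_def field_simps)
  have \<epsilon>: "0 < \<epsilon>" "\<epsilon> \<le> 1" using \<kappa> by (auto simp: \<epsilon>_def)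
  define C where "C = (1 + 2 * L powr q) powr (1 / q) * (1 / \<epsilon> powr (1 / p))"
  have "rademacher_norm smul N q n x \<le> C * rademacher_norm smul N p n x"
    if "quasi_normed smul N K" for smul :: "complex \<Rightarrow> 'a \<Rightarrow> 'a" and N n x
  proof -
    interpret quasi_normed smul N K by fact
    define S where "S t = (\<Sum>k<n. smul (t k) (x k))" for t
    define m where "m = rademacher_norm smul N p n x"
    have mp: "m powr p = (\<Sum>t\<in>cube n. N (S t) powr p) / 2 ^ n"
      unfolding m_def S_def using p by (subst lpn_powr) (auto simp: sum_divide_distrib)
    have m0: "0 \<le> m" by (simp add: m_def lpn_nonneg)
    show ?thesis
    proof (cases "m = 0")
      case True
      then have "(\<Sum>t\<in>cube n. N (S t) powr p) = 0"
        using mp p by simp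
      then have "\<forall>t\<in>cube n. N (S t) powr p = 0"
        using finite_cube by (subst (asm) sum_nonneg_eq_0_iff) auto
      then have "rademacher_norm smul N q n x = 0"
        unfolding lpn_def S_def using q by simp
      then show ?thesis using True by (simp add: m_def)
    next
      case False
      then have m: "0 < m" using m0 by simp
      define t where "t = m / \<epsilon> powr (1 / p)"
      have t: "0 < t" using m \<epsilon> by (simp add: t_def)
      have tp: "\<epsilon> * t powr p = m powr p"
        using m \<epsilon> p by (simp add: t_def powr_divide powr_powr)
      define c where "c u = real (card {s\<in>cube n. N (S s) > u}) / 2 ^ n" for u
      have c0: "0 \<le> c u" for u by (simp add: c_def)
      have markov: "c t \<le> \<epsilon>"
      proof -
        have "real (card {s\<in>cube n. N (S s) > t}) * t powr p = (\<Sum>s\<in>{s\<in>cube n. N (S s) > t}. t powr p)"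
          by simp
        also have "\<dots> \<le> (\<Sum>s\<in>{s\<in>cube n. N (S s) > t}. N (S s) powr p)"
          using t p by (intro sum_mono powr_mono2) auto
        also have "\<dots> \<le> (\<Sum>s\<in>cube n. N (S s) powr p)"
          using finite_cube by (intro sum_mono2) auto
        also have "\<dots> = 2 ^ n * (\<epsilon> * t powr p)"
          unfolding tp mp by simp
        finally show ?thesis
          using t by (simp add: c_def field_simps)
      qed
      have kahane: "c (L * u) \<le> 4 * (c u)\<^sup>2" if "0 \<le> u" for u
      proof -
        have "card {s\<in>cube n. N (S s) > L * u} * 2 ^ n \<le> 4 * (card {s\<in>cube n. N (S s) > u})\<^sup>2"
          using kahane_tail[OF that, of n x] unfolding S_def L_def .
        then have "real (card {s\<in>cube n. N (S s) > L * u} * 2 ^ n) \<le> real (4 * (card {s\<in>cube n. N (S s) > u})\<^sup>2)"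
          using of_nat_le_iff by blast
        then show ?thesis
          by (simp add: c_def field_simps power2_eq_square)
      qed
      have decay: "c (L ^ j * t) \<le> \<epsilon> * \<kappa> ^ j" for j
      proof (induction j)
        case 0
        then show ?case using markov by simp
      next
        case (Suc j)
        have "c (L ^ Suc j * t) \<le> 4 * (c (L ^ j * t))\<^sup>2"
          using kahane[of "L ^ j * t"] L t by (simp add: mult_ac)
        also have "\<dots> \<le> 4 * (\<epsilon> * \<kappa> ^ j)\<^sup>2"
          using Suc c0 by (intro mult_left_mono power_mono) auto
        also have "\<dots> = (\<epsilon> * \<kappa> ^ Suc j) * \<kappa> ^ j"
          by (simp add: \<epsilon>_def power2_eq_square)
        also have "\<dots> \<le> \<epsilon> * \<kappa> ^ Suc j"
          using \<kappa> \<epsilon> by (intro mult_left_le power_le_one) auto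
        finally show ?case .
      qed
      define B where "B = Max ((\<lambda>s. N (S s)) ` cube n)"
      have B: "N (S s) \<le> B" if "s \<in> cube n" for s
        unfolding B_def using that finite_cube by (intro Max_ge) auto
      obtain J where "B / t < L ^ J"
        using real_arch_pow[of L "B / t"] L by auto
      then have J: "N (S s) \<le> L ^ J * t" if "s \<in> cube n" for s
        using B[OF that] t by (simp add: field_simps)
      define A where "A j = (L ^ Suc j * t) powr q" for j
      have count: "(\<Sum>s\<in>cube n. 1 / 2 ^ n * of_bool (u < N (S s))) = c u" for u
      proof -
        have "(\<Sum>s\<in>cube n. of_bool (u < N (S s))) = (\<Sum>s\<in>{s\<in>cube n. u < N (S s)}. 1 :: real)"
          unfolding of_bool_def by (rule sum.inter_filter[OF finite_cube, symmetric])
        then show ?thesis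
          unfolding sum_distrib_left[symmetric] by (simp add: c_def)
      qed
      have "(\<Sum>s\<in>cube n. 1 / 2 ^ n * N (S s) powr q) \<le>
          (\<Sum>s\<in>cube n. 1 / 2 ^ n * (t powr q + (\<Sum>j<J. A j * of_bool (L ^ j * t < N (S s)))))"
        using powr_layer_bound[OF t _ q N_nonneg J] L
        unfolding A_def by (intro sum_mono mult_left_mono) auto
      also have "\<dots> = (\<Sum>s\<in>cube n. 1 / 2 ^ n * t powr q)
          + (\<Sum>s\<in>cube n. \<Sum>j<J. A j * (1 / 2 ^ n * of_bool (L ^ j * t < N (S s))))"
        unfolding distrib_left sum.distrib sum_distrib_left by (simp only: mult_ac)
      also have "\<dots> = t powr q + (\<Sum>j<J. A j * c (L ^ j * t))"
      proof (rule arg_cong2[where f = "(+)"])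
        show "(\<Sum>s\<in>cube n. 1 / 2 ^ n * t powr q) = t powr q"
          by (simp add: card_cube)
        show "(\<Sum>s\<in>cube n. \<Sum>j<J. A j * (1 / 2 ^ n * of_bool (L ^ j * t < N (S s))))
            = (\<Sum>j<J. A j * c (L ^ j * t))"
          by (subst sum.swap, rule sum.cong[OF refl]) (simp only: count[symmetric] sum_distrib_left)
      qed
      also have "\<dots> \<le> t powr q + (\<Sum>j<J. (L powr q * t powr q) * (1 / 2) ^ j)"
      proof (intro add_left_mono sum_mono)
        fix j
        have Lj: "(L ^ Suc j * t) powr q = L powr q * t powr q * (L powr q) ^ j"
          using L t by (simp add: powr_mult powr_power powr_realpow[symmetric] powr_powr mult_ac)
        have "\<epsilon> * \<kappa> ^ j \<le> \<kappa> ^ j"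
          using \<epsilon> \<kappa> by (intro mult_left_le_one_le) auto
        then have "A j * c (L ^ j * t) \<le> (L ^ Suc j * t) powr q * (1 * \<kappa> ^ j)"
          using decay[of j] unfolding A_def by (intro mult_left_mono) auto
        also have "\<dots> = (L powr q * t powr q) * (L powr q * \<kappa>) ^ j"
          unfolding Lj by (simp add: power_mult_distrib)
        also have "L powr q * \<kappa> = 1 / 2" using L by (simp add: \<kappa>_def)
        finally show "A j * c (L ^ j * t) \<le> (L powr q * t powr q) * (1 / 2) ^ j" .
      qed
      also have "\<dots> = t powr q + (L powr q * t powr q) * (\<Sum>j<J. (1 / 2) ^ j)"
        by (simp add: sum_distrib_left)
      also have "\<dots> \<le> t powr q + (L powr q * t powr q) * 2"
      proof (intro add_left_mono mult_left_mono)
        show "(\<Sum>j<J. (1 / 2 :: real) ^ j) \<le> 2"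
          by (subst geometric_sum) (auto simp: field_simps)
      qed auto
      also have "\<dots> = t powr q * (1 + 2 * L powr q)" by (simp add: algebra_simps)
      finally have "rademacher_norm smul N q n x \<le> (t powr q * (1 + 2 * L powr q)) powr (1 / q)"
        unfolding lpn_def S_def using q by (intro powr_mono2 sum_nonneg) auto
      also have "\<dots> = t * (1 + 2 * L powr q) powr (1 / q)"
        using t q by (simp add: powr_mult powr_powr)
      also have "\<dots> = C * m" by (simp add: C_def t_def)
      finally show ?thesis by (simp add: m_def)
    qed
  qed
  moreover have "0 \<le> C" by (simp add: C_def)
  ultimately show ?thesis by blast
qed

section \<open>Sets of small probability\<close>

context coefficient_quasi_seminorm
begin

text \<open>
  A monotone function of sets of coordinates that is subadditive up to the factor \<open>K\<close>: the
  submeasure \<open>\<Phi>\<close> of the introduction.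
\<close>

definition disc_sup :: "nat set \<Rightarrow> real" where
  "disc_sup A = Sup {\<Psi> a | a. (\<forall>k. cmod (a k) \<le> 1) \<and> (\<forall>k. k \<notin> A \<longrightarrow> a k = 0)}"

lemma disc_sup_upper:
  assumes "\<And>k. cmod (a k) \<le> 1" "\<And>k. k \<notin> A \<Longrightarrow> a k = 0"
  shows "\<Psi> a \<le> disc_sup A"
proof -
  obtain B where "\<And>a. (\<forall>k<n. cmod (a k) \<le> 1) \<Longrightarrow> \<Psi> a \<le> B"
    using bounded_on_polydisc by blast
  then have "bdd_above {\<Psi> a | a. (\<forall>k. cmod (a k) \<le> 1) \<and> (\<forall>k. k \<notin> A \<longrightarrow> a k = 0)}"
    by (intro bdd_aboveI[of _ B]) auto
  then show ?thesis
    unfolding disc_sup_def using assms by (intro cSup_upper) auto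
qed

lemma disc_sup_least:
  assumes "\<And>a. (\<And>k. cmod (a k) \<le> 1) \<Longrightarrow> (\<And>k. k \<notin> A \<Longrightarrow> a k = 0) \<Longrightarrow> \<Psi> a \<le> c"
  shows "disc_sup A \<le> c"
  unfolding disc_sup_def
proof (rule cSup_least)
  show "{\<Psi> a | a. (\<forall>k. cmod (a k) \<le> 1) \<and> (\<forall>k. k \<notin> A \<longrightarrow> a k = 0)} \<noteq> {}"
    by (auto intro!: exI[of _ "\<lambda>k. 0"])
qed (use assms in auto)

lemma disc_sup_nonneg: "0 \<le> disc_sup A"
  using disc_sup_upper[of "\<lambda>k. 0" A] zero by simp

lemma disc_sup_mono: "A \<subseteq> B \<Longrightarrow> disc_sup A \<le> disc_sup B"
  by (rule disc_sup_least, rule disc_sup_upper) auto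

lemma disc_sup_null:
  assumes "\<And>k. k \<in> A \<Longrightarrow> \<not> k < n"
  shows "disc_sup A \<le> 0"
proof (rule disc_sup_least)
  fix a :: "nat \<Rightarrow> complex" assume "\<And>k. k \<notin> A \<Longrightarrow> a k = 0"
  then have "\<Psi> a = \<Psi> (\<lambda>k. 0)" using assms by (intro local) auto
  then show "\<Psi> a \<le> 0" by (simp add: zero)
qed

lemma disc_sup_Un: "disc_sup (A \<union> B) \<le> K * (disc_sup A + disc_sup B)"
proof (rule disc_sup_least)
  fix a :: "nat \<Rightarrow> complex"
  assume a: "\<And>k. cmod (a k) \<le> 1" "\<And>k. k \<notin> A \<union> B \<Longrightarrow> a k = 0"
  have "\<Psi> a = \<Psi> (\<lambda>k. (if k \<in> A then a k else 0) + (if k \<in> A then 0 else a k))"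
    by (rule arg_cong[where f = \<Psi>]) auto
  also have "\<dots> \<le> K * (\<Psi> (\<lambda>k. if k \<in> A then a k else 0) + \<Psi> (\<lambda>k. if k \<in> A then 0 else a k))"
    by (rule triangle)
  also have "\<dots> \<le> K * (disc_sup A + disc_sup B)"
    using K_ge_1 a by (intro mult_left_mono add_mono disc_sup_upper) auto
  finally show "\<Psi> a \<le> K * (disc_sup A + disc_sup B)" .
qed

lemma scaled_le_disc_sup:
  assumes "0 < r" "\<And>k. cmod (a k) \<le> r" "\<And>k. k \<notin> A \<Longrightarrow> a k = 0"
  shows "\<Psi> a \<le> r * disc_sup A"
proof -
  have "\<Psi> a = \<Psi> (\<lambda>k. of_real r * (a k / of_real r))"
    using assms by (intro local) auto
  also have "\<dots> = r * \<Psi> (\<lambda>k. a k / of_real r)"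
    unfolding scale using assms by simp
  also have "\<dots> \<le> r * disc_sup A"
    using assms by (intro mult_left_mono disc_sup_upper) (auto simp: norm_divide divide_le_eq)
  finally show ?thesis .
qed

text \<open>
  This is what remains of a cotype, or lower \<open>q\<close>-estimate, at the level of a submeasure.
\<close>

definition exhaustive :: "real \<Rightarrow> real \<Rightarrow> bool" where
  "exhaustive C \<theta> \<longleftrightarrow> (\<forall>m (A :: nat \<Rightarrow> nat set). 0 < m \<and> disjoint_family_on A {..<m} \<longrightarrow>
     (\<exists>i<m. disc_sup (A i) \<le> C * real m powr (-\<theta>) * disc_sup UNIV))"

text \<open>
  A quantitative form of the fact that an exhaustive submeasure has a control measure: a random
  set containing each point with small probability takes a value of small submeasure.  Draw \<open>m\<close>
  independent copies.  Off the set \<open>B\<close> of points covered twice they are disjoint, so that one of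
  them is small off \<open>B\<close>; and \<open>B\<close> is itself a random set, which contains each point with a
  probability so much smaller that the argument can be iterated, with \<open>L m\<close> for \<open>m\<close>.  When the
  probability falls below \<open>1 / n\<close>, the empty set occurs.
\<close>

lemma random_set_small:
  assumes C: "0 \<le> C" and \<theta>: "0 < \<theta>" and L: "2 * K \<le> real L powr \<theta>" and ex: "exhaustive C \<theta>"
    and m: "L\<^sup>2 \<le> m" and P: "\<And>k. k < n \<Longrightarrow> measure_pmf.prob P {A. k \<in> A} \<le> 1 / real m ^ 4"
  shows "\<exists>A\<in>set_pmf P. disc_sup A \<le> 2 * K * C * real m powr (-\<theta>) * disc_sup UNIV"
  using m P
proof (induction "Suc n - m" arbitrary: m P rule: less_induct)
  case less
  have "L \<noteq> 0" using L K_ge_1 \<theta> by (intro notI) auto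
  moreover have "L \<noteq> 1" using L K_ge_1 by (intro notI) auto
  ultimately have L2: "2 \<le> L" by linarith
  have "2 ^ 2 \<le> L\<^sup>2" using L2 by (intro power_mono) auto
  then have m4: "4 \<le> m" using less.prems(1) by simp
  show ?case
  proof (cases "n < m")
    case True
    have "measure_pmf.prob P (\<Union>k<n. {A. k \<in> A}) \<le> (\<Sum>k<n. measure_pmf.prob P {A. k \<in> A})"
      by (rule measure_pmf.finite_measure_subadditive_finite) auto
    also have "\<dots> \<le> (\<Sum>k<n. 1 / real m ^ 4)"
      using less.prems(2) by (intro sum_mono) auto
    also have "\<dots> = real n / real m ^ 4" by simp
    also have "\<dots> < 1"
    proof -
      have "real m ^ 1 \<le> real m ^ 4" using m4 by (intro power_increasing) auto
      then show ?thesis using True m4 by (simp add: divide_less_eq)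
    qed
    finally have "measure_pmf.prob P (\<Union>k<n. {A. k \<in> A}) < 1" .
    then have "\<not> set_pmf P \<subseteq> (\<Union>k<n. {A. k \<in> A})"
      using measure_pmf.prob_eq_1[of "\<Union>k<n. {A. k \<in> A}" P] by (auto simp: AE_measure_pmf_iff)
    then obtain A where A: "A \<in> set_pmf P" "\<And>k. k < n \<Longrightarrow> k \<notin> A" by auto
    have "disc_sup A \<le> 0" using A by (intro disc_sup_null) auto
    also have "0 \<le> 2 * K * C * real m powr (-\<theta>) * disc_sup UNIV"
      using C K_ge_1 disc_sup_nonneg by auto
    finally show ?thesis using A by blast
  next
    case False
    define Q where "Q = Pi_pmf {..<m} {} (\<lambda>_. P)"
    define B where "B f = {k. \<exists>i<m. \<exists>j<m. i \<noteq> j \<and> k \<in> f i \<and> k \<in> f j}" for f :: "nat \<Rightarrow> nat set"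
    \<comment> \<open>the probability \<open>m\<^sup>-\<^sup>4\<close> is chosen so that being covered twice, of probability at most
      \<open>m\<^sup>2 m\<^sup>-\<^sup>8\<close>, has probability at most \<open>(L m)\<^sup>-\<^sup>4\<close> as soon as \<open>L\<^sup>2 \<le> m\<close>\<close>
    have pair: "measure_pmf.prob Q {f. k \<in> f i \<and> k \<in> f j} \<le> 1 / real m ^ 4 * (1 / real m ^ 4)"
      if ij: "i < m" "j < m" "i \<noteq> j" and k: "k < n" for i j k
    proof -
      define S where "S l = (if l \<in> {i, j} then {A. k \<in> A} else UNIV)" for l
      have "{f. k \<in> f i \<and> k \<in> f j} = Pi {..<m} S"
        using ij by (auto simp: S_def Pi_def)
      then have "measure_pmf.prob Q {f. k \<in> f i \<and> k \<in> f j} = (\<Prod>l<m. measure_pmf.prob P (S l))"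
        by (simp add: Q_def measure_Pi_pmf_Pi)
      also have "\<dots> = (\<Prod>l\<in>{i, j}. measure_pmf.prob P {A. k \<in> A})"
        using ij by (intro prod.mono_neutral_cong_right) (auto simp: S_def)
      also have "\<dots> = measure_pmf.prob P {A. k \<in> A} * measure_pmf.prob P {A. k \<in> A}"
        using ij by simp
      also have "\<dots> \<le> 1 / real m ^ 4 * (1 / real m ^ 4)"
        using less.prems(2)[OF k] by (intro mult_mono) auto
      finally show ?thesis .
    qed
    have twice: "measure_pmf.prob (map_pmf B Q) {A. k \<in> A} \<le> 1 / real (L * m) ^ 4" if k: "k < n" for k
    proof -
      define I where "I = {(i, j). i < m \<and> j < m \<and> i \<noteq> j}"
      have I: "I \<subseteq> {..<m} \<times> {..<m}" by (auto simp: I_def)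
      then have finI: "finite I" by (rule finite_subset) auto
      have cardI: "card I \<le> m\<^sup>2"
        using card_mono[OF _ I] by (simp add: power2_eq_square)
      have "measure_pmf.prob (map_pmf B Q) {A. k \<in> A} = measure_pmf.prob Q {f. k \<in> B f}"
        by (simp add: vimage_def)
      also have "{f. k \<in> B f} = (\<Union>(i, j)\<in>I. {f. k \<in> f i \<and> k \<in> f j})"
        by (auto simp: B_def I_def)
      also have "measure_pmf.prob Q \<dots> \<le> (\<Sum>z\<in>I. measure_pmf.prob Q (case z of (i, j) \<Rightarrow> {f. k \<in> f i \<and> k \<in> f j}))"
        using finI by (intro measure_pmf.finite_measure_subadditive_finite) auto
      also have "\<dots> \<le> (\<Sum>z\<in>I. 1 / real m ^ 4 * (1 / real m ^ 4))"
        using k pair by (intro sum_mono) (auto simp: I_def)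
      also have "\<dots> = real (card I) * (1 / real m ^ 8)"
        by (simp flip: power_add)
      also have "\<dots> \<le> real (m\<^sup>2) * (1 / real m ^ 8)"
        using cardI by (intro mult_right_mono) (auto simp del: of_nat_power)
      also have "\<dots> = 1 / (real m ^ 2 * real m ^ 4)"
      proof -
        have "real m ^ 8 = real m ^ 2 * (real m ^ 2 * real m ^ 4)" by (simp flip: power_add)
        moreover have "x * (1 / (x * y)) = 1 / y" if "x \<noteq> 0" for x y :: real
          using that by simp
        moreover have "real m ^ 2 \<noteq> 0" using m4 by simp
        ultimately show ?thesis by (simp only: of_nat_power)
      qed
      also have "\<dots> \<le> 1 / (real L ^ 4 * real m ^ 4)"
      proof (rule divide_left_mono)
        have "(L\<^sup>2)\<^sup>2 \<le> m\<^sup>2" using less.prems(1) by (intro power_mono) auto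
        then have "real ((L\<^sup>2)\<^sup>2) \<le> real (m\<^sup>2)" by (simp only: of_nat_le_iff)
        then show "real L ^ 4 * real m ^ 4 \<le> real m ^ 2 * real m ^ 4"
          by (intro mult_right_mono) (auto simp: power_mult[symmetric])
      qed (use m4 L2 in auto)
      finally show ?thesis by (simp add: power_mult_distrib)
    qed
    have "Suc n - L * m < Suc n - m"
    proof -
      have "m < L * m" using m4 L2 by simp
      then show ?thesis using False by linarith
    qed
    moreover have "L\<^sup>2 \<le> L * m"
      using less.prems(1) L2 mult_le_mono[of 1 L "L\<^sup>2" m] by auto
    ultimately have "\<exists>A\<in>set_pmf (map_pmf B Q).
        disc_sup A \<le> 2 * K * C * real (L * m) powr (-\<theta>) * disc_sup UNIV"
      using twice by (intro less.hyps) auto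
    then obtain f where f: "f \<in> set_pmf Q"
      and fB: "disc_sup (B f) \<le> 2 * K * C * real (L * m) powr (-\<theta>) * disc_sup UNIV" by auto
    have fP: "f i \<in> set_pmf P" if "i < m" for i
      using f that by (auto simp: Q_def set_Pi_pmf PiE_dflt_def)
    have "disjoint_family_on (\<lambda>i. f i - B f) {..<m}"
      unfolding disjoint_family_on_def B_def by blast
    then obtain i where i: "i < m" and fi: "disc_sup (f i - B f) \<le> C * real m powr (-\<theta>) * disc_sup UNIV"
      using ex[unfolded exhaustive_def, rule_format, of m "\<lambda>i. f i - B f"] m4 by auto
    have "2 * K * C * real (L * m) powr (-\<theta>) * disc_sup UNIV
        = (2 * K * real L powr (-\<theta>)) * (C * real m powr (-\<theta>) * disc_sup UNIV)"
      by (simp add: powr_mult)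
    also have "\<dots> \<le> 1 * (C * real m powr (-\<theta>) * disc_sup UNIV)"
      using C L L2 disc_sup_nonneg
      by (intro mult_right_mono) (auto simp: powr_minus field_simps)
    finally have B2: "disc_sup (B f) \<le> C * real m powr (-\<theta>) * disc_sup UNIV"
      using fB by simp
    have "disc_sup (f i) \<le> disc_sup ((f i - B f) \<union> B f)"
      by (rule disc_sup_mono) auto
    also have "\<dots> \<le> K * (disc_sup (f i - B f) + disc_sup (B f))"
      by (rule disc_sup_Un)
    also have "\<dots> \<le> K * (C * real m powr (-\<theta>) * disc_sup UNIV + C * real m powr (-\<theta>) * disc_sup UNIV)"
      using K_ge_1 fi B2 by (intro mult_left_mono add_mono) auto
    also have "\<dots> = 2 * K * C * real m powr (-\<theta>) * disc_sup UNIV"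
      by (simp add: algebra_simps)
    finally show ?thesis using fP[OF i] by blast
  qed
qed

end

section \<open>Empirical averages\<close>

text \<open>
  Second moments of independent centred variables add up: in the induction step the mixed term
  vanishes.
\<close>

lemma second_moment_iid:
  fixes X :: "'b \<Rightarrow> real"
  assumes fin: "finite (set_pmf Q)" and bound: "\<And>b. b \<in> set_pmf Q \<Longrightarrow> \<bar>X b\<bar> \<le> c"
    and mean: "measure_pmf.expectation Q X = 0"
  shows "measure_pmf.expectation (Pi_pmf {..<N} d (\<lambda>_. Q)) (\<lambda>f. (\<Sum>j<N. X (f j))\<^sup>2) \<le> real N * c\<^sup>2"
proof (induction N)
  case 0
  then show ?case by simp
next
  case (Suc N)
  let ?R = "Pi_pmf {..<N} d (\<lambda>_. Q)"
  have finR: "finite (set_pmf ?R)"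
    using fin by (auto simp: set_Pi_pmf)
  have int: "integrable (measure_pmf ?R) h" for h :: "(nat \<Rightarrow> 'b) \<Rightarrow> real"
    using finR by (rule integrable_measure_pmf_finite)
  have mean_sum: "measure_pmf.expectation ?R (\<lambda>f. \<Sum>j<N. X (f j)) = 0"
  proof -
    have "measure_pmf.expectation ?R (\<lambda>f. X (f j)) = 0" if "j < N" for j
    proof -
      have "measure_pmf.expectation ?R (\<lambda>f. X (f j)) = measure_pmf.expectation (map_pmf (\<lambda>f. f j) ?R) X"
        by simp
      also have "map_pmf (\<lambda>f. f j) ?R = Q"
        using that by (subst Pi_pmf_component) auto
      finally show ?thesis by (simp add: mean)
    qed
    then show ?thesis
      by (subst Bochner_Integration.integral_sum) (auto intro: int)
  qed
  have fin2: "finite (set_pmf (?R \<bind> (\<lambda>f. return_pmf (f(N := y)))))" for y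
    using finR by simp
  have "measure_pmf.expectation (Pi_pmf {..<Suc N} d (\<lambda>_. Q)) (\<lambda>f. (\<Sum>j<Suc N. X (f j))\<^sup>2)
      = measure_pmf.expectation (Q \<bind> (\<lambda>y. ?R \<bind> (\<lambda>f. return_pmf (f(N := y))))) (\<lambda>f. (\<Sum>j<Suc N. X (f j))\<^sup>2)"
    by (simp only: lessThan_Suc Pi_pmf_insert'[OF finite_lessThan] lessThan_iff less_irrefl not_False_eq_True)
  also have "\<dots> = (\<Sum>y\<in>set_pmf Q. pmf Q y *\<^sub>R measure_pmf.expectation (?R \<bind> (\<lambda>f. return_pmf (f(N := y))))
          (\<lambda>f. (\<Sum>j<Suc N. X (f j))\<^sup>2))"
    by (rule pmf_expectation_bind[OF fin fin2]) auto
  also have "\<dots> = (\<Sum>y\<in>set_pmf Q. pmf Q y * (measure_pmf.expectation ?R (\<lambda>f. (\<Sum>j<N. X (f j))\<^sup>2) + (X y)\<^sup>2))"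
  proof (intro sum.cong refl)
    fix y
    have "measure_pmf.expectation (?R \<bind> (\<lambda>f. return_pmf (f(N := y)))) (\<lambda>f. (\<Sum>j<Suc N. X (f j))\<^sup>2)
        = measure_pmf.expectation ?R (\<lambda>f. (\<Sum>j<Suc N. X ((f(N := y)) j))\<^sup>2)"
      by (simp add: map_pmf_def[symmetric])
    also have "(\<lambda>f. (\<Sum>j<Suc N. X ((f(N := y)) j))\<^sup>2)
        = (\<lambda>f. ((\<Sum>j<N. X (f j))\<^sup>2 + 2 * X y * (\<Sum>j<N. X (f j))) + (X y)\<^sup>2)"
    proof
      fix f :: "nat \<Rightarrow> 'b"
      have "(\<Sum>j<Suc N. X ((f(N := y)) j)) = (\<Sum>j<N. X (f j)) + X y"
        by simp
      then show "(\<Sum>j<Suc N. X ((f(N := y)) j))\<^sup>2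
          = ((\<Sum>j<N. X (f j))\<^sup>2 + 2 * X y * (\<Sum>j<N. X (f j))) + (X y)\<^sup>2"
        by (simp add: power2_eq_square algebra_simps)
    qed
    also have "measure_pmf.expectation ?R \<dots> =
        measure_pmf.expectation ?R (\<lambda>f. (\<Sum>j<N. X (f j))\<^sup>2)
        + 2 * X y * measure_pmf.expectation ?R (\<lambda>f. \<Sum>j<N. X (f j)) + (X y)\<^sup>2"
      by (subst Bochner_Integration.integral_add, rule int, rule int,
          subst Bochner_Integration.integral_add, rule int, rule int) simp
    finally show "pmf Q y *\<^sub>R measure_pmf.expectation (?R \<bind> (\<lambda>f. return_pmf (f(N := y)))) (\<lambda>f. (\<Sum>j<Suc N. X (f j))\<^sup>2)
        = pmf Q y * (measure_pmf.expectation ?R (\<lambda>f. (\<Sum>j<N. X (f j))\<^sup>2) + (X y)\<^sup>2)"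
      by (simp only: mean_sum real_scaleR_def mult_zero_right add_0_right)
  qed
  also have "\<dots> \<le> (\<Sum>y\<in>set_pmf Q. pmf Q y * (real N * c\<^sup>2 + c\<^sup>2))"
  proof (intro sum_mono mult_left_mono add_mono Suc)
    fix y assume "y \<in> set_pmf Q"
    then have "\<bar>X y\<bar> \<le> \<bar>c\<bar>" using bound[of y] by linarith
    then show "(X y)\<^sup>2 \<le> c\<^sup>2" by (simp add: abs_le_square_iff)
  qed auto
  also have "\<dots> = (\<Sum>y\<in>set_pmf Q. pmf Q y) * (real N * c\<^sup>2 + c\<^sup>2)"
    by (simp only: sum_distrib_right)
  also have "(\<Sum>y\<in>set_pmf Q. pmf Q y) = 1"
    using fin by (intro sum_pmf_eq_1) auto
  finally show ?case by (simp add: algebra_simps)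
qed

lemma prob_iid_deviation:
  fixes X :: "'b \<Rightarrow> real"
  assumes fin: "finite (set_pmf Q)" and bound: "\<And>b. b \<in> set_pmf Q \<Longrightarrow> \<bar>X b\<bar> \<le> c"
    and mean: "measure_pmf.expectation Q X = 0" and a: "0 < a"
  shows "measure_pmf.prob (Pi_pmf {..<N} d (\<lambda>_. Q)) {f. a < \<bar>\<Sum>j<N. X (f j)\<bar>} \<le> real N * c\<^sup>2 / a\<^sup>2"
proof -
  let ?R = "Pi_pmf {..<N} d (\<lambda>_. Q)"
  have int: "integrable (measure_pmf ?R) h" for h :: "(nat \<Rightarrow> 'b) \<Rightarrow> real"
    using fin by (intro integrable_measure_pmf_finite) (auto simp: set_Pi_pmf)
  have "measure_pmf.prob ?R {f. a < \<bar>\<Sum>j<N. X (f j)\<bar>}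
      = measure_pmf.expectation ?R (indicator {f. a < \<bar>\<Sum>j<N. X (f j)\<bar>})"
    by simp
  also have "\<dots> \<le> measure_pmf.expectation ?R (\<lambda>f. (\<Sum>j<N. X (f j))\<^sup>2 / a\<^sup>2)"
  proof (rule integral_mono[OF int int])
    fix f :: "nat \<Rightarrow> 'b"
    have "a\<^sup>2 \<le> (\<Sum>j<N. X (f j))\<^sup>2" if "a < \<bar>\<Sum>j<N. X (f j)\<bar>"
      using that a by (simp add: abs_le_square_iff[symmetric])
    then show "indicator {f. a < \<bar>\<Sum>j<N. X (f j)\<bar>} f \<le> (\<Sum>j<N. X (f j))\<^sup>2 / a\<^sup>2"
      using a by (auto simp: indicator_def)
  qed
  also have "\<dots> = measure_pmf.expectation ?R (\<lambda>f. (\<Sum>j<N. X (f j))\<^sup>2) / a\<^sup>2"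
    by simp
  also have "\<dots> \<le> real N * c\<^sup>2 / a\<^sup>2"
    using second_moment_iid[OF fin bound mean] by (intro divide_right_mono) auto
  finally show ?thesis .
qed

text \<open>
  A finite combination of total mass at most \<open>M\<close> is, up to the factor \<open>M\<close>, an expectation; the
  mass that is missing is put on \<open>None\<close>.
\<close>

lemma pmf_of_coefficients:
  fixes c :: "'b \<Rightarrow> complex"
  assumes Y: "finite Y" and M: "0 < M" "(\<Sum>y\<in>Y. cmod (c y)) \<le> M"
  obtains Q :: "'b option pmf" where "finite (set_pmf Q)"
    and "\<And>h :: 'b option \<Rightarrow> real. h None = 0 \<Longrightarrow>
           M * measure_pmf.expectation Q h = (\<Sum>y\<in>Y. cmod (c y) * h (Some y))"
proof -
  define w where "w o' = (case o' of None \<Rightarrow> 1 - (\<Sum>y\<in>Y. cmod (c y)) / M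
      | Some y \<Rightarrow> if y \<in> Y then cmod (c y) / M else 0)" for o' :: "'b option"
  define A where "A = insert None (Some ` Y)"
  have finA: "finite A" using Y by (simp add: A_def)
  have w0: "0 \<le> w o'" for o'
    using M by (auto simp: w_def split: option.splits)
  have wA: "w o' = 0" if "o' \<notin> A" for o'
    using that by (cases o') (auto simp: w_def A_def)
  have "(\<Sum>o'\<in>A. w o') = w None + (\<Sum>y\<in>Y. w (Some y))"
    unfolding A_def using Y by (subst sum.insert) (auto simp: sum.reindex)
  also have "\<dots> = 1" by (simp add: w_def sum_divide_distrib)
  finally have sumw: "(\<Sum>o'\<in>A. w o') = 1" .
  have "(\<integral>\<^sup>+ o'. ennreal (w o') \<partial>count_space UNIV) = (\<Sum>o'\<in>A. ennreal (w o'))"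
    by (rule nn_integral_count_space'[where A = A and B = UNIV and f = "\<lambda>o'. ennreal (w o')"])
      (simp_all add: wA finA)
  also have "\<dots> = 1" using sumw w0 by simp
  finally have pm: "pmf (embed_pmf w) = w"
    using w0 by (intro ext pmf_embed_pmf) auto
  have supp: "set_pmf (embed_pmf w) \<subseteq> A"
    using wA unfolding set_pmf_eq pm by blast
  show thesis
  proof (rule that)
    show "finite (set_pmf (embed_pmf w))" using supp finA by (rule finite_subset)
    fix h :: "'b option \<Rightarrow> real" assume h: "h None = 0"
    have "measure_pmf.expectation (embed_pmf w) h = (\<Sum>o'\<in>A. h o' * w o')"
      using integral_measure_pmf_real[OF finA, of "embed_pmf w" h] supp unfolding pm by blast
    also have "\<dots> = (\<Sum>y\<in>Y. h (Some y) * w (Some y))"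
      unfolding A_def using Y h by (subst sum.insert) (auto simp: sum.reindex)
    also have "M * \<dots> = (\<Sum>y\<in>Y. cmod (c y) * h (Some y))"
      unfolding sum_distrib_left using M by (intro sum.cong) (auto simp: w_def)
    finally show "M * measure_pmf.expectation (embed_pmf w) h = (\<Sum>y\<in>Y. cmod (c y) * h (Some y))" .
  qed
qed

text \<open>
  A combination \<open>\<Sum> c y z y\<close> is \<open>M\<close> times the expectation of the random point \<open>sgn (c y) z y\<close>, so by
  Chebyshev's inequality \<open>M\<close> times the average of \<open>N\<close> independent samples approximates each of its
  coordinates.  The bound involves neither the number of coordinates nor that of points.
\<close>

lemma empirical_approximation:
  fixes c :: "'b \<Rightarrow> complex" and z :: "'b \<Rightarrow> nat \<Rightarrow> complex"
  assumes Y: "finite Y" and M: "0 < M" "(\<Sum>y\<in>Y. cmod (c y)) \<le> M"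
    and z: "\<And>y k. k < n \<Longrightarrow> cmod (z y k) \<le> 1" and N: "0 < N" and \<delta>: "0 < \<delta>"
  obtains R :: "(nat \<Rightarrow> 'b option) pmf" and u :: "'b option \<Rightarrow> complex" where
    "\<And>o'. cmod (u o') \<le> 1"
    "\<And>k. k < n \<Longrightarrow> measure_pmf.prob R {f. \<delta> < cmod (of_real (M / real N) * (\<Sum>j<N. u (f j) * z (the (f j)) k)
          - (\<Sum>y\<in>Y. c y * z y k))} \<le> 32 * M\<^sup>2 / (real N * \<delta>\<^sup>2)"
proof -
  obtain Q :: "'b option pmf" where finQ: "finite (set_pmf Q)"
    and Q: "\<And>h :: 'b option \<Rightarrow> real. h None = 0 \<Longrightarrow>
           M * measure_pmf.expectation Q h = (\<Sum>y\<in>Y. cmod (c y) * h (Some y))"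
    using pmf_of_coefficients[OF Y M] by blast
  define u where "u o' = (case o' of None \<Rightarrow> 0 | Some y \<Rightarrow> sgn (c y))" for o' :: "'b option"
  have u1: "cmod (u o') \<le> 1" for o' by (auto simp: u_def norm_sgn split: option.splits)
  define b where "b k o' = u o' * z (the o') k" for k o'
  define v where "v k = (\<Sum>y\<in>Y. c y * z y k)" for k
  have b1: "cmod (b k o') \<le> 1" if "k < n" for k o'
    unfolding b_def norm_mult using u1[of o'] z[OF that] by (intro mult_le_one) auto
  have polar: "of_real (cmod a) * sgn a = a" for a :: complex
    by (simp add: sgn_eq)
  let ?R = "Pi_pmf {..<N} None (\<lambda>_. Q)"
  \<comment> \<open>\<open>g\<close> is the real or the imaginary part\<close>
  have part: "measure_pmf.prob ?R {f. \<delta> / 2 < \<bar>g (of_real (M / real N) * (\<Sum>j<N. b k (f j)) - v k)\<bar>}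
        \<le> 16 * M\<^sup>2 / (real N * \<delta>\<^sup>2)"
    if k: "k < n" and g: "bounded_linear g" "\<And>a. \<bar>g a\<bar> \<le> cmod a" for k and g :: "complex \<Rightarrow> real"
  proof -
    interpret g: bounded_linear g by fact
    define X where "X o' = g (b k o') - g (v k) / M" for o'
    have "M * measure_pmf.expectation Q (\<lambda>o'. g (b k o')) = (\<Sum>y\<in>Y. cmod (c y) * g (b k (Some y)))"
      by (rule Q) (simp add: b_def u_def g.zero)
    also have "\<dots> = (\<Sum>y\<in>Y. g (c y * z y k))"
    proof (intro sum.cong refl)
      fix y
      have "cmod (c y) * g (b k (Some y)) = g (cmod (c y) *\<^sub>R b k (Some y))"
        by (simp add: g.scaleR)
      also have "cmod (c y) *\<^sub>R b k (Some y) = (of_real (cmod (c y)) * sgn (c y)) * z y k"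
        by (simp add: b_def u_def scaleR_conv_of_real)
      finally show "cmod (c y) * g (b k (Some y)) = g (c y * z y k)" unfolding polar .
    qed
    also have "\<dots> = g (v k)" by (simp add: v_def g.sum)
    finally have Eb: "measure_pmf.expectation Q (\<lambda>o'. g (b k o')) = g (v k) / M"
      using M by (simp add: field_simps)
    have mean: "measure_pmf.expectation Q X = 0"
      unfolding X_def by (subst Bochner_Integration.integral_diff)
        (auto intro: integrable_measure_pmf_finite[OF finQ] simp: Eb)
    have gv: "\<bar>g (v k) / M\<bar> \<le> 1"
    proof -
      have "cmod (v k) \<le> (\<Sum>y\<in>Y. cmod (c y * z y k))" unfolding v_def by (rule norm_sum)
      also have "\<dots> \<le> (\<Sum>y\<in>Y. cmod (c y) * 1)"
        unfolding norm_mult using z[OF k] by (intro sum_mono mult_left_mono) auto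
      finally show ?thesis using g(2)[of "v k"] M by (simp add: field_simps)
    qed
    have bound: "\<bar>X o'\<bar> \<le> 2" for o'
      using g(2)[of "b k o'"] b1[OF k, of o'] gv unfolding X_def by linarith
    have "{f. \<delta> / 2 < \<bar>g (of_real (M / real N) * (\<Sum>j<N. b k (f j)) - v k)\<bar>}
        = {f. real N * \<delta> / (2 * M) < \<bar>\<Sum>j<N. X (f j)\<bar>}"
    proof (intro Collect_cong)
      fix f :: "nat \<Rightarrow> 'b option"
      have "of_real (M / real N) * (\<Sum>j<N. b k (f j)) = (M / real N) *\<^sub>R (\<Sum>j<N. b k (f j))"
        by (simp only: scaleR_conv_of_real)
      then have "g (of_real (M / real N) * (\<Sum>j<N. b k (f j)) - v k)
          = M / real N * (\<Sum>j<N. g (b k (f j))) - g (v k)"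
        by (simp only: g.diff g.scaleR g.sum real_scaleR_def)
      also have "\<dots> = M / real N * (\<Sum>j<N. X (f j))"
      proof -
        have "M / real N * (\<Sum>j<N. X (f j)) = M / real N * (\<Sum>j<N. g (b k (f j))) - M / real N * (real N * (g (v k) / M))"
          by (simp only: X_def sum_subtractf right_diff_distrib sum_constant card_lessThan)
        also have "M / real N * (real N * (g (v k) / M)) = g (v k)"
          using M N by simp
        finally show ?thesis by simp
      qed
      finally have eq: "\<bar>g (of_real (M / real N) * (\<Sum>j<N. b k (f j)) - v k)\<bar> = M / real N * \<bar>\<Sum>j<N. X (f j)\<bar>"
        using M N by (simp add: abs_mult)
      show "(\<delta> / 2 < \<bar>g (of_real (M / real N) * (\<Sum>j<N. b k (f j)) - v k)\<bar>)
          = (real N * \<delta> / (2 * M) < \<bar>\<Sum>j<N. X (f j)\<bar>)"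
        unfolding eq using M N by (simp add: field_simps)
    qed
    also have "measure_pmf.prob ?R \<dots> \<le> real N * 2\<^sup>2 / (real N * \<delta> / (2 * M))\<^sup>2"
      using prob_iid_deviation[OF finQ bound mean] M N \<delta> by simp
    also have "\<dots> = 16 * M\<^sup>2 / (real N * \<delta>\<^sup>2)"
      using M N \<delta> by (simp add: field_simps power2_eq_square)
    finally show ?thesis .
  qed
  show thesis
  proof (rule that[of u ?R])
    fix k assume k: "k < n"
    let ?e = "\<lambda>f. of_real (M / real N) * (\<Sum>j<N. b k (f j)) - v k"
    have "measure_pmf.prob ?R {f. \<delta> < cmod (?e f)}
        \<le> measure_pmf.prob ?R ({f. \<delta> / 2 < \<bar>Re (?e f)\<bar>} \<union> {f. \<delta> / 2 < \<bar>Im (?e f)\<bar>})"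
    proof (rule measure_pmf.finite_measure_mono)
      show "{f. \<delta> < cmod (?e f)} \<subseteq> {f. \<delta> / 2 < \<bar>Re (?e f)\<bar>} \<union> {f. \<delta> / 2 < \<bar>Im (?e f)\<bar>}"
      proof
        fix f assume "f \<in> {f. \<delta> < cmod (?e f)}"
        then have "\<delta> < \<bar>Re (?e f)\<bar> + \<bar>Im (?e f)\<bar>"
          using cmod_le[of "?e f"] by simp
        then show "f \<in> {f. \<delta> / 2 < \<bar>Re (?e f)\<bar>} \<union> {f. \<delta> / 2 < \<bar>Im (?e f)\<bar>}"
          unfolding Un_iff mem_Collect_eq by linarith
      qed
    qed simp
    also have "\<dots> \<le> measure_pmf.prob ?R {f. \<delta> / 2 < \<bar>Re (?e f)\<bar>} + measure_pmf.prob ?R {f. \<delta> / 2 < \<bar>Im (?e f)\<bar>}"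
      by (rule measure_Un_le) auto
    also have "\<dots> \<le> 16 * M\<^sup>2 / (real N * \<delta>\<^sup>2) + 16 * M\<^sup>2 / (real N * \<delta>\<^sup>2)"
      using part[OF k bounded_linear_Re abs_Re_le_cmod] part[OF k bounded_linear_Im abs_Im_le_cmod]
      by (rule add_mono)
    finally show "measure_pmf.prob ?R {f. \<delta> < cmod (of_real (M / real N) * (\<Sum>j<N. u (f j) * z (the (f j)) k)
          - (\<Sum>y\<in>Y. c y * z y k))} \<le> 32 * M\<^sup>2 / (real N * \<delta>\<^sup>2)"
      by (simp add: b_def v_def)
  qed (use u1 in \<open>auto simp: u_def\<close>)
qed

text \<open>
  Every coefficient vector of the polydisc lies in \<open>M\<close> times the closed absolutely convex hull of
  the points \<open>z y\<close>, but a quasi-seminorm does not control convex hulls.  It does control averages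
  of a fixed number \<open>N\<close> of points, and the error of such an average is small except on a random
  set of coordinates with small probability.  On that set exhaustivity makes the quasi-seminorm
  small, so the whole error amounts to at most half of the supremum over the polydisc.
\<close>

theorem polydisc_bound_from_hull:
  fixes K C \<theta> M :: real
  assumes K: "1 \<le> K" and C: "0 \<le> C" and \<theta>: "0 < \<theta>" and M: "0 < M"
  shows "\<exists>D\<ge>0. \<forall>n \<Psi> (z :: 'b \<Rightarrow> nat \<Rightarrow> complex) S a.
    coefficient_quasi_seminorm n K \<Psi> \<and> coefficient_quasi_seminorm.exhaustive \<Psi> C \<theta> \<and>
    (\<forall>y. \<forall>k<n. cmod (z y k) \<le> 1) \<and> 0 \<le> S \<and> (\<forall>y. \<Psi> (z y) \<le> S) \<and>
    (\<forall>t \<eta>. (\<forall>k<n. cmod (t k) \<le> 1) \<and> 0 < \<eta> \<longrightarrow> (\<exists>Y c. finite Y \<and> (\<Sum>y\<in>Y. cmod (c y)) \<le> M \<and>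
        (\<forall>k<n. cmod (t k - (\<Sum>y\<in>Y. c y * z y k)) \<le> \<eta>))) \<and>
    (\<forall>k<n. cmod (a k) \<le> 1) \<longrightarrow> \<Psi> a \<le> D * S"
proof -
  obtain L :: nat where "(2 * K) powr (1 / \<theta>) \<le> real L"
    using real_arch_simple by blast
  then have "((2 * K) powr (1 / \<theta>)) powr \<theta> \<le> real L powr \<theta>"
    using \<theta> by (intro powr_mono2) auto
  then have L: "2 * K \<le> real L powr \<theta>"
    using K \<theta> by (simp add: powr_powr)
  \<comment> \<open>\<open>\<rho>\<close> bounds the submeasure of the bad set and \<open>\<delta>\<close> the error on the good set; each contributes an
    eighth of the supremum \<open>\<Phi>\<close> in the end\<close>
  define \<rho> where "\<rho> = 1 / (8 * K\<^sup>2 * (M + 1))"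
  have \<rho>: "0 < \<rho>" using K M by (simp add: \<rho>_def)
  have "((\<lambda>m::nat. 2 * K * C * real m powr (-\<theta>)) \<longlongrightarrow> 2 * K * C * 0) sequentially"
    using \<theta> by (intro tendsto_mult tendsto_const tendsto_neg_powr filterlim_real_sequentially) auto
  then have "eventually (\<lambda>m::nat. 2 * K * C * real m powr (-\<theta>) < \<rho>) sequentially"
    using \<rho> by (intro order_tendstoD) auto
  moreover have "eventually (\<lambda>m::nat. L\<^sup>2 \<le> m \<and> 1 \<le> m) sequentially"
    by (intro eventually_conj eventually_ge_at_top)
  ultimately have "eventually (\<lambda>m::nat. 2 * K * C * real m powr (-\<theta>) < \<rho> \<and> L\<^sup>2 \<le> m \<and> 1 \<le> m) sequentially"
    by (rule eventually_conj)
  then obtain m :: nat where m\<rho>: "2 * K * C * real m powr (-\<theta>) < \<rho>" and m: "L\<^sup>2 \<le> m" "1 \<le> m"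
    by (auto simp: eventually_sequentially)
  define \<delta> where "\<delta> = 1 / (8 * K\<^sup>2)"
  have \<delta>: "0 < \<delta>" using K by (simp add: \<delta>_def)
  obtain N0 :: nat where "32 * M\<^sup>2 / (\<delta> / 2)\<^sup>2 * real m ^ 4 < real N0"
    using reals_Archimedean2 by blast
  define N where "N = Suc N0"
  have N: "0 < N" by (simp add: N_def)
  have "32 * M\<^sup>2 / (\<delta> / 2)\<^sup>2 * real m ^ 4 \<le> real N"
    using \<open>_ < real N0\<close> by (simp add: N_def)
  then have prob: "32 * M\<^sup>2 / (real N * (\<delta> / 2)\<^sup>2) \<le> 1 / real m ^ 4"
    using m N \<delta> by (simp add: field_simps)
  define D where "D = K * (M * K ^ N)"
  have D: "0 \<le> D" using K M by (simp add: D_def)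
  show ?thesis
  proof (intro exI[of _ "2 * D"] conjI allI impI)
    show "0 \<le> 2 * D" using D by simp
    fix n \<Psi> and z :: "'b \<Rightarrow> nat \<Rightarrow> complex" and S and a :: "nat \<Rightarrow> complex"
    assume *: "coefficient_quasi_seminorm n K \<Psi> \<and> coefficient_quasi_seminorm.exhaustive \<Psi> C \<theta> \<and>
    (\<forall>y. \<forall>k<n. cmod (z y k) \<le> 1) \<and> 0 \<le> S \<and> (\<forall>y. \<Psi> (z y) \<le> S) \<and>
    (\<forall>t \<eta>. (\<forall>k<n. cmod (t k) \<le> 1) \<and> 0 < \<eta> \<longrightarrow> (\<exists>Y c. finite Y \<and> (\<Sum>y\<in>Y. cmod (c y)) \<le> M \<and>
        (\<forall>k<n. cmod (t k - (\<Sum>y\<in>Y. c y * z y k)) \<le> \<eta>))) \<and>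
    (\<forall>k<n. cmod (a k) \<le> 1)"
    then interpret coefficient_quasi_seminorm n K \<Psi> by blast
    have ex: "exhaustive C \<theta>" and z1: "\<And>y k. k < n \<Longrightarrow> cmod (z y k) \<le> 1" and S0: "0 \<le> S"
      and zS: "\<And>y. \<Psi> (z y) \<le> S" and a: "\<And>k. k < n \<Longrightarrow> cmod (a k) \<le> 1"
      using * by auto
    have hull: "\<exists>Y c. finite Y \<and> (\<Sum>y\<in>Y. cmod (c y)) \<le> M \<and>
        (\<forall>k<n. cmod (t k - (\<Sum>y\<in>Y. c y * z y k)) \<le> \<eta>)"
      if "\<forall>k<n. cmod (t k) \<le> 1" "0 < \<eta>" for t \<eta>
      using * that by blast
    define \<Phi> where "\<Phi> = disc_sup UNIV"
    have \<Phi>0: "0 \<le> \<Phi>" unfolding \<Phi>_def by (rule disc_sup_nonneg)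
    have main: "\<Psi> t \<le> D * S + \<Phi> / 2" if t: "\<And>k. cmod (t k) \<le> 1" for t
    proof -
      have "\<exists>Y c. finite Y \<and> (\<Sum>y\<in>Y. cmod (c y)) \<le> M \<and>
        (\<forall>k<n. cmod (t k - (\<Sum>y\<in>Y. c y * z y k)) \<le> \<delta> / 2)"
        using hull[of t "\<delta> / 2"] t \<delta> by simp
      then obtain Y c where Y: "finite Y" "(\<Sum>y\<in>Y. cmod (c y)) \<le> M"
        and approx: "\<And>k. k < n \<Longrightarrow> cmod (t k - (\<Sum>y\<in>Y. c y * z y k)) \<le> \<delta> / 2"
        by blast
      have half: "0 < \<delta> / 2" using \<delta> by simp
      obtain R :: "(nat \<Rightarrow> 'b option) pmf" and u where u: "\<And>o'. cmod (u o') \<le> 1"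
        and R: "\<And>k. k < n \<Longrightarrow> measure_pmf.prob R {f. \<delta> / 2 < cmod (of_real (M / real N) * (\<Sum>j<N. u (f j) * z (the (f j)) k)
          - (\<Sum>y\<in>Y. c y * z y k))} \<le> 32 * M\<^sup>2 / (real N * (\<delta> / 2)\<^sup>2)"
        by (rule empirical_approximation[where n = n and z = z, OF Y(1) M Y(2) _ N half]) (rule z1, assumption, rule that)
      define avg where "avg f k = of_real (M / real N) * (\<Sum>j<N. u (f j) * z (the (f j)) k)" for f k
      define A where "A f = {k. k < n \<and> \<delta> < cmod (t k - avg f k)}" for f
      have "measure_pmf.prob (map_pmf A R) {B. k \<in> B} \<le> 1 / real m ^ 4" if k: "k < n" for k
      proof -
        have "measure_pmf.prob (map_pmf A R) {B. k \<in> B} = measure_pmf.prob R {f. k \<in> A f}"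
          by (simp add: vimage_def)
        also have "\<dots> \<le> measure_pmf.prob R {f. \<delta> / 2 < cmod (avg f k - (\<Sum>y\<in>Y. c y * z y k))}"
        proof (rule measure_pmf.finite_measure_mono)
          show "{f. k \<in> A f} \<subseteq> {f. \<delta> / 2 < cmod (avg f k - (\<Sum>y\<in>Y. c y * z y k))}"
          proof
            fix f assume "f \<in> {f. k \<in> A f}"
            then have "\<delta> < cmod (t k - avg f k)" by (simp add: A_def)
            also have "t k - avg f k = (t k - (\<Sum>y\<in>Y. c y * z y k)) - (avg f k - (\<Sum>y\<in>Y. c y * z y k))"
              by simp
            also have "cmod \<dots> \<le> cmod (t k - (\<Sum>y\<in>Y. c y * z y k)) + cmod (avg f k - (\<Sum>y\<in>Y. c y * z y k))"
              by (rule norm_triangle_ineq4)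
            finally show "f \<in> {f. \<delta> / 2 < cmod (avg f k - (\<Sum>y\<in>Y. c y * z y k))}"
              using approx[OF k] by simp
          qed
        qed simp
        also have "\<dots> \<le> 1 / real m ^ 4"
          using R[OF k] prob unfolding avg_def by linarith
        finally show ?thesis .
      qed
      from random_set_small[OF C \<theta> L ex m(1) this]
      obtain f where f: "disc_sup (A f) \<le> 2 * K * C * real m powr (-\<theta>) * \<Phi>"
        by (auto simp: \<Phi>_def)
      have "disc_sup (A f) \<le> \<rho> * \<Phi>"
        using f m\<rho> \<Phi>0 mult_right_mono[of "2 * K * C * real m powr (-\<theta>)" \<rho> \<Phi>] by linarith
      define e1 where "e1 k = (if k < n \<and> k \<notin> A f then t k - avg f k else 0)" for k
      define e2 where "e2 k = (if k \<in> A f then t k - avg f k else 0)" for k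
      have avg_le: "\<Psi> (avg f) \<le> M * K ^ N * S"
      proof -
        have "\<Psi> (avg f) = M / real N * \<Psi> (\<lambda>k. \<Sum>j<N. u (f j) * z (the (f j)) k)"
          unfolding avg_def scale norm_of_real using M by simp
        also have "\<dots> \<le> M / real N * (K ^ N * (\<Sum>j<N. \<Psi> (\<lambda>k. u (f j) * z (the (f j)) k)))"
          using M sum_le[of "\<lambda>j k. u (f j) * z (the (f j)) k" N] by (intro mult_left_mono) auto
        also have "\<dots> \<le> M / real N * (K ^ N * (\<Sum>j<N. 1 * S))"
          unfolding scale using M K u zS nonneg
          by (intro mult_left_mono sum_mono mult_mono) auto
        also have "\<dots> = M * K ^ N * S" using N by simp
        finally show ?thesis .
      qed
      have e1_le: "\<Psi> e1 \<le> \<delta> * \<Phi>"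
        unfolding \<Phi>_def using \<delta> by (intro scaled_le_disc_sup) (auto simp: e1_def A_def)
      have e2_le: "\<Psi> e2 \<le> (M + 1) * disc_sup (A f)"
      proof (rule scaled_le_disc_sup)
        fix k
        show "cmod (e2 k) \<le> M + 1"
        proof (cases "k \<in> A f")
          case True
          then have k: "k < n" by (simp add: A_def)
          have "cmod (\<Sum>j<N. u (f j) * z (the (f j)) k) \<le> (\<Sum>j<N. 1)"
            using u z1[OF k] by (intro sum_norm_le) (auto simp: norm_mult intro: mult_le_one)
          then have "cmod (avg f k) \<le> M / real N * real N"
            unfolding avg_def norm_mult norm_of_real using M
            by (intro mult_mono) auto
          then have "cmod (avg f k) \<le> M" using N by simp
          then show ?thesis
            using True norm_triangle_ineq4[of "t k" "avg f k"] t[of k] by (simp add: e2_def)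
        qed (use M in \<open>simp add: e2_def\<close>)
      qed (use M in \<open>auto simp: e2_def\<close>)
      have "\<Psi> t = \<Psi> (\<lambda>k. avg f k + (e1 k + e2 k))"
        by (rule local) (auto simp: e1_def e2_def)
      also have "\<dots> \<le> K * (\<Psi> (avg f) + K * (\<Psi> e1 + \<Psi> e2))"
        using triangle[of "avg f" "\<lambda>k. e1 k + e2 k"] triangle[of e1 e2] K
        by (elim order_trans) (intro mult_left_mono add_mono, auto)
      also have "\<dots> \<le> K * (M * K ^ N * S + K * (\<delta> * \<Phi> + (M + 1) * (\<rho> * \<Phi>)))"
      proof -
        have "(M + 1) * disc_sup (A f) \<le> (M + 1) * (\<rho> * \<Phi>)"
          using M \<open>disc_sup (A f) \<le> \<rho> * \<Phi>\<close> by (intro mult_left_mono) auto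
        then show ?thesis
          using K avg_le e1_le e2_le by (intro mult_left_mono add_mono) auto
      qed
      also have "\<dots> = D * S + (K\<^sup>2 * \<delta> + K\<^sup>2 * (M + 1) * \<rho>) * \<Phi>"
        by (simp add: D_def power2_eq_square algebra_simps)
      also have "K\<^sup>2 * \<delta> + K\<^sup>2 * (M + 1) * \<rho> = 1 / 4"
        using K M by (simp add: \<delta>_def \<rho>_def)
      finally show ?thesis using \<Phi>0 by simp
    qed
    have "\<Phi> \<le> D * S + \<Phi> / 2"
      unfolding \<Phi>_def by (rule disc_sup_least, rule main[unfolded \<Phi>_def])
    then have "\<Phi> \<le> 2 * D * S" by simp
    moreover have "\<Psi> a = \<Psi> (\<lambda>k. if k < n then a k else 0)"
      by (rule local) auto
    moreover have "\<Psi> (\<lambda>k. if k < n then a k else 0) \<le> \<Phi>"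
      unfolding \<Phi>_def using a by (intro disc_sup_upper) auto
    ultimately show "\<Psi> a \<le> 2 * D * S" by simp
  qed
qed

section \<open>Discretization\<close>

text \<open>
  Group the points by the cells of a square grid that contain their values, and send each point to
  a representative of its group.
\<close>

lemma finite_range_rounding:
  fixes h :: "'i \<Rightarrow> 'g::topological_space \<Rightarrow> complex"
  assumes I: "finite I" and meas: "\<And>k. k \<in> I \<Longrightarrow> h k \<in> borel_measurable borel"
    and bound: "\<And>k x. k \<in> I \<Longrightarrow> cmod (h k x) \<le> 1" and \<eta>: "0 < \<eta>"
  obtains r :: "'g \<Rightarrow> 'g" where "finite (range r)" "\<And>y. r -` {y} \<in> sets borel"
    "\<And>x k. k \<in> I \<Longrightarrow> cmod (h k x - h k (r x)) \<le> \<eta>"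
proof -
  define d where "d = \<eta> / 2"
  have d: "0 < d" using \<eta> by (simp add: d_def)
  define cell where "cell x = (\<lambda>k\<in>I. (\<lfloor>Re (h k x) / d\<rfloor>, \<lfloor>Im (h k x) / d\<rfloor>))" for x
  define B where "B = \<lceil>1 / d\<rceil>"
  have in_box: "\<lfloor>u / d\<rfloor> \<in> {-B..B}" if "\<bar>u\<bar> \<le> 1" for u
  proof -
    have "\<bar>u\<bar> / d \<le> 1 / d" using that d by (intro divide_right_mono) auto
    then have "\<bar>u / d\<bar> \<le> of_int B" unfolding B_def using d by (simp add: abs_divide) linarith
    then have "- of_int B \<le> u / d" "u / d < of_int B + 1" by linarith+
    then show ?thesis by (simp add: le_floor_iff floor_le_iff)
  qed
  have "range cell \<subseteq> I \<rightarrow>\<^sub>E {-B..B} \<times> {-B..B}"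
  proof
    fix z assume "z \<in> range cell"
    then obtain x where z: "z = cell x" by blast
    show "z \<in> I \<rightarrow>\<^sub>E {-B..B} \<times> {-B..B}"
      unfolding z cell_def
    proof (rule restrict_PiE_iff[THEN iffD2], intro ballI SigmaI in_box)
      fix k assume k: "k \<in> I"
      show "\<bar>Re (h k x)\<bar> \<le> 1" "\<bar>Im (h k x)\<bar> \<le> 1"
        using bound[OF k, of x] abs_Re_le_cmod[of "h k x"] abs_Im_le_cmod[of "h k x"] by linarith+
    qed
  qed
  then have fin: "finite (range cell)"
    by (rule finite_subset) (intro finite_PiE I finite_SigmaI finite_atLeastAtMost_int)
  define rep where "rep c = (SOME y. cell y = c)" for c
  define r where "r x = rep (cell x)" for x
  have cell_r: "cell (r x) = cell x" for x
    unfolding r_def rep_def by (rule someI[of _ x]) simp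
  have "range r \<subseteq> rep ` range cell" by (auto simp: r_def)
  then have finr: "finite (range r)" using fin finite_subset by blast
  have cells: "{x. cell x = cell y} \<in> sets borel" for y
  proof -
    have "{x. cell x = cell y} = {x \<in> space borel. \<forall>k\<in>I.
        (of_int \<lfloor>Re (h k y) / d\<rfloor> \<le> Re (h k x) / d \<and> Re (h k x) / d < of_int \<lfloor>Re (h k y) / d\<rfloor> + 1) \<and>
        (of_int \<lfloor>Im (h k y) / d\<rfloor> \<le> Im (h k x) / d \<and> Im (h k x) / d < of_int \<lfloor>Im (h k y) / d\<rfloor> + 1)}"
      by (simp add: cell_def restrict_def fun_eq_iff floor_eq_iff) blast
    also have "\<dots> \<in> sets borel"
      using meas I by (intro sets.sets_Collect_finite_All sets.sets_Collect_conj borel_measurable_le borel_measurable_less) auto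
    finally show ?thesis .
  qed
  have fibre: "r -` {y} \<in> sets borel" for y
  proof (cases "r y = y")
    case True
    have "r -` {y} = {x. cell x = cell y}"
    proof (intro equalityI subsetI)
      fix x assume "x \<in> r -` {y}"
      then have "r x = y" by simp
      then show "x \<in> {x. cell x = cell y}" using cell_r[of x] by simp
    next
      fix x assume "x \<in> {x. cell x = cell y}"
      then have "r x = r y" by (simp add: r_def)
      then show "x \<in> r -` {y}" using True by simp
    qed
    then show ?thesis using cells by simp
  next
    case False
    have "r x \<noteq> y" for x
    proof
      assume "r x = y"
      then have "r y = r x" using cell_r[of x] by (simp add: r_def)
      then show False using False \<open>r x = y\<close> by simp
    qed
    then have "r -` {y} = {}" by auto
    then show ?thesis by simp
  qed
  have close: "cmod (h k x - h k (r x)) \<le> \<eta>" if k: "k \<in> I" for x k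
  proof -
    have same: "\<bar>u - v\<bar> \<le> d" if "\<lfloor>u / d\<rfloor> = \<lfloor>v / d\<rfloor>" for u v
    proof -
      have "\<bar>u / d - v / d\<bar> \<le> 1" using that by linarith
      then have "\<bar>u - v\<bar> / d \<le> 1" using d by (simp add: abs_divide flip: diff_divide_distrib)
      then show ?thesis using d by simp
    qed
    have "cell x k = cell (r x) k" by (simp add: cell_r)
    then have "\<bar>Re (h k x) - Re (h k (r x))\<bar> \<le> d" "\<bar>Im (h k x) - Im (h k (r x))\<bar> \<le> d"
      using k by (auto simp: cell_def intro!: same)
    then show ?thesis
      using cmod_le[of "h k x - h k (r x)"] by (simp add: d_def)
  qed
  show thesis by (rule that[OF finr fibre close])
qed

lemma integral_finite_range:
  fixes F :: "'g::topological_space \<Rightarrow> 'b::{banach, second_countable_topology}"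
  assumes m: "finite_measure m" "sets m = sets borel"
    and r: "finite (range r)" "\<And>y. r -` {y} \<in> sets borel"
  shows "integrable m (\<lambda>x. F (r x))"
    and "(LINT x|m. F (r x)) = (\<Sum>y\<in>range r. measure m (r -` {y}) *\<^sub>R F y)"
proof -
  interpret finite_measure m by fact
  have F: "(\<lambda>x. F (r x)) = (\<lambda>x. \<Sum>y\<in>range r. indicator (r -` {y}) x *\<^sub>R F y)"
  proof
    fix x
    have "(\<Sum>y\<in>range r. indicator (r -` {y}) x *\<^sub>R F y) = (\<Sum>y\<in>{r x}. indicator (r -` {y}) x *\<^sub>R F y)"
      using r(1) by (intro sum.mono_neutral_right) (auto simp: indicator_def)
    then show "F (r x) = (\<Sum>y\<in>range r. indicator (r -` {y}) x *\<^sub>R F y)" by simp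
  qed
  have int: "integrable m (\<lambda>x. indicator (r -` {y}) x *\<^sub>R F y)" for y
    using r(2) m(2) by (intro integrable_scaleR_left) (simp add: less_top[symmetric])
  show "integrable m (\<lambda>x. F (r x))"
    unfolding F by (intro Bochner_Integration.integrable_sum int)
  have "(LINT x|m. indicator (r -` {y}) x *\<^sub>R F y) = measure m (r -` {y}) *\<^sub>R F y" for y
    using r(2) m(2) sets_eq_imp_space_eq[OF m(2)]
    by (subst integral_scaleR_left) (auto simp: less_top[symmetric])
  then show "(LINT x|m. F (r x)) = (\<Sum>y\<in>range r. measure m (r -` {y}) *\<^sub>R F y)"
    unfolding F using int by (subst Bochner_Integration.integral_sum) auto
qed

section \<open>Absolutely convex hulls of point evaluations\<close>

text \<open>
  \<open>R\<close> times the closed absolutely convex hull of the point evaluations, restricted to the functions in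
  \<open>F\<close>.  The hull is closed so as to contain integrals against measures of total mass \<open>R\<close>.
\<close>

definition in_hull :: "real \<Rightarrow> ('g \<Rightarrow> complex) set \<Rightarrow> (('g \<Rightarrow> complex) \<Rightarrow> complex) \<Rightarrow> bool" where
  "in_hull R F t \<longleftrightarrow> (\<forall>\<eta>>0. \<exists>Y c. finite Y \<and> (\<Sum>y\<in>Y. cmod (c y)) \<le> R \<and>
     (\<forall>\<gamma>\<in>F. cmod (t \<gamma> - (\<Sum>y\<in>Y. c y * \<gamma> y)) \<le> \<eta>))"

lemma in_hull_mono:
  assumes "in_hull R F t" "R \<le> R'" "F' \<subseteq> F"
  shows "in_hull R' F' t"
  unfolding in_hull_def
proof (intro allI impI)
  fix \<eta> :: real assume "0 < \<eta>"
  then obtain Y c where "finite Y" "(\<Sum>y\<in>Y. cmod (c y)) \<le> R"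
    "\<forall>\<gamma>\<in>F. cmod (t \<gamma> - (\<Sum>y\<in>Y. c y * \<gamma> y)) \<le> \<eta>"
    using assms(1) unfolding in_hull_def by meson
  then show "\<exists>Y c. finite Y \<and> (\<Sum>y\<in>Y. cmod (c y)) \<le> R' \<and>
     (\<forall>\<gamma>\<in>F'. cmod (t \<gamma> - (\<Sum>y\<in>Y. c y * \<gamma> y)) \<le> \<eta>)"
    using assms(2,3) by (intro exI[of _ Y] exI[of _ c]) auto
qed

lemma in_hull_cong: "in_hull R F t \<Longrightarrow> (\<And>\<gamma>. \<gamma> \<in> F \<Longrightarrow> t \<gamma> = s \<gamma>) \<Longrightarrow> in_hull R F s"
  unfolding in_hull_def by simp

lemma in_hull_add:
  assumes s: "in_hull R F s" and t: "in_hull R' F t"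
  shows "in_hull (R + R') F (\<lambda>\<gamma>. s \<gamma> + t \<gamma>)"
  unfolding in_hull_def
proof (intro allI impI)
  fix \<eta> :: real assume "0 < \<eta>"
  then have \<eta>: "0 < \<eta> / 2" by simp
  obtain Y c where Y: "finite Y" "(\<Sum>y\<in>Y. cmod (c y)) \<le> R"
    "\<And>\<gamma>. \<gamma> \<in> F \<Longrightarrow> cmod (s \<gamma> - (\<Sum>y\<in>Y. c y * \<gamma> y)) \<le> \<eta> / 2"
    using s \<eta> unfolding in_hull_def by meson
  obtain Z d where Z: "finite Z" "(\<Sum>y\<in>Z. cmod (d y)) \<le> R'"
    "\<And>\<gamma>. \<gamma> \<in> F \<Longrightarrow> cmod (t \<gamma> - (\<Sum>y\<in>Z. d y * \<gamma> y)) \<le> \<eta> / 2"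
    using t \<eta> unfolding in_hull_def by meson
  define c' where "c' y = (if y \<in> Y then c y else 0)" for y
  define d' where "d' y = (if y \<in> Z then d y else 0)" for y
  have c': "(\<Sum>y\<in>Y \<union> Z. f y (c' y)) = (\<Sum>y\<in>Y. f y (c y))" if "\<And>y. f y 0 = 0" for f :: "'a \<Rightarrow> complex \<Rightarrow> 'b::comm_monoid_add"
    using Y(1) Z(1) that by (intro sum.mono_neutral_cong_right) (auto simp: c'_def)
  have d': "(\<Sum>y\<in>Y \<union> Z. f y (d' y)) = (\<Sum>y\<in>Z. f y (d y))" if "\<And>y. f y 0 = 0" for f :: "'a \<Rightarrow> complex \<Rightarrow> 'b::comm_monoid_add"
    using Y(1) Z(1) that by (intro sum.mono_neutral_cong_right) (auto simp: d'_def)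
  show "\<exists>Y c. finite Y \<and> (\<Sum>y\<in>Y. cmod (c y)) \<le> R + R' \<and>
     (\<forall>\<gamma>\<in>F. cmod (s \<gamma> + t \<gamma> - (\<Sum>y\<in>Y. c y * \<gamma> y)) \<le> \<eta>)"
  proof (intro exI[of _ "Y \<union> Z"] exI[of _ "\<lambda>y. c' y + d' y"] conjI ballI)
    have "(\<Sum>y\<in>Y \<union> Z. cmod (c' y + d' y)) \<le> (\<Sum>y\<in>Y \<union> Z. cmod (c' y)) + (\<Sum>y\<in>Y \<union> Z. cmod (d' y))"
      unfolding sum.distrib[symmetric] by (intro sum_mono norm_triangle_ineq)
    then show "(\<Sum>y\<in>Y \<union> Z. cmod (c' y + d' y)) \<le> R + R'"
      using c'[of "\<lambda>_. cmod"] d'[of "\<lambda>_. cmod"] Y(2) Z(2) by simp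
    fix \<gamma> assume \<gamma>: "\<gamma> \<in> F"
    have "(\<Sum>y\<in>Y \<union> Z. (c' y + d' y) * \<gamma> y) = (\<Sum>y\<in>Y. c y * \<gamma> y) + (\<Sum>y\<in>Z. d y * \<gamma> y)"
      using c'[of "\<lambda>y a. a * \<gamma> y"] d'[of "\<lambda>y a. a * \<gamma> y"] by (simp add: distrib_right sum.distrib)
    then have "s \<gamma> + t \<gamma> - (\<Sum>y\<in>Y \<union> Z. (c' y + d' y) * \<gamma> y)
        = (s \<gamma> - (\<Sum>y\<in>Y. c y * \<gamma> y)) + (t \<gamma> - (\<Sum>y\<in>Z. d y * \<gamma> y))"
      by simp
    also have "cmod \<dots> \<le> cmod (s \<gamma> - (\<Sum>y\<in>Y. c y * \<gamma> y)) + cmod (t \<gamma> - (\<Sum>y\<in>Z. d y * \<gamma> y))"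
      by (rule norm_triangle_ineq)
    also have "\<dots> \<le> \<eta> / 2 + \<eta> / 2"
      by (intro add_mono Y(3) Z(3) \<gamma>)
    finally show "cmod (s \<gamma> + t \<gamma> - (\<Sum>y\<in>Y \<union> Z. (c' y + d' y) * \<gamma> y)) \<le> \<eta>" by simp
  qed (use Y Z in auto)
qed

lemma in_hull_zero: "in_hull 0 F (\<lambda>\<gamma>. 0)"
  unfolding in_hull_def by (intro allI impI exI[of _ "{}"]) auto

lemma in_hull_scale:
  assumes t: "in_hull R F t"
  shows "in_hull (cmod a * R) F (\<lambda>\<gamma>. a * t \<gamma>)"
  unfolding in_hull_def
proof (intro allI impI)
  fix \<eta> :: real assume \<eta>: "0 < \<eta>"
  then have "0 < \<eta> / (cmod a + 1)" by (simp add: add_nonneg_pos)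
  then obtain Y c where Y: "finite Y" "(\<Sum>y\<in>Y. cmod (c y)) \<le> R"
    "\<And>\<gamma>. \<gamma> \<in> F \<Longrightarrow> cmod (t \<gamma> - (\<Sum>y\<in>Y. c y * \<gamma> y)) \<le> \<eta> / (cmod a + 1)"
    using t unfolding in_hull_def by meson
  show "\<exists>Y c. finite Y \<and> (\<Sum>y\<in>Y. cmod (c y)) \<le> cmod a * R \<and>
     (\<forall>\<gamma>\<in>F. cmod (a * t \<gamma> - (\<Sum>y\<in>Y. c y * \<gamma> y)) \<le> \<eta>)"
  proof (intro exI[of _ Y] exI[of _ "\<lambda>y. a * c y"] conjI ballI)
    show "(\<Sum>y\<in>Y. cmod (a * c y)) \<le> cmod a * R"
      using Y(2) by (simp add: norm_mult mult_left_mono flip: sum_distrib_left)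
    fix \<gamma> assume \<gamma>: "\<gamma> \<in> F"
    have "a * t \<gamma> - (\<Sum>y\<in>Y. a * c y * \<gamma> y) = a * (t \<gamma> - (\<Sum>y\<in>Y. c y * \<gamma> y))"
      by (simp add: right_diff_distrib sum_distrib_left mult.assoc)
    then have "cmod (a * t \<gamma> - (\<Sum>y\<in>Y. a * c y * \<gamma> y)) = cmod a * cmod (t \<gamma> - (\<Sum>y\<in>Y. c y * \<gamma> y))"
      by (simp only: norm_mult)
    also have "\<dots> \<le> cmod a * (\<eta> / (cmod a + 1))"
      using Y(3)[OF \<gamma>] by (rule mult_left_mono) simp
    also have "\<dots> \<le> \<eta>" using \<eta> by (simp add: divide_le_eq add_nonneg_pos)
    finally show "cmod (a * t \<gamma> - (\<Sum>y\<in>Y. a * c y * \<gamma> y)) \<le> \<eta>" .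
  qed (use Y in auto)
qed

text \<open>
  The points are \<open>\<phi> x\<close> rather than \<open>x\<close> because the Fourier transform integrates conjugate
  characters, which are characters evaluated at \<open>- x\<close>.
\<close>

lemma in_hull_integral:
  fixes m :: "'g::topological_space measure" and u :: "'g \<Rightarrow> complex" and \<phi> :: "'g \<Rightarrow> 'g"
  assumes m: "finite_measure m" "sets m = sets borel" and F: "finite F" and \<phi>: "inj \<phi>"
    and meas: "\<And>\<gamma>. \<gamma> \<in> F \<Longrightarrow> (\<lambda>x. u x * \<gamma> (\<phi> x)) \<in> borel_measurable borel"
    and u: "\<And>x. cmod (u x) \<le> 1" and bound: "\<And>\<gamma> x. \<gamma> \<in> F \<Longrightarrow> cmod (u x * \<gamma> (\<phi> x)) \<le> 1"
  shows "in_hull (measure m UNIV) F (\<lambda>\<gamma>. LINT x|m. u x * \<gamma> (\<phi> x))"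
  unfolding in_hull_def
proof (intro allI impI)
  interpret finite_measure m by fact
  have space: "space m = UNIV" using sets_eq_imp_space_eq[OF m(2)] by simp
  define W where "W = measure m UNIV"
  have W: "0 \<le> W" by (simp add: W_def)
  fix \<eta> :: real assume \<eta>: "0 < \<eta>"
  have \<eta>': "0 < \<eta> / (W + 1)" using \<eta> W by (simp add: add_nonneg_pos)
  obtain r :: "'g \<Rightarrow> 'g" where r: "finite (range r)" "\<And>y. r -` {y} \<in> sets borel"
    and close: "\<And>x \<gamma>. \<gamma> \<in> F \<Longrightarrow> cmod (u x * \<gamma> (\<phi> x) - u (r x) * \<gamma> (\<phi> (r x))) \<le> \<eta> / (W + 1)"
    by (rule finite_range_rounding[where I = F and h = "\<lambda>\<gamma> x. u x * \<gamma> (\<phi> x)", OF F _ _ \<eta>'])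
      (rule meas, assumption, rule bound, assumption, rule that)
  define w where "w y = measure m (r -` {y})" for y
  define c where "c z = of_real (w (inv \<phi> z)) * u (inv \<phi> z)" for z
  have c: "c (\<phi> y) = of_real (w y) * u y" for y by (simp add: c_def inv_f_f[OF \<phi>])
  have inj: "inj_on \<phi> (range r)" using \<phi> by (rule inj_on_subset) auto
  have "(\<Sum>y\<in>range r. w y) = (LINT x|m. (1::real))"
    using integral_finite_range(2)[OF m r, of "\<lambda>_. 1 :: real"] by (simp add: w_def)
  then have sumw: "(\<Sum>y\<in>range r. w y) = W" by (simp add: W_def space)
  show "\<exists>Y c. finite Y \<and> (\<Sum>y\<in>Y. cmod (c y)) \<le> measure m UNIV \<and>
     (\<forall>\<gamma>\<in>F. cmod ((LINT x|m. u x * \<gamma> (\<phi> x)) - (\<Sum>y\<in>Y. c y * \<gamma> y)) \<le> \<eta>)"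
  proof (intro exI[of _ "\<phi> ` range r"] exI[of _ c] conjI ballI)
    have "(\<Sum>z\<in>\<phi> ` range r. cmod (c z)) = (\<Sum>y\<in>range r. w y * cmod (u y))"
      unfolding sum.reindex[OF inj] by (simp add: c norm_mult w_def)
    also have "\<dots> \<le> (\<Sum>y\<in>range r. w y * 1)"
      using u by (intro sum_mono mult_left_mono) (auto simp: w_def)
    finally show "(\<Sum>z\<in>\<phi> ` range r. cmod (c z)) \<le> measure m UNIV"
      using sumw by (simp add: W_def)
    fix \<gamma> assume \<gamma>: "\<gamma> \<in> F"
    let ?h = "\<lambda>x. u x * \<gamma> (\<phi> x)"
    have int: "integrable m ?h"
      using meas[OF \<gamma>] bound[OF \<gamma>] m(2)
      by (intro integrable_const_bound[of _ 1]) (auto simp: measurable_cong_sets[OF m(2) refl])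
    have "(\<Sum>z\<in>\<phi> ` range r. c z * \<gamma> z) = (\<Sum>y\<in>range r. w y *\<^sub>R ?h y)"
      unfolding sum.reindex[OF inj] by (simp add: c scaleR_conv_of_real mult.assoc)
    also have "\<dots> = (LINT x|m. ?h (r x))"
      using integral_finite_range(2)[OF m r, of ?h] by (simp add: w_def)
    finally have "(LINT x|m. ?h x) - (\<Sum>z\<in>\<phi> ` range r. c z * \<gamma> z) = (LINT x|m. ?h x - ?h (r x))"
      using int integral_finite_range(1)[OF m r, of ?h] by simp
    also have "cmod \<dots> \<le> (LINT x|m. cmod (?h x - ?h (r x)))"
      by (rule integral_norm_bound)
    also have "\<dots> \<le> (LINT x|m. \<eta> / (W + 1))"
      using int integral_finite_range(1)[OF m r, of ?h] close[OF \<gamma>]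
      by (intro integral_mono) auto
    also have "\<dots> = W * (\<eta> / (W + 1))" by (simp add: space W_def)
    also have "\<dots> \<le> \<eta>" using W \<eta> by (simp add: divide_le_eq add_nonneg_pos)
    finally show "cmod ((LINT x|m. ?h x) - (\<Sum>z\<in>\<phi> ` range r. c z * \<gamma> z)) \<le> \<eta>" .
  qed (use r in auto)
qed

section \<open>Complex measures\<close>

text \<open>
  From a set with subsets of arbitrarily large values one can split off a piece of value at least 1
  such that the rest has the same property.  Repeating this would give a disjoint sequence whose
  values do not tend to 0.
\<close>

lemma countably_additive_bounded:
  fixes f :: "'g::topological_space set \<Rightarrow> real"
  assumes ca: "\<And>A :: nat \<Rightarrow> 'g set. range A \<subseteq> sets borel \<Longrightarrow> disjoint_family A \<Longrightarrow> (\<lambda>n. f (A n)) sums f (\<Union>n. A n)"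
  shows "\<exists>B. \<forall>A\<in>sets borel. \<bar>f A\<bar> \<le> B"
proof (rule ccontr)
  assume unbounded: "\<not> ?thesis"
  have "(\<lambda>n::nat. f {}) sums f (\<Union>n::nat. {})"
    by (rule ca[of "\<lambda>_. {}"]) (auto simp: disjoint_family_on_def)
  then have "(\<lambda>n::nat. f {}) \<longlonglongrightarrow> 0" by (intro summable_LIMSEQ_zero sums_summable)
  then have empty: "f {} = 0" by (simp add: LIMSEQ_const_iff)
  have additive: "f (A \<union> B) = f A + f B" if "A \<in> sets borel" "B \<in> sets borel" "A \<inter> B = {}" for A B
  proof -
    define D where "D n = (if n = 0 then A else if n = 1 then B else {})" for n :: nat
    have "(\<lambda>n. f (D n)) sums f (\<Union>n. D n)"
      using that by (intro ca) (auto simp: D_def disjoint_family_on_def)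
    moreover have "(\<Union>n. D n) = A \<union> B"
      by (auto simp: D_def split: if_splits intro: exI[of _ 0] exI[of _ 1])
    moreover have "(\<lambda>n. f (D n)) sums (\<Sum>n\<in>{0, 1}. f (D n))"
      by (rule sums_finite) (auto simp: D_def empty)
    ultimately show ?thesis
      using sums_unique2 by (fastforce simp: D_def)
  qed
  define bad where "bad A \<longleftrightarrow> A \<in> sets borel \<and> (\<forall>B. \<exists>C\<in>sets borel. C \<subseteq> A \<and> B < \<bar>f C\<bar>)" for A
  have "bad UNIV" using unbounded by (simp add: bad_def not_le)
  have split: "\<exists>A'. bad A' \<and> A' \<subseteq> A \<and> 1 \<le> \<bar>f (A - A')\<bar>" if A: "bad A" for A
  proof -
    obtain C where C: "C \<in> sets borel" "C \<subseteq> A" "\<bar>f A\<bar> + 1 < \<bar>f C\<bar>"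
      using A unfolding bad_def by blast
    have mA: "A \<in> sets borel" "A - C \<in> sets borel" using A C by (auto simp: bad_def)
    have "f (C \<union> (A - C)) = f C + f (A - C)" using C mA by (intro additive) auto
    moreover have "C \<union> (A - C) = A" using C by auto
    ultimately have fA: "f A = f C + f (A - C)" by simp
    have "bad C \<or> bad (A - C)"
    proof (rule ccontr)
      assume "\<not> (bad C \<or> bad (A - C))"
      then obtain B1 B2 where B1: "\<And>D. D \<in> sets borel \<Longrightarrow> D \<subseteq> C \<Longrightarrow> \<bar>f D\<bar> \<le> B1"
        and B2: "\<And>D. D \<in> sets borel \<Longrightarrow> D \<subseteq> A - C \<Longrightarrow> \<bar>f D\<bar> \<le> B2"
        using C mA unfolding bad_def by (metis not_le)
      obtain D where D: "D \<in> sets borel" "D \<subseteq> A" "B1 + B2 < \<bar>f D\<bar>"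
        using A unfolding bad_def by blast
      have "f ((D \<inter> C) \<union> (D - C)) = f (D \<inter> C) + f (D - C)"
        using D C by (intro additive) auto
      moreover have "(D \<inter> C) \<union> (D - C) = D" by auto
      ultimately have "f D = f (D \<inter> C) + f (D - C)" by simp
      moreover have "\<bar>f (D \<inter> C)\<bar> \<le> B1" "\<bar>f (D - C)\<bar> \<le> B2"
        using D C by (auto intro!: B1 B2)
      ultimately show False using D(3) by linarith
    qed
    then show ?thesis
    proof
      assume "bad C"
      then show ?thesis using C fA by (intro exI[of _ C]) auto
    next
      assume "bad (A - C)"
      moreover have "A - (A - C) = C" using C by auto
      ultimately show ?thesis using C by (intro exI[of _ "A - C"]) auto
    qed
  qed
  obtain A where A: "\<And>n. bad (A n)" "\<And>n. A (Suc n) \<subseteq> A n" "\<And>n. 1 \<le> \<bar>f (A n - A (Suc n))\<bar>"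
    using dependent_nat_choice[of "\<lambda>_. bad" "\<lambda>_ A A'. A' \<subseteq> A \<and> 1 \<le> \<bar>f (A - A')\<bar>"] \<open>bad UNIV\<close> split
    by metis
  define D where "D n = A n - A (Suc n)" for n
  have anti: "A n \<subseteq> A m" if "m \<le> n" for m n
    using A(2) that by (rule lift_Suc_antimono_le)
  have "D m \<inter> D n = {}" if "m < n" for m n
    using anti[of "Suc m" n] that by (auto simp: D_def)
  then have "disjoint_family D"
    unfolding disjoint_family_on_def by (metis inf_commute linorder_neqE_nat)
  moreover have "range D \<subseteq> sets borel" using A(1) by (auto simp: D_def bad_def)
  ultimately have "(\<lambda>n. f (D n)) sums f (\<Union>n. D n)" by (intro ca)
  then have "(\<lambda>n. f (D n)) \<longlonglongrightarrow> 0" by (intro summable_LIMSEQ_zero sums_summable)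
  then have "eventually (\<lambda>n. \<bar>f (D n)\<bar> < 1) sequentially"
    by (intro order_tendstoD(2)[of _ 0] tendsto_rabs_zero) auto
  then obtain n where "\<bar>f (D n)\<bar> < 1" by (auto simp: eventually_sequentially)
  then show False using A(3)[of n] by (simp add: D_def)
qed

text \<open>
  A set function that is not a measure is turned by \<open>measure_of\<close> into the null measure, so that the
  bound on the total mass holds in any case.
\<close>

lemma upper_variation_finite:
  fixes f :: "'g::topological_space set \<Rightarrow> real"
  assumes B: "\<And>A. A \<in> sets borel \<Longrightarrow> f A \<le> B"
  shows "finite_measure (upper_variation f)" "sets (upper_variation f) = sets borel"
proof -
  show s: "sets (upper_variation f) = sets borel"
    unfolding upper_variation_def using sets.sigma_sets_eq[of borel] by (simp add: sets_measure_of)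
  have space: "space (upper_variation f) = UNIV"
    using sets_eq_imp_space_eq[OF s] by simp
  have "emeasure (upper_variation f) UNIV \<le> (SUP A\<in>{A \<in> sets borel. A \<subseteq> UNIV}. ennreal (f A))"
    unfolding upper_variation_def emeasure_measure_of_conv by simp
  also have "\<dots> \<le> ennreal B"
    using B by (intro SUP_least ennreal_leI) auto
  finally have "emeasure (upper_variation f) UNIV \<noteq> \<infinity>"
    using ennreal_less_top[of B] by (metis infinity_ennreal_def leD)
  then show "finite_measure (upper_variation f)"
    by (intro finite_measureI) (simp add: space)
qed

section \<open>Sidon sets\<close>

lemma dual_groupD:
  assumes "\<gamma> \<in> dual_group"
  shows dual_group_continuous: "continuous_on UNIV \<gamma>"
    and dual_group_norm: "cmod (\<gamma> x) = 1"
    and dual_group_add: "\<gamma> (x + y) = \<gamma> x * \<gamma> y"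
  using assms by (auto simp: dual_group_def)

lemma dual_group_borel: "\<gamma> \<in> dual_group \<Longrightarrow> \<gamma> \<in> borel_measurable borel"
  by (intro borel_measurable_continuous_onI dual_group_continuous)

lemma dual_group_zero: "\<gamma> \<in> dual_group \<Longrightarrow> \<gamma> 0 = 1"
  using dual_group_add[of \<gamma> 0 0] dual_group_norm[of \<gamma> 0] by (cases "\<gamma> 0 = 0") auto

lemma cnj_mult_self: "cmod z = 1 \<Longrightarrow> cnj z * z = 1"
  using complex_norm_square[of z] by (simp add: mult.commute[of "cnj z" z])

lemma dual_group_minus:
  assumes "\<gamma> \<in> dual_group"
  shows "\<gamma> (- x) = cnj (\<gamma> x)"
proof -
  have "\<gamma> (- x) * \<gamma> x = 1"
    using dual_group_add[OF assms, of "- x" x] dual_group_zero[OF assms] by simp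
  then have "\<gamma> (- x) * \<gamma> x = cnj (\<gamma> x) * \<gamma> x"
    using cnj_mult_self[OF dual_group_norm[OF assms, of x]] by simp
  moreover have "\<gamma> x \<noteq> 0" using dual_group_norm[OF assms, of x] by auto
  ultimately show ?thesis by simp
qed

text \<open>
  The mass \<open>R\<close> is that of the four measures in the definition of the integral, whatever \<open>F\<close> is.
\<close>

lemma fourier_transform_in_hull:
  fixes \<nu> :: "'g::{topological_ab_group_add, t2_space} set \<Rightarrow> complex"
  assumes \<nu>: "regular_complex_measure \<nu>"
  shows "\<exists>R. \<forall>F. finite F \<and> F \<subseteq> dual_group \<longrightarrow> in_hull R F (fourier_transform \<nu>)"
proof -
  have ca: "(\<lambda>n. \<nu> (A n)) sums \<nu> (\<Union>n. A n)" if "range A \<subseteq> sets borel" "disjoint_family A" for A :: "nat \<Rightarrow> 'g set"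
    using \<nu> that unfolding regular_complex_measure_def by blast
  obtain B1 where B1: "\<And>A. A \<in> sets borel \<Longrightarrow> \<bar>Re (\<nu> A)\<bar> \<le> B1"
    using countably_additive_bounded[of "\<lambda>A. Re (\<nu> A)"] sums_Re[OF ca] by blast
  obtain B2 where B2: "\<And>A. A \<in> sets borel \<Longrightarrow> \<bar>Im (\<nu> A)\<bar> \<le> B2"
    using countably_additive_bounded[of "\<lambda>A. Im (\<nu> A)"] sums_Im[OF ca] by blast
  define m where "m = (\<lambda>f. upper_variation (f :: 'g set \<Rightarrow> real))"
  define W where "W f = measure (m f) UNIV" for f
  have hull: "in_hull (W f) F (\<lambda>\<gamma>. LINT t|m f. cnj (\<gamma> t))"
    if f: "\<And>A. A \<in> sets borel \<Longrightarrow> f A \<le> B" and F: "finite F" "F \<subseteq> dual_group" for f B F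
  proof -
    have "in_hull (W f) F (\<lambda>\<gamma>. LINT x|m f. 1 * \<gamma> (- x))"
      unfolding W_def m_def
    proof (rule in_hull_integral[OF upper_variation_finite[OF f]])
      fix \<gamma> assume "\<gamma> \<in> F"
      then have \<gamma>: "\<gamma> \<in> dual_group" using F by auto
      have "\<gamma> \<circ> uminus \<in> borel_measurable borel"
        by (intro borel_measurable_continuous_onI continuous_on_compose)
          (auto intro: continuous_on_minus continuous_on_id continuous_on_subset[OF dual_group_continuous[OF \<gamma>]])
      then show "(\<lambda>x. 1 * \<gamma> (- x)) \<in> borel_measurable borel" by (simp add: comp_def)
      show "cmod (1 * \<gamma> (- x)) \<le> 1" for x using dual_group_norm[OF \<gamma>] by simp
    qed (use F in auto)
    then show ?thesis
      by (rule in_hull_cong) (use F in \<open>auto simp: dual_group_minus subset_iff intro!: Bochner_Integration.integral_cong\<close>)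
  qed
  let ?a = "\<lambda>A. Re (\<nu> A)" and ?b = "\<lambda>A. - Re (\<nu> A)" and ?c = "\<lambda>A. Im (\<nu> A)" and ?d = "\<lambda>A. - Im (\<nu> A)"
  have "in_hull ((W ?a + cmod (-1) * W ?b) + cmod \<i> * (W ?c + cmod (-1) * W ?d)) F (fourier_transform \<nu>)"
    if F: "finite F" "F \<subseteq> dual_group" for F
  proof -
    have bounds: "?a A \<le> B1" "?b A \<le> B1" "?c A \<le> B2" "?d A \<le> B2" if "A \<in> sets borel" for A
      using B1[OF that] B2[OF that] by linarith+
    have "in_hull ((W ?a + cmod (-1) * W ?b) + cmod \<i> * (W ?c + cmod (-1) * W ?d)) F
        (\<lambda>\<gamma>. ((LINT t|m ?a. cnj (\<gamma> t)) + (-1) * (LINT t|m ?b. cnj (\<gamma> t)))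
          + \<i> * ((LINT t|m ?c. cnj (\<gamma> t)) + (-1) * (LINT t|m ?d. cnj (\<gamma> t))))"
      by (intro in_hull_add in_hull_scale hull[OF bounds(1) F] hull[OF bounds(2) F]
          hull[OF bounds(3) F] hull[OF bounds(4) F])
    then show ?thesis
      by (rule in_hull_cong) (simp add: fourier_transform_def complex_measure_integral_def m_def)
  qed
  then show ?thesis by blast
qed

lemma normalized_haar_finite:
  assumes "normalized_haar \<mu>"
  shows "finite_measure \<mu>" "sets \<mu> = sets borel" "space \<mu> = UNIV" "measure \<mu> UNIV = 1"
proof -
  show s: "sets \<mu> = sets borel" using assms by (simp add: normalized_haar_def)
  then show sp: "space \<mu> = UNIV" using sets_eq_imp_space_eq[of \<mu> borel] by simp
  show "finite_measure \<mu>"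
    using assms sp by (intro finite_measureI) (simp add: normalized_haar_def)
  show "measure \<mu> UNIV = 1" using assms by (simp add: normalized_haar_def measure_def)
qed

lemma haar_integral_translate:
  fixes \<mu> :: "'g::{topological_ab_group_add, t2_space} measure" and f :: "'g \<Rightarrow> 'b::{banach, second_countable_topology}"
  assumes \<mu>: "normalized_haar \<mu>" and f: "f \<in> borel_measurable borel"
  shows "(LINT x|\<mu>. f (a + x)) = (LINT x|\<mu>. f x)"
proof -
  have "(\<lambda>x. a + x) \<in> borel_measurable borel"
    by (intro borel_measurable_continuous_onI continuous_intros)
  then have meas: "(\<lambda>x. a + x) \<in> measurable \<mu> borel"
    by (simp add: measurable_cong_sets[OF normalized_haar_finite(2)[OF \<mu>] refl])
  have "distr \<mu> borel (\<lambda>x. a + x) = \<mu>"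
    using \<mu> by (simp add: normalized_haar_def)
  then have "(LINT x|\<mu>. f x) = (LINT x|distr \<mu> borel (\<lambda>x. a + x). f x)" by simp
  also have "\<dots> = (LINT x|\<mu>. f (a + x))" by (rule integral_distr[OF meas f])
  finally show ?thesis by simp
qed

lemma dual_group_product_borel:
  assumes "\<gamma> \<in> dual_group" "\<gamma>' \<in> dual_group"
  shows "(\<lambda>x. cnj (\<gamma>' x) * \<gamma> x) \<in> borel_measurable borel"
  by (rule borel_measurable_continuous_onI, rule continuous_on_mult, rule continuous_on_cnj)
    (rule dual_group_continuous[OF assms(2)], rule dual_group_continuous[OF assms(1)])

lemma haar_orthogonality:
  assumes \<mu>: "normalized_haar \<mu>" and \<gamma>: "\<gamma> \<in> dual_group" "\<gamma>' \<in> dual_group"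
  shows "(LINT x|\<mu>. cnj (\<gamma>' x) * \<gamma> x) = (if \<gamma> = \<gamma>' then 1 else 0)"
proof (cases "\<gamma> = \<gamma>'")
  case True
  then have "(LINT x|\<mu>. cnj (\<gamma>' x) * \<gamma> x) = (LINT x|\<mu>. 1)"
    by (simp add: cnj_mult_self[OF dual_group_norm[OF \<gamma>(2)]])
  then show ?thesis using True normalized_haar_finite[OF \<mu>] by simp
next
  case False
  define h where "h x = cnj (\<gamma>' x) * \<gamma> x" for x
  obtain a where a: "\<gamma> a \<noteq> \<gamma>' a" using False unfolding fun_eq_iff by blast
  have "h a \<noteq> 1"
  proof
    assume "h a = 1"
    then have "\<gamma>' a * (cnj (\<gamma>' a) * \<gamma> a) = \<gamma>' a" by (simp add: h_def)
    then have "(cnj (\<gamma>' a) * \<gamma>' a) * \<gamma> a = \<gamma>' a" by (simp only: mult_ac)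
    then show False using a cnj_mult_self[OF dual_group_norm[OF \<gamma>(2)], of a] by simp
  qed
  have "(LINT x|\<mu>. h x) = (LINT x|\<mu>. h (a + x))"
    unfolding h_def
    by (rule haar_integral_translate[OF \<mu> dual_group_product_borel[OF \<gamma>], symmetric])
  also have "\<dots> = (LINT x|\<mu>. h a * h x)"
    by (simp add: h_def dual_group_add[OF \<gamma>(1)] dual_group_add[OF \<gamma>(2)] mult_ac)
  also have "\<dots> = h a * (LINT x|\<mu>. h x)" by simp
  finally have "(LINT x|\<mu>. h x) = 0" using \<open>h a \<noteq> 1\<close> by simp
  then show ?thesis using False by (simp add: h_def)
qed

lemma unit_vector_in_hull:
  fixes \<mu> :: "'g::{topological_ab_group_add, t2_space} measure" and F :: "('g \<Rightarrow> complex) set"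
  assumes \<mu>: "normalized_haar \<mu>" and F: "finite F" "F \<subseteq> dual_group" and \<gamma>': "\<gamma>' \<in> dual_group"
  shows "in_hull 1 F (\<lambda>\<gamma>. if \<gamma> = \<gamma>' then 1 else 0)"
proof -
  have "in_hull (measure \<mu> UNIV) F (\<lambda>\<gamma>. LINT x|\<mu>. cnj (\<gamma>' x) * \<gamma> x)"
  proof (rule in_hull_integral[where \<phi> = "\<lambda>x. x" and u = "\<lambda>x. cnj (\<gamma>' x)",
        OF normalized_haar_finite(1,2)[OF \<mu>] F(1)])
    show "inj (\<lambda>x::'g. x)" by simp
    show "cmod (cnj (\<gamma>' x)) \<le> 1" for x by (simp add: dual_group_norm[OF \<gamma>'])
    fix \<gamma> assume "\<gamma> \<in> F"
    then have \<gamma>: "\<gamma> \<in> dual_group" using F by auto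
    show "(\<lambda>x. cnj (\<gamma>' x) * \<gamma> x) \<in> borel_measurable borel"
      by (rule dual_group_product_borel[OF \<gamma> \<gamma>'])
    show "cmod (cnj (\<gamma>' x) * \<gamma> x) \<le> 1" for x
      by (simp add: norm_mult dual_group_norm[OF \<gamma>] dual_group_norm[OF \<gamma>'])
  qed
  then have "in_hull 1 F (\<lambda>\<gamma>. LINT x|\<mu>. cnj (\<gamma>' x) * \<gamma> x)"
    by (simp only: normalized_haar_finite(4)[OF \<mu>])
  then show ?thesis
  proof (rule in_hull_cong)
    fix \<gamma> assume "\<gamma> \<in> F"
    then have "\<gamma> \<in> dual_group" using F by blast
    then show "(LINT x|\<mu>. cnj (\<gamma>' x) * \<gamma> x) = (if \<gamma> = \<gamma>' then 1 else 0)"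
      by (rule haar_orthogonality[OF \<mu> _ \<gamma>'])
  qed
qed

text \<open>
  Prescribed signs are interpolated with a uniform bound on the total mass.  Otherwise a gliding
  hump yields signs on all of \<open>E\<close> whose restrictions to suitable finite sets need arbitrarily
  large mass, whereas a single measure interpolates them.  Fixing the signs on a finite set
  \<open>F\<close> once and for all costs at most \<open>2 card F\<close>, by orthogonality of the characters.
\<close>

lemma sidon_uniform_signs:
  fixes \<mu> :: "'g::{topological_ab_group_add, t2_space} measure" and E :: "('g \<Rightarrow> complex) set"
  assumes \<mu>: "normalized_haar \<mu>" and E: "sidon_set E"
  shows "\<exists>M>0. \<forall>F t. finite F \<and> F \<subseteq> E \<and> (\<forall>\<gamma>. t \<gamma> \<in> {-1, 1}) \<longrightarrow> in_hull M F t"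
proof (rule ccontr)
  define sign where "sign t \<longleftrightarrow> (\<forall>\<gamma>. t \<gamma> \<in> {-1, 1})" for t :: "('g \<Rightarrow> complex) \<Rightarrow> complex"
  assume "\<not> ?thesis"
  then have "\<not> (\<exists>M>0. \<forall>F t. finite F \<and> F \<subseteq> E \<and> sign t \<longrightarrow> in_hull M F t)"
    unfolding sign_def .
  then have large: "\<exists>F t. finite F \<and> F \<subseteq> E \<and> sign t \<and> \<not> in_hull M F t" if "0 < M" for M
    using that by blast
  have Ed: "E \<subseteq> dual_group" using E by (simp add: sidon_set_def)
  define P where "P z \<longleftrightarrow> finite (fst z) \<and> fst z \<subseteq> E \<and> sign (snd z)"
    for z :: "('g \<Rightarrow> complex) set \<times> (('g \<Rightarrow> complex) \<Rightarrow> complex)"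
  define Q where "Q n z z' \<longleftrightarrow> fst z \<subseteq> fst z' \<and> (\<forall>\<gamma>\<in>fst z. snd z' \<gamma> = snd z \<gamma>) \<and> \<not> in_hull (real n) (fst z') (snd z')"
    for n and z z' :: "('g \<Rightarrow> complex) set \<times> (('g \<Rightarrow> complex) \<Rightarrow> complex)"
  have "P ({}, \<lambda>_. 1)" by (simp add: P_def sign_def)
  have step: "\<exists>z'. P z' \<and> Q n z z'" if z: "P z" for n z
  proof -
    obtain F t where z_eq: "z = (F, t)" by (cases z)
    have F: "finite F" "F \<subseteq> E" and t: "sign t" using z by (auto simp: P_def z_eq)
    have "0 < real n + real (card F) * 2 + 1" by (simp add: add_nonneg_pos)
    from large[OF this] obtain F' s where F': "finite F'" "F' \<subseteq> E"
      and s: "sign s" and far: "\<not> in_hull (real n + real (card F) * 2 + 1) F' s"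
      by blast
    define t' where "t' \<gamma> = (if \<gamma> \<in> F then t \<gamma> else s \<gamma>)" for \<gamma>
    \<comment> \<open>the correction that changes \<open>t'\<close> into \<open>s\<close> on \<open>F\<close>\<close>
    have corr: "in_hull (real (card H) * 2) F' (\<lambda>\<gamma>. \<Sum>\<gamma>'\<in>H. (s \<gamma>' - t \<gamma>') * (if \<gamma> = \<gamma>' then 1 else 0))"
      if "finite H" "H \<subseteq> F" for H
      using that
    proof (induction H rule: finite_induct)
      case empty
      then show ?case using in_hull_zero by simp
    next
      case (insert \<gamma>' H)
      have "cmod (s \<gamma>' - t \<gamma>') \<le> 2"
        using s[unfolded sign_def, rule_format, of \<gamma>'] t[unfolded sign_def, rule_format, of \<gamma>'] by auto
      then have "in_hull 2 F' (\<lambda>\<gamma>. (s \<gamma>' - t \<gamma>') * (if \<gamma> = \<gamma>' then 1 else 0))"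
      proof (intro in_hull_mono[OF in_hull_scale[OF unit_vector_in_hull[OF \<mu>]] _ subset_refl])
        show "finite F'" "F' \<subseteq> dual_group" "\<gamma>' \<in> dual_group"
          using insert.prems F F' Ed by blast+
      qed simp
      from in_hull_add[OF this insert.IH] show ?case
        using insert by (simp add: algebra_simps)
    qed
    have "\<not> in_hull (real n) (F \<union> F') t'"
    proof
      assume "in_hull (real n) (F \<union> F') t'"
      then have "in_hull (real n) F' t'" by (rule in_hull_mono) auto
      from in_hull_add[OF this corr[OF F(1) subset_refl]]
      have "in_hull (real n + real (card F) * 2) F' s"
      proof (rule in_hull_cong)
        fix \<gamma>
        show "t' \<gamma> + (\<Sum>\<gamma>'\<in>F. (s \<gamma>' - t \<gamma>') * (if \<gamma> = \<gamma>' then 1 else 0)) = s \<gamma>"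
          using F(1) by (simp add: t'_def if_distrib cong: if_cong)
      qed
      then have "in_hull (real n + real (card F) * 2 + 1) F' s"
        by (rule in_hull_mono) simp_all
      then show False using far by blast
    qed
    then have "Q n z (F \<union> F', t')" by (simp add: Q_def z_eq t'_def)
    moreover have "sign t'"
      using s t unfolding t'_def sign_def by simp
    then have "P (F \<union> F', t')" using F F' by (simp add: P_def)
    ultimately show ?thesis by blast
  qed
  have "\<exists>z. \<forall>n. P (z n) \<and> Q n (z n) (z (Suc n))"
  proof (rule dependent_nat_choice)
    show "\<exists>z. P z" using \<open>P ({}, \<lambda>_. 1)\<close> by (rule exI)
  qed (rule step)
  then obtain z where z: "\<And>n. P (z n)" "\<And>n. Q n (z n) (z (Suc n))" by blast
  define F where "F n = fst (z n)" for n
  define t where "t n = snd (z n)" for n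
  have F: "F n \<subseteq> F (Suc n)" and t: "\<And>\<gamma>. \<gamma> \<in> F n \<Longrightarrow> t (Suc n) \<gamma> = t n \<gamma>"
    and far: "\<not> in_hull (real n) (F (Suc n)) (t (Suc n))" and fin: "finite (F n)" "F n \<subseteq> E"
    and sgn: "sign (t n)" for n
    using z(1)[of n] z(2)[of n] unfolding P_def Q_def F_def t_def by blast+
  have F_mono: "F m \<subseteq> F n" if "m \<le> n" for m n
    using F that by (rule lift_Suc_mono_le)
  have t_stable: "t (m + k) \<gamma> = t m \<gamma>" if "\<gamma> \<in> F m" for m k \<gamma>
  proof (induction k)
    case (Suc k)
    have "\<gamma> \<in> F (m + k)" using that F_mono[of m "m + k"] by auto
    then show ?case using t[of \<gamma> "m + k"] Suc by simp
  qed simp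
  define \<epsilon> where "\<epsilon> \<gamma> = (if \<exists>n. \<gamma> \<in> F n then t (LEAST n. \<gamma> \<in> F n) \<gamma> else 1)" for \<gamma>
  have \<epsilon>: "\<epsilon> \<gamma> = t n \<gamma>" if "\<gamma> \<in> F n" for \<gamma> n
  proof -
    define l where "l = (LEAST n. \<gamma> \<in> F n)"
    have "\<gamma> \<in> F l" unfolding l_def using that by (rule LeastI)
    have "l \<le> n" unfolding l_def using that by (rule Least_le)
    then have "t n \<gamma> = t l \<gamma>" using t_stable[OF \<open>\<gamma> \<in> F l\<close>, of "n - l"] by simp
    moreover have "\<exists>n. \<gamma> \<in> F n" using that by blast
    ultimately show ?thesis by (simp add: \<epsilon>_def l_def)
  qed
  have "\<epsilon> \<gamma> \<in> {-1, 1}" for \<gamma>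
    unfolding \<epsilon>_def using sgn[of "LEAST n. \<gamma> \<in> F n"] by (simp add: sign_def)
  then obtain \<nu> where \<nu>: "regular_complex_measure \<nu>" "\<And>\<gamma>. \<gamma> \<in> E \<Longrightarrow> fourier_transform \<nu> \<gamma> = \<epsilon> \<gamma>"
    using E unfolding sidon_set_def by blast
  obtain R where R: "\<And>F. finite F \<Longrightarrow> F \<subseteq> dual_group \<Longrightarrow> in_hull R F (fourier_transform \<nu>)"
    using fourier_transform_in_hull[OF \<nu>(1)] by blast
  obtain n :: nat where n: "R \<le> real n" using real_arch_simple by blast
  have "in_hull R (F (Suc n)) (fourier_transform \<nu>)"
    using fin Ed by (intro R) auto
  then have "in_hull R (F (Suc n)) (t (Suc n))"
  proof (rule in_hull_cong)
    fix \<gamma> assume \<gamma>: "\<gamma> \<in> F (Suc n)"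
    then have "\<gamma> \<in> E" using fin(2) by blast
    then show "fourier_transform \<nu> \<gamma> = t (Suc n) \<gamma>"
      by (simp only: \<nu>(2) \<epsilon>[OF \<gamma>])
  qed
  then have "in_hull (real n) (F (Suc n)) (t (Suc n))"
    using n by (rule in_hull_mono) simp
  then show False using far by blast
qed

text \<open>
  By convexity: a coordinate in \<open>[-1, 1]\<close> is an average of the two signs.
\<close>

lemma sidon_uniform_real:
  assumes M: "0 \<le> M" "\<And>t. (\<forall>\<gamma>. t \<gamma> \<in> {-1, 1}) \<Longrightarrow> in_hull M F t"
    and G: "finite G"
  shows "(\<forall>\<gamma>. \<bar>a \<gamma>\<bar> \<le> 1) \<Longrightarrow> (\<forall>\<gamma>. \<gamma> \<notin> G \<longrightarrow> a \<gamma> \<in> {-1, 1}) \<Longrightarrow> in_hull M F (\<lambda>\<gamma>. of_real (a \<gamma>))"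
  using G
proof (induction G arbitrary: a rule: finite_induct)
  case empty
  have "of_real (a \<gamma>) \<in> {-1, 1 :: complex}" for \<gamma>
    using empty(2)[rule_format, of \<gamma>] by auto
  then show ?case by (intro M) blast
next
  case (insert \<gamma>' G)
  define u where "u = (1 + a \<gamma>') / 2"
  have u: "0 \<le> u" "u \<le> 1"
    using insert.prems(1)[rule_format, of \<gamma>'] by (auto simp: u_def abs_le_iff)
  have ind: "in_hull M F (\<lambda>\<gamma>. of_real ((a(\<gamma>' := v)) \<gamma>))" if "v \<in> {-1, 1}" for v
    by (rule insert.IH) (use insert.prems that in auto)
  have "in_hull (cmod (of_real u) * M + cmod (of_real (1 - u)) * M) F
      (\<lambda>\<gamma>. of_real u * of_real ((a(\<gamma>' := 1)) \<gamma>) + of_real (1 - u) * of_real ((a(\<gamma>' := -1)) \<gamma>))"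
    by (intro in_hull_add in_hull_scale ind) auto
  moreover have "cmod (of_real u) * M + cmod (of_real (1 - u)) * M = M"
    unfolding norm_of_real using u by (simp add: algebra_simps)
  moreover have "of_real u * of_real ((a(\<gamma>' := 1)) \<gamma>) + of_real (1 - u) * of_real ((a(\<gamma>' := -1)) \<gamma>) = (of_real (a \<gamma>) :: complex)" for \<gamma>
    by (auto simp: u_def field_simps)
  ultimately show ?case by simp
qed

theorem sidon_polydisc_hull:
  fixes \<mu> :: "'g::{topological_ab_group_add, t2_space} measure" and E :: "('g \<Rightarrow> complex) set"
  assumes \<mu>: "normalized_haar \<mu>" and E: "sidon_set E"
  shows "\<exists>M>0. \<forall>(n::nat) \<gamma> t \<eta>. inj_on \<gamma> {..<n} \<and> \<gamma> ` {..<n} \<subseteq> E \<and> (\<forall>k<n. cmod (t k) \<le> 1) \<and> 0 < \<eta> \<longrightarrow>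
    (\<exists>Y c. finite Y \<and> (\<Sum>y\<in>Y. cmod (c y)) \<le> M \<and> (\<forall>k<n. cmod (t k - (\<Sum>y\<in>Y. c y * \<gamma> k y)) \<le> \<eta>))"
proof -
  obtain M where M0: "0 < M"
    and signs: "\<forall>F t. finite F \<and> F \<subseteq> E \<and> (\<forall>\<gamma>. t \<gamma> \<in> {-1, 1}) \<longrightarrow> in_hull M F t"
    using sidon_uniform_signs[OF \<mu> E] by (elim exE conjE) (rule that)
  have "\<exists>Y c. finite Y \<and> (\<Sum>y\<in>Y. cmod (c y)) \<le> 2 * M \<and> (\<forall>k<n. cmod (t k - (\<Sum>y\<in>Y. c y * \<gamma> k y)) \<le> \<eta>)"
    if \<gamma>: "inj_on \<gamma> {..<n}" "\<gamma> ` {..<n} \<subseteq> E" and t: "\<forall>k<n. cmod (t k) \<le> 1" and \<eta>: "0 < \<eta>" for n :: nat and \<gamma> t \<eta>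
  proof -
    define F where "F = \<gamma> ` {..<n}"
    define s where "s \<xi> = (if \<xi> \<in> F then t (the_inv_into {..<n} \<gamma> \<xi>) else 1)" for \<xi>
    have s: "s (\<gamma> k) = t k" if "k < n" for k
      using that \<gamma>(1) by (simp add: s_def F_def the_inv_into_f_f)
    have s1: "cmod (s \<xi>) \<le> 1" for \<xi>
    proof (cases "\<xi> \<in> F")
      case True
      then obtain k where "k < n" "\<xi> = \<gamma> k" by (auto simp: F_def)
      then show ?thesis using s t by simp
    qed (simp add: s_def)
    have F: "finite F" "F \<subseteq> E" using \<gamma>(2) by (auto simp: F_def)
    have real_hull: "in_hull M F (\<lambda>\<xi>. of_real (a \<xi>))" if "\<And>\<xi>. \<bar>a \<xi>\<bar> \<le> 1" for a
    proof -
      define a' where "a' \<xi> = (if \<xi> \<in> F then a \<xi> else 1)" for \<xi>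
      have "in_hull M F (\<lambda>\<xi>. of_real (a' \<xi>))"
      proof (rule sidon_uniform_real)
        show "in_hull M F t" if "\<forall>\<gamma>. t \<gamma> \<in> {-1, 1}" for t
          by (rule signs[THEN spec, THEN spec, THEN mp, OF conjI[OF F(1) conjI[OF F(2) that]]])
      qed (use M0 F that in \<open>auto simp: a'_def\<close>)
      then show ?thesis by (rule in_hull_cong) (simp add: a'_def)
    qed
    have "in_hull (M + cmod \<i> * M) F (\<lambda>\<xi>. of_real (Re (s \<xi>)) + \<i> * of_real (Im (s \<xi>)))"
    proof (intro in_hull_add in_hull_scale real_hull)
      show "\<bar>Re (s \<xi>)\<bar> \<le> 1" "\<bar>Im (s \<xi>)\<bar> \<le> 1" for \<xi>
        using s1[of \<xi>] abs_Re_le_cmod[of "s \<xi>"] abs_Im_le_cmod[of "s \<xi>"] by linarith+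
    qed
    then have "in_hull (2 * M) F s"
      by (simp flip: complex_eq)
    then obtain Y c where "finite Y" "(\<Sum>y\<in>Y. cmod (c y)) \<le> 2 * M"
      "\<And>\<xi>. \<xi> \<in> F \<Longrightarrow> cmod (s \<xi> - (\<Sum>y\<in>Y. c y * \<xi> y)) \<le> \<eta>"
      using \<eta> unfolding in_hull_def by meson
    then show ?thesis
      using s by (intro exI[of _ Y] exI[of _ c]) (force simp: F_def)
  qed
  then show ?thesis using M0 by (intro exI[of _ "2 * M"]) simp
qed

section \<open>Cotype and exhaustivity\<close>

lemma Lp_qnorm_sign_cube:
  assumes p: "p \<noteq> \<infinity>" "0 < enn2real p" and N: "\<And>x. 0 \<le> N x"
  shows "Lp_qnorm (sign_cube n) p N f = ennreal (lpn (cube n) (\<lambda>_. 1 / 2 ^ n) (enn2real p) (\<lambda>t. N (f t)))"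
proof -
  have "(\<integral>\<^sup>+ t. ennreal (N (f t) powr enn2real p) \<partial>sign_cube n)
      = (\<Sum>t\<in>cube n. ennreal (1 / 2 ^ n) * ennreal (N (f t) powr enn2real p))"
    unfolding sign_cube_def cube_def[symmetric] uniform_count_measure_def
    by (simp add: nn_integral_point_measure_finite finite_cube card_cube)
  also have "\<dots> = (\<Sum>t\<in>cube n. ennreal (1 / 2 ^ n * N (f t) powr enn2real p))"
    by (intro sum.cong refl ennreal_mult[symmetric]) auto
  also have "\<dots> = ennreal (\<Sum>t\<in>cube n. 1 / 2 ^ n * N (f t) powr enn2real p)"
    by (intro sum_ennreal) auto
  finally show ?thesis
    using p by (simp add: Lp_qnorm_def lpn_def sum_nonneg)
qed

lemma has_cotypeD:
  assumes "has_cotype q smul N" "0 < q" and N: "\<And>x. 0 \<le> N x"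
  shows "\<exists>C\<ge>0. \<forall>n x. (\<Sum>k<n. N (x k) powr q) powr (1 / q) \<le> C * rademacher_norm smul N q n x"
proof -
  obtain C where C: "\<And>n (x :: nat \<Rightarrow> 'a). ennreal ((\<Sum>k<n. N (x k) powr q) powr (1 / q))
          \<le> ennreal C * Lp_qnorm (sign_cube n) (ennreal q) N (\<lambda>t. \<Sum>k<n. smul (t k) (x k))"
    using assms(1) unfolding has_cotype_def by blast
  have "(\<Sum>k<n. N (x k) powr q) powr (1 / q) \<le> max C 0 * rademacher_norm smul N q n x" for n x
  proof -
    have "ennreal ((\<Sum>k<n. N (x k) powr q) powr (1 / q)) \<le> ennreal C * ennreal (rademacher_norm smul N q n x)"
      using C[where n = n and x = x] Lp_qnorm_sign_cube[of "ennreal q" N] assms(2) N by simp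
    also have "ennreal C = ennreal (max C 0)" by (simp add: max_def ennreal_neg)
    also have "\<dots> * ennreal (rademacher_norm smul N q n x) = ennreal (max C 0 * rademacher_norm smul N q n x)"
      by (intro ennreal_mult[symmetric] lpn_nonneg) simp
    finally show ?thesis by (subst (asm) ennreal_le_iff) (auto simp: lpn_nonneg)
  qed
  then show ?thesis by (intro exI[of _ "max C 0"]) auto
qed

lemma (in quasi_normed) lpn_quasi_seminorm:
  assumes p: "0 < p" and w: "\<And>v. v \<in> W \<Longrightarrow> 0 \<le> w v"
  shows "coefficient_quasi_seminorm n (K * 2 powr (1 + 1 / p))
    (\<lambda>a. lpn W w p (\<lambda>v. N (\<Sum>k<n. smul (a k) (x k v))))"
proof
  let ?\<psi> = "\<lambda>v a. N (\<Sum>k<n. smul (a k) (x k v))"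
  interpret v: coefficient_quasi_seminorm n K "?\<psi> v" for v
    by (rule linear_combination_quasi_seminorm)
  have "1 \<le> 2 powr (1 + 1 / p)" using p by (intro ge_one_powr_ge_zero) auto
  then show "1 \<le> K * 2 powr (1 + 1 / p)"
    using const_ge_1 mult_mono[of 1 K 1 "2 powr (1 + 1 / p)"] by simp
  show "0 \<le> lpn W w p (\<lambda>v. ?\<psi> v a)" for a by (rule lpn_nonneg)
  show "lpn W w p (\<lambda>v. ?\<psi> v (\<lambda>k. a k + b k))
      \<le> K * 2 powr (1 + 1 / p) * (lpn W w p (\<lambda>v. ?\<psi> v a) + lpn W w p (\<lambda>v. ?\<psi> v b))" for a b
  proof -
    have "lpn W w p (\<lambda>v. ?\<psi> v (\<lambda>k. a k + b k)) \<le> lpn W w p (\<lambda>v. K * (?\<psi> v a + ?\<psi> v b))"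
      using p w v.nonneg v.triangle by (intro lpn_mono) auto
    also have "\<dots> = K * lpn W w p (\<lambda>v. ?\<psi> v a + ?\<psi> v b)"
      using p w const_ge_1 N_nonneg by (intro lpn_scale) auto
    also have "\<dots> \<le> K * (2 powr (1 + 1 / p) * (lpn W w p (\<lambda>v. ?\<psi> v a) + lpn W w p (\<lambda>v. ?\<psi> v b)))"
      using p w const_ge_1 N_nonneg by (intro mult_left_mono lpn_add) auto
    finally show ?thesis by (simp only: mult.assoc)
  qed
  show "lpn W w p (\<lambda>v. ?\<psi> v (\<lambda>k. c * a k)) = cmod c * lpn W w p (\<lambda>v. ?\<psi> v a)" for c a
    unfolding v.scale using p w N_nonneg by (intro lpn_scale) auto
  show "lpn W w p (\<lambda>v. ?\<psi> v a) = lpn W w p (\<lambda>v. ?\<psi> v b)" if "\<And>k. k < n \<Longrightarrow> a k = b k" for a b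
  proof -
    have "?\<psi> v a = ?\<psi> v b" for v using that by (rule v.local)
    then show ?thesis by presburger
  qed
qed

text \<open>
  Let \<open>V\<close> be the \<open>\<ell>\<^sub>q\<close>-norm of the numbers \<open>u i\<close>.  For \<open>p \<le> q\<close> they are split at the level
  \<open>\<tau> = V m\<^sup>-\<^sup>1\<^sup>/\<^sup>q\<close>: those below it contribute at most \<open>m \<tau>\<^sup>p\<close>, those above it at most \<open>V\<^sup>q \<tau>\<^sup>p\<^sup>-\<^sup>q\<close>,
  and both bounds equal \<open>m\<^sup>1\<^sup>-\<^sup>p\<^sup>/\<^sup>q V\<^sup>p\<close>.
\<close>

lemma sum_powr_le:
  fixes u :: "nat \<Rightarrow> real"
  assumes p: "0 < p" and q: "0 < q" and m: "0 < m" and u: "\<And>i. i < m \<Longrightarrow> 0 \<le> u i"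
    and U: "(\<Sum>i<m. u i powr q) powr (1 / q) \<le> U"
  shows "(\<Sum>i<m. u i powr p) \<le> 2 * real m powr (1 - p / max p q) * U powr p"
proof -
  define V where "V = (\<Sum>i<m. u i powr q) powr (1 / q)"
  have s0: "0 \<le> (\<Sum>i<m. u i powr q)" by (intro sum_nonneg) auto
  have Vq: "V powr q = (\<Sum>i<m. u i powr q)"
    using q s0 by (simp add: V_def powr_powr)
  have V0: "0 \<le> V" by (simp add: V_def)
  have uV: "u i \<le> V" if i: "i < m" for i
  proof -
    have "u i powr q \<le> V powr q"
      unfolding Vq using i by (intro member_le_sum) auto
    then show ?thesis using q V0 u[OF i] by (metis powr_less_mono2 not_le)
  qed
  have "(\<Sum>i<m. u i powr p) \<le> 2 * real m powr (1 - p / max p q) * V powr p"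
  proof (cases "V = 0")
    case True
    then have "u i = 0" if "i < m" for i using uV[OF that] u[OF that] by simp
    then show ?thesis by simp
  next
    case False
    then have V: "0 < V" using V0 by simp
    show ?thesis
    proof (cases "p \<le> q")
      case True
      then have mx: "max p q = q" by simp
      define \<tau> where "\<tau> = V * real m powr (- 1 / q)"
      have \<tau>: "0 < \<tau>" using V m by (simp add: \<tau>_def)
      have "u i powr p \<le> \<tau> powr p + u i powr q * \<tau> powr (p - q)" if i: "i < m" for i
      proof (cases "u i \<le> \<tau>")
        case True
        then have "u i powr p \<le> \<tau> powr p" using u[OF i] p by (intro powr_mono2) auto
        then show ?thesis by (simp add: add_increasing2)
      next
        case False
        then have "u i powr (p - q) \<le> \<tau> powr (p - q)"
          using \<tau> \<open>p \<le> q\<close> by (intro powr_mono2') auto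
        then have "u i powr q * u i powr (p - q) \<le> u i powr q * \<tau> powr (p - q)"
          by (intro mult_left_mono) auto
        moreover have "u i powr q * u i powr (p - q) = u i powr p"
          by (simp flip: powr_add)
        moreover have "0 \<le> \<tau> powr p" by simp
        ultimately show ?thesis by linarith
      qed
      then have "(\<Sum>i<m. u i powr p) \<le> (\<Sum>i<m. \<tau> powr p + u i powr q * \<tau> powr (p - q))"
        by (intro sum_mono) auto
      also have "\<dots> = real m * \<tau> powr p + V powr q * \<tau> powr (p - q)"
        by (simp add: sum.distrib Vq sum_distrib_right)
      also have "real m * \<tau> powr p = real m powr (1 - p / q) * V powr p"
      proof -
        have "real m * \<tau> powr p = real m powr 1 * (real m powr (- p / q) * V powr p)"
          using V m by (simp add: \<tau>_def powr_mult powr_powr)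
        also have "\<dots> = real m powr (1 + - p / q) * V powr p"
          by (simp only: powr_add mult.assoc)
        finally show ?thesis by simp
      qed
      also have "V powr q * \<tau> powr (p - q) = real m powr (1 - p / q) * V powr p"
      proof -
        have "V powr q * \<tau> powr (p - q) = (V powr q * V powr (p - q)) * real m powr (- 1 / q * (p - q))"
          using V m by (simp add: \<tau>_def powr_mult powr_powr)
        also have "V powr q * V powr (p - q) = V powr p" by (simp flip: powr_add)
        also have "- 1 / q * (p - q) = 1 - p / q" using q by (simp add: field_simps)
        finally show ?thesis by simp
      qed
      finally show ?thesis unfolding mx by (simp add: mult_ac)
    next
      case False
      then have mx: "max p q = p" by simp
      have "(\<Sum>i<m. u i powr p) = (\<Sum>i<m. u i powr q * u i powr (p - q))"
        by (simp flip: powr_add)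
      also have "\<dots> \<le> (\<Sum>i<m. u i powr q * V powr (p - q))"
        using False uV u by (intro sum_mono mult_left_mono powr_mono2) auto
      also have "\<dots> = V powr q * V powr (p - q)" by (simp add: Vq sum_distrib_right)
      also have "\<dots> = V powr p" by (simp flip: powr_add)
      also have "\<dots> \<le> 2 * V powr p" by simp
      finally show ?thesis unfolding mx using p m by simp
    qed
  qed
  also have "\<dots> \<le> 2 * real m powr (1 - p / max p q) * U powr p"
    using U p V0 unfolding V_def[symmetric] by (intro mult_left_mono powr_mono2) auto
  finally show ?thesis .
qed

text \<open>
  Cotype \<open>q\<close> of \<open>X\<close> gives a lower estimate in \<open>\<ell>\<^sub>p(X)\<close>.  For \<open>p < q\<close> the \<open>q\<close>-th moment of the
  Rademacher sums has to be replaced by the \<open>p\<close>-th one before integrating, which is where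
  Kahane's inequality is used.
\<close>

theorem cotype_exhaustive:
  fixes smul :: "complex \<Rightarrow> 'a::ab_group_add \<Rightarrow> 'a" and p q :: real
  assumes X: "quasi_normed smul N K" and cotype: "has_cotype q smul N" and q: "0 < q" and p: "0 < p"
  shows "\<exists>C\<ge>0. \<exists>\<theta>>0. \<forall>n (W :: 'w set) w x. (\<forall>v\<in>W. 0 \<le> w v) \<longrightarrow>
    coefficient_quasi_seminorm.exhaustive (\<lambda>a. lpn W w p (\<lambda>v. N (\<Sum>k<n. smul (a k) (x k v)))) C \<theta>"
proof -
  interpret quasi_normed smul N K by fact
  obtain C0 where C0: "0 \<le> C0" "\<And>m x. (\<Sum>i<m. N (x i) powr q) powr (1 / q) \<le> C0 * rademacher_norm smul N q m x"
    using has_cotypeD[OF cotype q N_nonneg] by blast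
  obtain C1 where C1: "0 \<le> C1" "\<And>m x. rademacher_norm smul N q m x \<le> C1 * rademacher_norm smul N p m x"
    using khintchine_kahane[OF const_ge_1 p q, where 'a = 'a] X by blast
  define C where "C = C0 * C1"
  have C: "0 \<le> C" using C0 C1 by (simp add: C_def)
  have low: "(\<Sum>i<m. N (x i) powr q) powr (1 / q) \<le> C * rademacher_norm smul N p m x" for m x
    using order_trans[OF C0(2) mult_left_mono[OF C1(2) C0(1)]] by (simp add: C_def mult.assoc)
  define \<theta> where "\<theta> = 1 / max p q"
  have \<theta>: "0 < \<theta>" using p by (simp add: \<theta>_def)
  have "coefficient_quasi_seminorm.exhaustive (\<lambda>a. lpn W w p (\<lambda>v. N (\<Sum>k<n. smul (a k) (x k v)))) (2 powr (1 / p) * C) \<theta>"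
    if w: "\<forall>v\<in>W. 0 \<le> w v" for n and W :: "'w set" and w x
  proof -
    define \<Psi> where "\<Psi> a = lpn W w p (\<lambda>v. N (\<Sum>k<n. smul (a k) (x k v)))" for a
    interpret L: coefficient_quasi_seminorm n "K * 2 powr (1 + 1 / p)" \<Psi>
      unfolding \<Psi>_def using w p by (intro lpn_quasi_seminorm) auto
    define \<Phi> where "\<Phi> = L.disc_sup UNIV"
    have \<Phi>0: "0 \<le> \<Phi>" unfolding \<Phi>_def by (rule L.disc_sup_nonneg)
    have \<Psi>p: "\<Psi> a powr p = (\<Sum>v\<in>W. w v * N (\<Sum>k<n. smul (a k) (x k v)) powr p)" for a
      unfolding \<Psi>_def using w p by (intro lpn_powr) auto
    have "\<exists>i<m. L.disc_sup (A i) \<le> 2 powr (1 / p) * C * real m powr (-\<theta>) * \<Phi>"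
      if m: "0 < m" and disj: "disjoint_family_on A {..<m}" for m and A :: "nat \<Rightarrow> nat set"
    proof (rule ccontr)
      define c where "c = 2 powr (1 / p) * C * real m powr (-\<theta>) * \<Phi>"
      have c0: "0 \<le> c" using C \<Phi>0 by (simp add: c_def)
      assume "\<not> (\<exists>i<m. L.disc_sup (A i) \<le> 2 powr (1 / p) * C * real m powr (-\<theta>) * \<Phi>)"
      then have big: "\<not> L.disc_sup (A i) \<le> c" if "i < m" for i using that by (auto simp: c_def)
      have "\<exists>b. (\<forall>k. cmod (b k) \<le> 1) \<and> (\<forall>k. k \<notin> A i \<longrightarrow> b k = 0) \<and> c < \<Psi> b" if i: "i < m" for i
      proof (rule ccontr)
        assume "\<not> ?thesis"
        then have "L.disc_sup (A i) \<le> c" by (intro L.disc_sup_least) (meson not_le)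
        then show False using big[OF i] by blast
      qed
      then obtain b where b1: "\<And>i k. i < m \<Longrightarrow> cmod (b i k) \<le> 1"
        and b0: "\<And>i k. i < m \<Longrightarrow> k \<notin> A i \<Longrightarrow> b i k = 0" and bc: "\<And>i. i < m \<Longrightarrow> c < \<Psi> (b i)"
        by metis
      \<comment> \<open>disjointness of the supports keeps the signed sums \<open>\<beta> s\<close> of the \<open>b i\<close> in the polydisc\<close>
      define z where "z v i = (\<Sum>k<n. smul (b i k) (x k v))" for v i
      define \<beta> where "\<beta> s k = (\<Sum>i<m. s i * b i k)" for s :: "nat \<Rightarrow> complex" and k
      have zs: "(\<Sum>i<m. smul (s i) (z v i)) = (\<Sum>k<n. smul (\<beta> s k) (x k v))" for s v
      proof -
        have "(\<Sum>i<m. smul (s i) (z v i)) = (\<Sum>i<m. \<Sum>k<n. smul (s i * b i k) (x k v))"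
          by (simp add: z_def scale_sum_right)
        also have "\<dots> = (\<Sum>k<n. \<Sum>i<m. smul (s i * b i k) (x k v))" by (rule sum.swap)
        finally show ?thesis by (simp add: \<beta>_def scale_sum_left)
      qed
      have \<beta>1: "cmod (\<beta> s k) \<le> 1" if s: "s \<in> cube m" for s k
      proof (cases "\<exists>i<m. k \<in> A i")
        case True
        then obtain i where i: "i < m" "k \<in> A i" by blast
        have "k \<notin> A j" if "j < m" "j \<noteq> i" for j
          using disj i that unfolding disjoint_family_on_def by blast
        then have "\<beta> s k = (\<Sum>j\<in>{i}. s j * b j k)"
          unfolding \<beta>_def using i b0 by (intro sum.mono_neutral_right) auto
        then show ?thesis
          using cube_sign[OF s i(1)] b1[OF i(1), of k] by (auto simp: norm_mult)
      next
        case False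
        then have "\<beta> s k = 0" unfolding \<beta>_def using b0 by (intro sum.neutral) auto
        then show ?thesis by simp
      qed
      have \<Psi>\<beta>: "\<Psi> (\<beta> s) \<le> \<Phi>" if "s \<in> cube m" for s
        unfolding \<Phi>_def using \<beta>1[OF that] by (intro L.disc_sup_upper) auto
      define E where "E v = rademacher_norm smul N p m (z v)" for v
      have E: "E v powr p = (\<Sum>s\<in>cube m. 1 / 2 ^ m * N (\<Sum>k<n. smul (\<beta> s k) (x k v)) powr p)" for v
        unfolding E_def zs using p by (intro lpn_powr) auto
      have "real m * c powr p = (\<Sum>i<m. c powr p)" by simp
      also have "\<dots> < (\<Sum>i<m. \<Psi> (b i) powr p)"
        using m c0 p bc by (intro sum_strict_mono powr_less_mono2) auto
      also have "\<dots> = (\<Sum>v\<in>W. w v * (\<Sum>i<m. N (z v i) powr p))"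
        unfolding \<Psi>p z_def by (subst sum.swap) (simp add: sum_distrib_left)
      also have "\<dots> \<le> (\<Sum>v\<in>W. w v * (2 * real m powr (1 - p / max p q) * (C * E v) powr p))"
        using w p q m low unfolding E_def
        by (intro sum_mono mult_left_mono sum_powr_le) (auto simp: N_nonneg)
      also have "\<dots> = (\<Sum>v\<in>W. (2 * real m powr (1 - p / max p q) * C powr p) * (w v * E v powr p))"
        using C by (intro sum.cong refl) (simp add: powr_mult E_def lpn_nonneg)
      also have "\<dots> = (2 * real m powr (1 - p / max p q) * C powr p) * (\<Sum>v\<in>W. w v * E v powr p)"
        by (simp only: sum_distrib_left)
      also have "(\<Sum>v\<in>W. w v * E v powr p) = (\<Sum>s\<in>cube m. 1 / 2 ^ m * \<Psi> (\<beta> s) powr p)"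
        unfolding E \<Psi>p sum_distrib_left by (subst sum.swap) (simp add: mult_ac)
      also have "(2 * real m powr (1 - p / max p q) * C powr p) * \<dots>
          \<le> (2 * real m powr (1 - p / max p q) * C powr p) * (\<Sum>s\<in>cube m. 1 / 2 ^ m * \<Phi> powr p)"
        using \<Psi>\<beta> p L.nonneg by (intro mult_left_mono sum_mono powr_mono2) auto
      also have "(\<Sum>s\<in>cube m. 1 / 2 ^ m * \<Phi> powr p) = \<Phi> powr p"
        by (simp add: card_cube)
      also have "(2 * real m powr (1 - p / max p q) * C powr p) * \<Phi> powr p = real m * c powr p"
      proof -
        have "c powr p = 2 * C powr p * real m powr (-\<theta> * p) * \<Phi> powr p"
          using C \<Phi>0 p by (simp add: c_def powr_mult powr_powr)
        then have "real m * c powr p = 2 * C powr p * (real m powr 1 * real m powr (-\<theta> * p)) * \<Phi> powr p"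
          using m by simp
        also have "real m powr 1 * real m powr (-\<theta> * p) = real m powr (1 - p / max p q)"
          unfolding powr_add[symmetric] \<theta>_def by simp
        finally show ?thesis by (simp only: mult_ac)
      qed
      finally show False by simp
    qed
    then have "L.exhaustive (2 powr (1 / p) * C) \<theta>"
      unfolding L.exhaustive_def \<Phi>_def by blast
    then show ?thesis unfolding \<Psi>_def[abs_def] .
  qed
  then show ?thesis
    using C \<theta> by (intro exI[of _ "2 powr (1 / p) * C"] conjI exI[of _ \<theta>]) auto
qed

section \<open>Domination by translates on a Sidon set\<close>

text \<open>
  Vector-valued coefficients \<open>y k\<close> are functions on a finite weighted set \<open>W\<close>; the bound is
  uniform in \<open>W\<close>.  One atom gives the supremum norm over the group, and a discretization of the
  group itself gives its \<open>L\<^sub>p\<close>-quasi-norm.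
\<close>

definition sidon_dominated ::
    "('g \<Rightarrow> complex) set \<Rightarrow> real \<Rightarrow> (complex \<Rightarrow> 'a::ab_group_add \<Rightarrow> 'a) \<Rightarrow> ('a \<Rightarrow> real) \<Rightarrow> bool" where
  "sidon_dominated E p smul N \<longleftrightarrow> (\<exists>D\<ge>0. \<forall>n \<gamma> (W :: 'g set) w y S a.
     inj_on \<gamma> {..<n::nat} \<and> \<gamma> ` {..<n} \<subseteq> E \<and> (\<forall>v\<in>W. 0 \<le> w v) \<and> 0 \<le> S \<and>
     (\<forall>g. lpn W w p (\<lambda>v. N (\<Sum>k<n. smul (\<gamma> k g) (y k v))) \<le> S) \<and> (\<forall>k<n. cmod (a k) \<le> 1) \<longrightarrow>
     lpn W w p (\<lambda>v. N (\<Sum>k<n. smul (a k) (y k v))) \<le> D * S)"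

lemma sidon_dominatedI:
  fixes E :: "('g \<Rightarrow> complex) set"
  assumes "0 \<le> D" and "\<And>n \<gamma> (W :: 'g set) w y S a. inj_on \<gamma> {..<n::nat} \<Longrightarrow> \<gamma> ` {..<n} \<subseteq> E \<Longrightarrow>
      (\<forall>v\<in>W. 0 \<le> w v) \<Longrightarrow> 0 \<le> S \<Longrightarrow> (\<forall>g. lpn W w p (\<lambda>v. N (\<Sum>k<n. smul (\<gamma> k g) (y k v))) \<le> S) \<Longrightarrow>
      (\<forall>k<n. cmod (a k) \<le> 1) \<Longrightarrow> lpn W w p (\<lambda>v. N (\<Sum>k<n. smul (a k) (y k v))) \<le> D * S"
  shows "sidon_dominated E p smul N"
  unfolding sidon_dominated_def
proof (rule exI[of _ D], intro conjI allI impI)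
  show "0 \<le> D" by fact
qed (elim conjE, rule assms(2))

lemma sidon_dominatedE:
  fixes E :: "('g \<Rightarrow> complex) set"
  assumes "sidon_dominated E p smul N"
  obtains D where "0 \<le> D" and "\<And>n \<gamma> (W :: 'g set) w y S a. inj_on \<gamma> {..<n::nat} \<Longrightarrow> \<gamma> ` {..<n} \<subseteq> E \<Longrightarrow>
      (\<forall>v\<in>W. 0 \<le> w v) \<Longrightarrow> 0 \<le> S \<Longrightarrow> (\<forall>g. lpn W w p (\<lambda>v. N (\<Sum>k<n. smul (\<gamma> k g) (y k v))) \<le> S) \<Longrightarrow>
      (\<forall>k<n. cmod (a k) \<le> 1) \<Longrightarrow> lpn W w p (\<lambda>v. N (\<Sum>k<n. smul (a k) (y k v))) \<le> D * S"
proof -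
  obtain D where D: "0 \<le> D" and all: "\<forall>n \<gamma> (W :: 'g set) w y S a.
     inj_on \<gamma> {..<n::nat} \<and> \<gamma> ` {..<n} \<subseteq> E \<and> (\<forall>v\<in>W. 0 \<le> w v) \<and> 0 \<le> S \<and>
     (\<forall>g. lpn W w p (\<lambda>v. N (\<Sum>k<n. smul (\<gamma> k g) (y k v))) \<le> S) \<and> (\<forall>k<n. cmod (a k) \<le> 1) \<longrightarrow>
     lpn W w p (\<lambda>v. N (\<Sum>k<n. smul (a k) (y k v))) \<le> D * S"
    using assms unfolding sidon_dominated_def by (elim exE conjE) (rule that)
  show thesis
    by (rule that[OF D], rule all[THEN spec, THEN spec, THEN spec, THEN spec, THEN spec, THEN spec, THEN spec, THEN mp])
      (intro conjI)
qed

theorem cotype_sidon_dominated: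
  fixes \<mu> :: "'g::{topological_ab_group_add, t2_space} measure" and E :: "('g \<Rightarrow> complex) set"
  assumes \<mu>: "normalized_haar \<mu>" and E: "sidon_set E" and X: "quasi_normed smul N K"
    and cotype: "has_cotype q smul N" and q: "0 < q" and p: "0 < p"
  shows "sidon_dominated E p smul N"
proof -
  interpret quasi_normed smul N K by fact
  let ?L = "\<lambda>n (W :: 'g set) w x a. lpn W w p (\<lambda>v. N (\<Sum>k<n. smul (a k) (x k v)))"
  obtain M where M: "0 < M" and hull: "\<forall>(n::nat) \<gamma> t \<eta>. inj_on \<gamma> {..<n} \<and> \<gamma> ` {..<n} \<subseteq> E \<and>
      (\<forall>k<n. cmod (t k) \<le> 1) \<and> 0 < \<eta> \<longrightarrow>
    (\<exists>Y c. finite Y \<and> (\<Sum>y\<in>Y. cmod (c y)) \<le> M \<and> (\<forall>k<n. cmod (t k - (\<Sum>y\<in>Y. c y * \<gamma> k y)) \<le> \<eta>))"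
    using sidon_polydisc_hull[OF \<mu> E] by (elim exE conjE) (rule that)
  obtain C \<theta> where C: "0 \<le> C" and \<theta>: "0 < \<theta>" and ex: "\<forall>n (W :: 'g set) w x. (\<forall>v\<in>W. 0 \<le> w v) \<longrightarrow>
      coefficient_quasi_seminorm.exhaustive (?L n W w x) C \<theta>"
    using cotype_exhaustive[OF X cotype q p, where 'w = 'g] by (elim exE conjE) (rule that)
  have "coefficient_quasi_seminorm 0 (K * 2 powr (1 + 1 / p)) (?L 0 {} (\<lambda>_. 0) (\<lambda>_ _. 0))"
    using p by (intro lpn_quasi_seminorm) auto
  then have K': "1 \<le> K * 2 powr (1 + 1 / p)" by (rule coefficient_quasi_seminorm.K_ge_1)
  obtain D where D: "0 \<le> D" and bound: "\<forall>n \<Psi> (z :: 'g \<Rightarrow> nat \<Rightarrow> complex) S a.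
    coefficient_quasi_seminorm n (K * 2 powr (1 + 1 / p)) \<Psi> \<and> coefficient_quasi_seminorm.exhaustive \<Psi> C \<theta> \<and>
    (\<forall>y. \<forall>k<n. cmod (z y k) \<le> 1) \<and> 0 \<le> S \<and> (\<forall>y. \<Psi> (z y) \<le> S) \<and>
    (\<forall>t \<eta>. (\<forall>k<n. cmod (t k) \<le> 1) \<and> 0 < \<eta> \<longrightarrow> (\<exists>Y c. finite Y \<and> (\<Sum>y\<in>Y. cmod (c y)) \<le> M \<and>
        (\<forall>k<n. cmod (t k - (\<Sum>y\<in>Y. c y * z y k)) \<le> \<eta>))) \<and>
    (\<forall>k<n. cmod (a k) \<le> 1) \<longrightarrow> \<Psi> a \<le> D * S"
    using polydisc_bound_from_hull[OF K' C \<theta> M, where 'b = 'g] by (elim exE conjE) (rule that)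
  have "?L n W w y a \<le> D * S"
    if \<gamma>: "inj_on \<gamma> {..<n}" "\<gamma> ` {..<n} \<subseteq> E" and w: "\<forall>v\<in>W. 0 \<le> w v" and S: "0 \<le> S"
      and le: "\<forall>g. ?L n W w y (\<lambda>k. \<gamma> k g) \<le> S" and a: "\<forall>k<n. cmod (a k) \<le> 1"
    for n :: nat and \<gamma> W w y S a
  proof (rule bound[THEN spec, of n, THEN spec, of "?L n W w y", THEN spec, of "\<lambda>g k. \<gamma> k g",
        THEN spec, of S, THEN spec, of a, THEN mp], intro conjI)
    show "coefficient_quasi_seminorm n (K * 2 powr (1 + 1 / p)) (?L n W w y)"
      using p w by (intro lpn_quasi_seminorm) auto
    show "coefficient_quasi_seminorm.exhaustive (?L n W w y) C \<theta>"
      by (rule ex[THEN spec, THEN spec, THEN spec, THEN spec, THEN mp, OF w])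
    show "\<forall>g. \<forall>k<n. cmod (\<gamma> k g) \<le> 1"
    proof (intro allI impI)
      fix g k assume "k < n"
      then have "\<gamma> k \<in> dual_group" using \<gamma>(2) E by (auto simp: sidon_set_def)
      from dual_group_norm[OF this, of g] show "cmod (\<gamma> k g) \<le> 1" by simp
    qed
    show "\<forall>t \<eta>. (\<forall>k<n. cmod (t k) \<le> 1) \<and> 0 < \<eta> \<longrightarrow> (\<exists>Y c. finite Y \<and> (\<Sum>y\<in>Y. cmod (c y)) \<le> M \<and>
        (\<forall>k<n. cmod (t k - (\<Sum>y\<in>Y. c y * \<gamma> k y)) \<le> \<eta>))"
    proof (intro allI impI)
      fix t and \<eta> :: real assume "(\<forall>k<n. cmod (t k) \<le> 1) \<and> 0 < \<eta>"
      then have "inj_on \<gamma> {..<n} \<and> \<gamma> ` {..<n} \<subseteq> E \<and> (\<forall>k<n. cmod (t k) \<le> 1) \<and> 0 < \<eta>"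
        by (elim conjE) (intro conjI \<gamma>)
      then show "\<exists>Y c. finite Y \<and> (\<Sum>y\<in>Y. cmod (c y)) \<le> M \<and>
        (\<forall>k<n. cmod (t k - (\<Sum>y\<in>Y. c y * \<gamma> k y)) \<le> \<eta>)"
        by (rule hull[THEN spec, THEN spec, THEN spec, THEN spec, THEN mp])
    qed
  qed (fact S, fact le, fact a)
  then show ?thesis by (rule sidon_dominatedI[OF D])
qed

text \<open>
  Each atom of \<open>W\<close> chooses one operator that almost norms the vector \<open>\<Sum>k<n. a k y k v\<close>.
  Here it matters that the domination in \<open>X\<close> holds for functions on \<open>W\<close>, not only for vectors.
\<close>

theorem sidon_dominated_norming:
  fixes E :: "('g \<Rightarrow> complex) set" and T :: "'i \<Rightarrow> 'y::ab_group_add \<Rightarrow> 'x::ab_group_add"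
  assumes dom: "sidon_dominated E p sX NX" and p: "0 < p"
    and N0: "\<And>x. 0 \<le> NX x" "\<And>y. 0 \<le> NY y"
    and T_add: "\<And>i u v. T i (u + v) = T i u + T i v"
    and T_scale: "\<And>i c u. T i (sY c u) = sX c (T i u)"
    and c: "0 \<le> c" and T_bound: "\<And>i u. NX (T i u) \<le> c * NY u"
    and norming: "\<And>u. \<exists>i. NY u \<le> c * NX (T i u)"
  shows "sidon_dominated E p sY NY"
proof -
  obtain D where D: "0 \<le> D" and bound: "\<And>n \<gamma> (W :: 'g set) w x S a.
     inj_on \<gamma> {..<n::nat} \<Longrightarrow> \<gamma> ` {..<n} \<subseteq> E \<Longrightarrow> (\<forall>v\<in>W. 0 \<le> w v) \<Longrightarrow> 0 \<le> S \<Longrightarrow>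
     (\<forall>g. lpn W w p (\<lambda>v. NX (\<Sum>k<n. sX (\<gamma> k g) (x k v))) \<le> S) \<Longrightarrow> (\<forall>k<n. cmod (a k) \<le> 1) \<Longrightarrow>
     lpn W w p (\<lambda>v. NX (\<Sum>k<n. sX (a k) (x k v))) \<le> D * S"
    by (rule sidon_dominatedE[OF dom]) (rule that)
  have T_zero: "T i 0 = 0" for i
    using T_add[of i 0 0] by (metis add.right_neutral add_left_cancel)
  have T_sum: "T i (\<Sum>k<n. sY (a k) (y k)) = (\<Sum>k<n. sX (a k) (T i (y k)))" for i n a and y :: "nat \<Rightarrow> 'y"
    by (induction n) (simp_all add: T_zero T_add T_scale)
  have "lpn W w p (\<lambda>v. NY (\<Sum>k<n. sY (a k) (y k v))) \<le> c * D * c * S"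
    if \<gamma>: "inj_on \<gamma> {..<n}" "\<gamma> ` {..<n} \<subseteq> E" and w: "\<forall>v\<in>W. 0 \<le> w v" and S: "0 \<le> S"
      and le: "\<forall>g. lpn W w p (\<lambda>v. NY (\<Sum>k<n. sY (\<gamma> k g) (y k v))) \<le> S" and a: "\<forall>k<n. cmod (a k) \<le> 1"
    for n :: nat and \<gamma> and W :: "'g set" and w y S a
  proof -
    have "\<forall>v. \<exists>i. NY (\<Sum>k<n. sY (a k) (y k v)) \<le> c * NX (T i (\<Sum>k<n. sY (a k) (y k v)))"
      by (intro allI norming)
    from choice[OF this] obtain i
      where i: "\<And>v. NY (\<Sum>k<n. sY (a k) (y k v)) \<le> c * NX (T (i v) (\<Sum>k<n. sY (a k) (y k v)))"
      by (elim exE) (rule that, erule spec)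
    define x where "x k v = T (i v) (y k v)" for k v
    have "lpn W w p (\<lambda>v. NX (\<Sum>k<n. sX (\<gamma> k g) (x k v))) \<le> c * S" for g
    proof -
      have "lpn W w p (\<lambda>v. NX (\<Sum>k<n. sX (\<gamma> k g) (x k v)))
          \<le> lpn W w p (\<lambda>v. c * NY (\<Sum>k<n. sY (\<gamma> k g) (y k v)))"
        unfolding x_def T_sum[symmetric] using w p N0 T_bound by (intro lpn_mono) auto
      also have "\<dots> = c * lpn W w p (\<lambda>v. NY (\<Sum>k<n. sY (\<gamma> k g) (y k v)))"
        using w p N0 c by (intro lpn_scale) auto
      also have "\<dots> \<le> c * S" using le c by (intro mult_left_mono) auto
      finally show ?thesis .
    qed
    then have X: "lpn W w p (\<lambda>v. NX (\<Sum>k<n. sX (a k) (x k v))) \<le> D * (c * S)"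
      using w S c a by (intro bound[OF \<gamma>]) auto
    have "lpn W w p (\<lambda>v. NY (\<Sum>k<n. sY (a k) (y k v)))
        \<le> lpn W w p (\<lambda>v. c * NX (\<Sum>k<n. sX (a k) (x k v)))"
      unfolding x_def T_sum[symmetric] using w p N0 i by (intro lpn_mono) auto
    also have "\<dots> = c * lpn W w p (\<lambda>v. NX (\<Sum>k<n. sX (a k) (x k v)))"
      using w p N0 c by (intro lpn_scale) auto
    also have "\<dots> \<le> c * (D * (c * S))" using X c by (intro mult_left_mono) auto
    finally show ?thesis by (simp only: mult.assoc)
  qed
  moreover have "0 \<le> c * D * c" using c D by simp
  ultimately show ?thesis
    by (intro sidon_dominatedI)
qed

section \<open>From domination to equivalence of norms\<close>

lemma le_of_le_add_multiple:
  fixes a b c :: real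
  assumes "0 \<le> c" "\<And>e. 0 < e \<Longrightarrow> a \<le> c * (b + e)"
  shows "a \<le> c * b"
proof (rule field_le_epsilon)
  fix e :: real assume e: "0 < e"
  have "a \<le> c * (b + e / (c + 1))"
    using assms(1) e by (intro assms(2)) (simp add: add_nonneg_pos)
  also have "\<dots> = c * b + c / (c + 1) * e"
    by (simp add: distrib_left)
  also have "c / (c + 1) * e \<le> 1 * e"
    using assms(1) e by (intro mult_right_mono) auto
  finally show "a \<le> c * b + e" by simp
qed

text \<open>
  Multiplying the coefficients by fixed signs permutes the cube, so all sign vectors have the same
  Rademacher average and the contraction principle for quasi-seminorms applies.
\<close>

lemma (in quasi_normed) rademacher_contraction:
  assumes p: "0 < p"
  shows "\<exists>C\<ge>0. \<forall>n x a. (\<forall>k<n. cmod (a k) \<le> 1) \<longrightarrow>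
    rademacher_norm smul N p n (\<lambda>k. smul (a k) (x k)) \<le> C * rademacher_norm smul N p n x"
proof -
  let ?K = "K * 2 powr (1 + 1 / p)"
  let ?\<Psi> = "\<lambda>n x a. lpn (cube n) (\<lambda>_. 1 / 2 ^ n) p (\<lambda>t. N (\<Sum>k<n. smul (a k) (smul (t k) (x k))))"
  have qs: "coefficient_quasi_seminorm n ?K (?\<Psi> n x)" for n x
    using p by (intro lpn_quasi_seminorm) auto
  have K': "1 \<le> ?K" by (rule coefficient_quasi_seminorm.K_ge_1[OF qs])
  obtain C where C: "0 \<le> C" and contraction: "\<forall>n \<Psi> R a. coefficient_quasi_seminorm n ?K \<Psi> \<and>
           (\<forall>\<theta>. (\<forall>k. \<theta> k \<in> {-1, 1}) \<longrightarrow> \<Psi> \<theta> \<le> R) \<and> (\<forall>k<n. cmod (a k) \<le> 1) \<longrightarrow> \<Psi> a \<le> C * R"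
    using contraction_principle[OF K'] by (elim exE conjE) (rule that)
  have eq: "rademacher_norm smul N p n (\<lambda>k. smul (a k) (x k)) = ?\<Psi> n x a" for n a x
    by (simp add: mult.commute)
  have sign_invariant: "?\<Psi> n x \<theta> = rademacher_norm smul N p n x" if \<theta>: "\<forall>k. \<theta> k \<in> {-1, 1}" for n x and \<theta> :: "nat \<Rightarrow> complex"
  proof -
    have \<theta>': "\<theta> k \<in> {-1, 1}" for k using \<theta> by (rule spec)
    have "(\<Sum>t\<in>cube n. 1 / 2 ^ n * N (\<Sum>k<n. smul (t k) (x k)) powr p)
        = (\<Sum>t\<in>cube n. 1 / 2 ^ n * N (\<Sum>k<n. smul (sign_mult n \<theta> t k) (x k)) powr p)"
      by (rule sum.reindex_bij_betw[OF sign_mult_bij[OF \<theta>'], symmetric])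
    also have "\<dots> = (\<Sum>t\<in>cube n. 1 / 2 ^ n * N (\<Sum>k<n. smul (\<theta> k) (smul (t k) (x k))) powr p)"
      by (simp add: sign_mult_def)
    finally show ?thesis by (simp only: lpn_def)
  qed
  have "rademacher_norm smul N p n (\<lambda>k. smul (a k) (x k)) \<le> C * rademacher_norm smul N p n x"
    if a: "\<forall>k<n. cmod (a k) \<le> 1" for n x a
    unfolding eq
  proof (rule contraction[THEN spec, of n, THEN spec, of "?\<Psi> n x", THEN spec, THEN spec, of _ a, THEN mp],
      intro conjI allI impI)
    fix \<theta> :: "nat \<Rightarrow> complex" assume "\<forall>k. \<theta> k \<in> {-1, 1}"
    from sign_invariant[OF this] show "?\<Psi> n x \<theta> \<le> rademacher_norm smul N p n x"
      by (rule eq_refl)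
  next
    fix k assume "k < n"
    then show "cmod (a k) \<le> 1" using a by simp
  qed (rule qs)
  then show ?thesis using C by (intro exI[of _ C]) simp
qed

text \<open>
  A rounding of the group to finitely many points that is fine enough to change no trigonometric
  polynomial with coefficients \<open>a k y k\<close>, \<open>\<bar>a k\<bar> \<le> 1\<close>, by more than \<open>e\<close>.
\<close>

lemma (in coefficient_quasi_seminorm) rounding:
  fixes \<gamma> :: "nat \<Rightarrow> 'g::topological_ab_group_add \<Rightarrow> complex"
  assumes \<gamma>: "\<And>k. k < n \<Longrightarrow> \<gamma> k \<in> dual_group" and e: "0 < e"
  obtains r :: "'g \<Rightarrow> 'g" where "finite (range r)" "\<And>y. r -` {y} \<in> sets borel"
    "\<And>x a. \<forall>k<n. cmod (a k) \<le> 1 \<Longrightarrow> \<Psi> (\<lambda>k. a k * (\<gamma> k x - \<gamma> k (r x))) \<le> e"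
proof -
  define \<Phi> where "\<Phi> = disc_sup UNIV"
  have \<Phi>: "0 \<le> \<Phi>" unfolding \<Phi>_def by (rule disc_sup_nonneg)
  define \<eta> where "\<eta> = e / (\<Phi> + 1)"
  have \<eta>: "0 < \<eta>" using \<Phi> e by (simp add: \<eta>_def add_nonneg_pos)
  obtain r :: "'g \<Rightarrow> 'g" where r: "finite (range r)" "\<And>y. r -` {y} \<in> sets borel"
    and close: "\<And>x k. k \<in> {..<n} \<Longrightarrow> cmod (\<gamma> k x - \<gamma> k (r x)) \<le> \<eta>"
    by (rule finite_range_rounding[where I = "{..<n}" and h = \<gamma>, OF _ _ _ \<eta>])
      (use \<gamma> dual_group_borel dual_group_norm[OF \<gamma>] that in auto)
  show thesis
  proof (rule that[OF r])
    fix x and a :: "nat \<Rightarrow> complex" assume a: "\<forall>k<n. cmod (a k) \<le> 1"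
    define b where "b k = (if k < n then a k * (\<gamma> k x - \<gamma> k (r x)) else 0)" for k
    have "cmod (b k) \<le> \<eta>" for k
    proof (cases "k < n")
      case True
      then have "cmod (b k) = cmod (a k) * cmod (\<gamma> k x - \<gamma> k (r x))"
        by (simp add: b_def norm_mult)
      also have "\<dots> \<le> 1 * \<eta>"
        using a[rule_format, OF True] close[of k x] True by (intro mult_mono) auto
      finally show ?thesis by simp
    qed (use \<eta> in \<open>simp add: b_def\<close>)
    then have "\<Psi> b \<le> \<eta> * \<Phi>"
      unfolding \<Phi>_def using \<eta> by (intro scaled_le_disc_sup) auto
    also have "\<dots> \<le> e" using \<Phi> e by (simp add: \<eta>_def divide_le_eq add_nonneg_pos)
    also have "\<Psi> b = \<Psi> (\<lambda>k. a k * (\<gamma> k x - \<gamma> k (r x)))"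
      by (rule local) (simp add: b_def)
    finally show "\<Psi> (\<lambda>k. a k * (\<gamma> k x - \<gamma> k (r x))) \<le> e" .
  qed
qed

lemma lpn_add_const:
  assumes "0 < p" "0 \<le> K" "\<And>v. v \<in> W \<Longrightarrow> 0 \<le> w v" "(\<Sum>v\<in>W. w v) \<le> 1" "\<And>v. v \<in> W \<Longrightarrow> 0 \<le> H v" "0 \<le> e"
  shows "lpn W w p (\<lambda>v. K * (H v + e)) \<le> K * 2 powr (1 + 1 / p) * (lpn W w p H + e)"
proof -
  have "lpn W w p (\<lambda>v. K * (H v + e)) = K * lpn W w p (\<lambda>v. H v + e)"
    using assms by (intro lpn_scale) auto
  also have "\<dots> \<le> K * (2 powr (1 + 1 / p) * (lpn W w p H + lpn W w p (\<lambda>_. e)))"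
    using assms by (intro mult_left_mono lpn_add) auto
  also have "\<dots> \<le> K * (2 powr (1 + 1 / p) * (lpn W w p H + e))"
    using assms by (intro mult_left_mono add_left_mono lpn_le_const) auto
  finally show ?thesis by (simp only: mult.assoc)
qed

lemma haar_sum_fibres:
  fixes \<mu> :: "'g::{topological_ab_group_add, t2_space} measure" and r :: "'g \<Rightarrow> 'g"
  assumes \<mu>: "normalized_haar \<mu>" and r: "finite (range r)" "\<And>y. r -` {y} \<in> sets borel"
  shows "(\<Sum>v\<in>range r. measure \<mu> (r -` {v})) = 1"
proof -
  note haar = normalized_haar_finite[OF \<mu>]
  have "(\<Sum>v\<in>range r. measure \<mu> (r -` {v})) = (LINT x|\<mu>. (1::real))"
    using integral_finite_range(2)[OF haar(1,2) r, of "\<lambda>_. 1 :: real"] by simp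
  then show ?thesis by (simp add: haar)
qed

lemma lpn_eq_nn_integral:
  fixes \<mu> :: "'g::{topological_ab_group_add, t2_space} measure" and r :: "'g \<Rightarrow> 'g"
  assumes \<mu>: "normalized_haar \<mu>" and r: "finite (range r)" "\<And>y. r -` {y} \<in> sets borel" and p: "0 < p"
  shows "(\<integral>\<^sup>+ x. ennreal (F (r x) powr p) \<partial>\<mu>) = ennreal (lpn (range r) (\<lambda>v. measure \<mu> (r -` {v})) p F powr p)"
proof -
  note haar = normalized_haar_finite[OF \<mu>]
  have "(\<integral>\<^sup>+ x. ennreal (F (r x) powr p) \<partial>\<mu>) = ennreal (LINT x|\<mu>. F (r x) powr p)"
    by (rule nn_integral_eq_integral[OF integral_finite_range(1)[OF haar(1,2) r]]) simp
  also have "(LINT x|\<mu>. F (r x) powr p) = (\<Sum>v\<in>range r. measure \<mu> (r -` {v}) * F v powr p)"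
    using integral_finite_range(2)[OF haar(1,2) r, of "\<lambda>v. F v powr p"] by simp
  also have "\<dots> = lpn (range r) (\<lambda>v. measure \<mu> (r -` {v})) p F powr p"
    by (rule lpn_powr[OF p, symmetric]) simp
  finally show ?thesis .
qed

text \<open>
  This is how the invariance of Haar measure enters on the discretized group.  Rounding does not
  commute with translation, so the two sides are compared before integrating.
\<close>

lemma lpn_translate_mono:
  fixes \<mu> :: "'g::{topological_ab_group_add, t2_space} measure" and r :: "'g \<Rightarrow> 'g"
  assumes \<mu>: "normalized_haar \<mu>" and r: "finite (range r)" "\<And>y. r -` {y} \<in> sets borel" and p: "0 < p"
    and H: "\<And>v. 0 \<le> H v" and le: "\<And>x. H (r x) \<le> F (r (g + x))"
  shows "lpn (range r) (\<lambda>v. measure \<mu> (r -` {v})) p H \<le> lpn (range r) (\<lambda>v. measure \<mu> (r -` {v})) p F"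
proof -
  let ?l = "lpn (range r) (\<lambda>v. measure \<mu> (r -` {v})) p"
  note haar = normalized_haar_finite[OF \<mu>]
  have "(\<lambda>x. g + x) \<in> borel_measurable borel"
    by (intro borel_measurable_continuous_onI continuous_intros)
  then have shift: "(\<lambda>x. g + x) \<in> measurable \<mu> borel"
    by (simp add: measurable_cong_sets[OF haar(2) refl])
  have "(\<lambda>x. F (r x) powr p) \<in> borel_measurable \<mu>"
    by (rule borel_measurable_integrable[OF integral_finite_range(1)[OF haar(1,2) r]])
  then have meas: "(\<lambda>x. ennreal (F (r x) powr p)) \<in> borel_measurable borel"
    by (simp add: measurable_cong_sets[OF haar(2) refl])
  have "ennreal (?l H powr p) = (\<integral>\<^sup>+ x. ennreal (H (r x) powr p) \<partial>\<mu>)"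
    by (rule lpn_eq_nn_integral[OF \<mu> r p, symmetric])
  also have "\<dots> \<le> (\<integral>\<^sup>+ x. ennreal (F (r (g + x)) powr p) \<partial>\<mu>)"
    using p H le by (intro nn_integral_mono ennreal_leI powr_mono2) auto
  also have "\<dots> = (\<integral>\<^sup>+ x. ennreal (F (r x) powr p) \<partial>distr \<mu> borel (\<lambda>x. g + x))"
    by (rule nn_integral_distr[OF shift, symmetric]) (use meas in simp)
  also have "distr \<mu> borel (\<lambda>x. g + x) = \<mu>" using \<mu> by (simp add: normalized_haar_def)
  also have "(\<integral>\<^sup>+ x. ennreal (F (r x) powr p) \<partial>\<mu>) = ennreal (?l F powr p)"
    by (rule lpn_eq_nn_integral[OF \<mu> r p])
  finally have "?l H powr p \<le> ?l F powr p"
    by (subst (asm) ennreal_le_iff) auto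
  then have "(?l H powr p) powr (1 / p) \<le> (?l F powr p) powr (1 / p)"
    using p by (intro powr_mono2[of "1 / p"]) auto
  moreover have "(z powr p) powr (1 / p) = z" if "0 \<le> z" for z
    using p that by (simp add: powr_powr)
  ultimately show ?thesis by (simp only: lpn_nonneg)
qed

text \<open>
  The lower integral of a function that is within quasi-triangle distance \<open>e\<close> of a simple
  function \<open>F \<circ> r\<close> is comparable with the power mean of \<open>F\<close>.  The second bound uses a simple
  minorant, because lower integrals of nonmeasurable functions are not subadditive.
\<close>

lemma Lp_qnorm_rounding:
  fixes \<mu> :: "'g::{topological_ab_group_add, t2_space} measure" and r :: "'g \<Rightarrow> 'g"
  assumes \<mu>: "normalized_haar \<mu>" and r: "finite (range r)" "\<And>y. r -` {y} \<in> sets borel"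
    and p: "p \<noteq> \<infinity>" "0 < enn2real p" and K: "1 \<le> K" and e: "0 \<le> e"
    and f: "\<And>x. 0 \<le> N (f x)" and F: "\<And>v. 0 \<le> F v"
    and fF: "\<And>x. N (f x) \<le> K * (F (r x) + e)" and Ff: "\<And>x. F (r x) \<le> K * (N (f x) + e)"
  defines "Q \<equiv> lpn (range r) (\<lambda>v. measure \<mu> (r -` {v})) (enn2real p) F"
    and "c \<equiv> K * 2 powr (1 + 1 / enn2real p)"
  shows "\<exists>j\<ge>0. Lp_qnorm \<mu> p N f = ennreal j \<and> j \<le> c * (Q + e) \<and> Q \<le> c * (j + e)"
proof -
  define s where "s = enn2real p"
  have s: "0 < s" using p by (simp add: s_def)
  define w where "w v = measure \<mu> (r -` {v})" for v
  have w: "0 \<le> w v" for v by (simp add: w_def)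
  have w1: "(\<Sum>v\<in>range r. w v) = 1"
    unfolding w_def by (rule haar_sum_fibres[OF \<mu> r])
  have add: "lpn (range r) w s (\<lambda>v. K * (H v + e)) \<le> c * (lpn (range r) w s H + e)" if H: "\<And>v. 0 \<le> H v" for H
    unfolding c_def s_def[symmetric] using s K w w1 H e by (intro lpn_add_const) auto
  define I where "I = (\<integral>\<^sup>+ x. ennreal (N (f x) powr s) \<partial>\<mu>)"
  have "I \<le> (\<integral>\<^sup>+ x. ennreal ((\<lambda>v. K * (F v + e)) (r x) powr s) \<partial>\<mu>)"
    unfolding I_def using f fF s by (intro nn_integral_mono ennreal_leI powr_mono2) auto
  also have "\<dots> = ennreal (lpn (range r) w s (\<lambda>v. K * (F v + e)) powr s)"
    unfolding w_def by (rule lpn_eq_nn_integral[OF \<mu> r s])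
  finally have I_le: "I \<le> ennreal (lpn (range r) w s (\<lambda>v. K * (F v + e)) powr s)" .
  then have I_fin: "I \<noteq> \<infinity>" by (metis ennreal_less_top infinity_ennreal_def leD)
  define j where "j = enn2real I powr (1 / s)"
  have js: "j powr s = enn2real I"
    using s by (simp add: j_def powr_powr)
  have j_eq: "Lp_qnorm \<mu> p N f = ennreal j"
    using p I_fin by (simp add: Lp_qnorm_def j_def I_def s_def)
  have j0: "0 \<le> j" by (simp add: j_def)
  have Q: "Q = lpn (range r) w s F" by (simp only: Q_def w_def[abs_def] s_def)
  have "enn2real I \<le> lpn (range r) w s (\<lambda>v. K * (F v + e)) powr s"
    using I_le by (intro enn2real_leI) auto
  then have "j \<le> (lpn (range r) w s (\<lambda>v. K * (F v + e)) powr s) powr (1 / s)"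
    unfolding j_def using s by (intro powr_mono2) auto
  also have "\<dots> = lpn (range r) w s (\<lambda>v. K * (F v + e))"
    using s by (simp add: powr_powr lpn_nonneg)
  also have "\<dots> \<le> c * (Q + e)" unfolding Q by (rule add[OF F])
  finally have upper: "j \<le> c * (Q + e)" .
  \<comment> \<open>\<open>G \<circ> r\<close> is a simple function below \<open>N \<circ> f\<close>\<close>
  define G where "G v = max 0 (F v / K - e)" for v
  have G0: "0 \<le> G v" for v by (simp add: G_def)
  have "ennreal (lpn (range r) w s G powr s) = (\<integral>\<^sup>+ x. ennreal (G (r x) powr s) \<partial>\<mu>)"
    unfolding w_def by (rule lpn_eq_nn_integral[OF \<mu> r s, symmetric])
  also have "\<dots> \<le> I"
    unfolding I_def
  proof (intro nn_integral_mono ennreal_leI powr_mono2)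
    fix x
    have "F (r x) / K \<le> N (f x) + e" using Ff[of x] K by (simp add: divide_le_eq mult.commute)
    then show "G (r x) \<le> N (f x)" using f[of x] by (simp add: G_def)
  qed (use s G0 in auto)
  finally have "ennreal (lpn (range r) w s G powr s) \<le> ennreal (enn2real I)"
    using I_fin by (simp add: less_top[symmetric])
  then have "lpn (range r) w s G powr s \<le> j powr s"
    unfolding js by (subst (asm) ennreal_le_iff) auto
  then have "(lpn (range r) w s G powr s) powr (1 / s) \<le> (j powr s) powr (1 / s)"
    using s by (intro powr_mono2[of "1 / s"]) auto
  then have Gj: "lpn (range r) w s G \<le> j"
    using s j0 by (simp add: powr_powr lpn_nonneg)
  have "Q \<le> lpn (range r) w s (\<lambda>v. K * (G v + e))"
    unfolding Q
  proof (intro lpn_mono s w F)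
    fix v
    have "F v = K * (F v / K)" using K by simp
    also have "\<dots> \<le> K * (G v + e)" using K by (intro mult_left_mono) (auto simp: G_def)
    finally show "F v \<le> K * (G v + e)" .
  qed
  also have "\<dots> \<le> c * (lpn (range r) w s G + e)" by (rule add[OF G0])
  also have "\<dots> \<le> c * (j + e)"
    using Gj K by (intro mult_left_mono add_right_mono) (auto simp: c_def)
  finally have lower: "Q \<le> c * (j + e)" .
  show ?thesis using j_eq j0 upper lower by blast
qed

text \<open>
  Write \<open>Q s\<close> for the discretized \<open>L\<^sub>p\<close>-quasi-norm of \<open>\<Sum>k<n. s k \<gamma> k y k\<close>.  Translating by \<open>g\<close>
  multiplies the coefficients by \<open>\<gamma> k g\<close>, so that by domination the numbers \<open>Q s\<close> are equivalent
  to each other for all signs \<open>s\<close>.  Their average over \<open>s\<close> is, by the contraction principle at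
  each atom, equivalent to the Rademacher average of the \<open>y k\<close>.
\<close>

theorem property_C_finite_exponent:
  fixes \<mu> :: "'g::{topological_ab_group_add, t2_space} measure" and E :: "('g \<Rightarrow> complex) set"
  assumes \<mu>: "normalized_haar \<mu>" and E: "E \<subseteq> dual_group" and Y: "quasi_normed smul N K"
    and p: "p \<noteq> \<infinity>" "0 < enn2real p" and dom: "sidon_dominated E (enn2real p) smul N"
  shows "property_C \<mu> E p smul N"
proof -
  interpret quasi_normed smul N K by fact
  define s where "s = enn2real p"
  have s: "0 < s" using p by (simp add: s_def)
  define c where "c = K * 2 powr (1 + 1 / s)"
  have c: "0 \<le> c" using const_ge_1 by (simp add: c_def)
  obtain D where D: "0 \<le> D" and dominated: "\<And>n \<gamma> (W :: 'g set) w y S a. inj_on \<gamma> {..<n::nat} \<Longrightarrow> \<gamma> ` {..<n} \<subseteq> E \<Longrightarrow>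
      (\<forall>v\<in>W. 0 \<le> w v) \<Longrightarrow> 0 \<le> S \<Longrightarrow> (\<forall>g. lpn W w s (\<lambda>v. N (\<Sum>k<n. smul (\<gamma> k g) (y k v))) \<le> S) \<Longrightarrow>
      (\<forall>k<n. cmod (a k) \<le> 1) \<Longrightarrow> lpn W w s (\<lambda>v. N (\<Sum>k<n. smul (a k) (y k v))) \<le> D * S"
    by (rule sidon_dominatedE[OF dom[folded s_def]]) (rule that)
  obtain B where B: "0 \<le> B" and contraction: "\<forall>n x a. (\<forall>k<n. cmod (a k) \<le> 1) \<longrightarrow>
    rademacher_norm smul N s n (\<lambda>k. smul (a k) (x k)) \<le> B * rademacher_norm smul N s n x"
    using rademacher_contraction[OF s] by (elim exE conjE) (rule that)
  define M1 where "M1 = c * (D * c * (B + 2 * K) + 1)"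
  define M2 where "M2 = B * (D * (c * (c + 2 * K)))"
  have M12: "0 \<le> M1" "0 \<le> M2" using B D c const_ge_1 by (auto simp: M1_def M2_def)
  define M where "M = M1 + M2 + 1"
  have M: "0 < M" using M12 by (simp add: M_def)

  have main: "\<exists>j\<ge>0. Lp_qnorm \<mu> p N (\<lambda>t. \<Sum>k<n. smul (\<gamma> k t) (y k)) = ennreal j \<and>
      j \<le> M1 * rademacher_norm smul N s n y \<and> rademacher_norm smul N s n y \<le> M2 * j"
    if \<gamma>: "inj_on \<gamma> {..<n}" "\<gamma> ` {..<n} \<subseteq> E" for n :: nat and \<gamma> y
  proof -
    define \<Psi> where "\<Psi> a = N (\<Sum>k<n. smul (a k) (y k))" for a
    interpret \<Psi>: coefficient_quasi_seminorm n K \<Psi>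
      unfolding \<Psi>_def by (rule linear_combination_quasi_seminorm)
    define S where "S = rademacher_norm smul N s n y"
    have S0: "0 \<le> S" by (simp add: S_def lpn_nonneg)
    define J where "J = Lp_qnorm \<mu> p N (\<lambda>t. \<Sum>k<n. smul (\<gamma> k t) (y k))"
    have \<gamma>d: "\<gamma> k \<in> dual_group" if "k < n" for k using \<gamma>(2) E that by auto
    have \<gamma>1: "cmod (\<gamma> k v) = 1" if "k < n" for k v by (rule dual_group_norm[OF \<gamma>d[OF that]])
    have \<gamma>_add: "\<gamma> k (u + v) = \<gamma> k u * \<gamma> k v" if "k < n" for k u v by (rule dual_group_add[OF \<gamma>d[OF that]])

    define R where "R v = rademacher_norm smul N s n (\<lambda>k. smul (\<gamma> k v) (y k))" for v
    have R0: "0 \<le> R v" for v by (simp add: R_def lpn_nonneg)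
    have RS: "R v \<le> B * S" for v
      unfolding R_def S_def
      by (rule contraction[THEN spec, THEN spec, THEN spec, THEN mp]) (simp add: \<gamma>1)
    have SR: "S \<le> B * R v" for v
    proof -
      have "S = rademacher_norm smul N s n (\<lambda>k. smul (cnj (\<gamma> k v)) (smul (\<gamma> k v) (y k)))"
        unfolding S_def by (simp add: cnj_mult_self \<gamma>1)
      also have "\<dots> \<le> B * R v"
        unfolding R_def
        by (rule contraction[THEN spec, THEN spec, THEN spec, THEN mp]) (simp add: \<gamma>1)
      finally show ?thesis .
    qed

    \<comment> \<open>\<open>e\<close> is the rounding error; the constants do not depend on it\<close>
    have "\<exists>j\<ge>0. J = ennreal j \<and> j \<le> M1 * (S + e) \<and> S \<le> M2 * (j + e)" if e: "0 < e" for e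
    proof -
      obtain r :: "'g \<Rightarrow> 'g" where r: "finite (range r)" "\<And>y. r -` {y} \<in> sets borel"
        and close: "\<And>x a. \<forall>k<n. cmod (a k) \<le> 1 \<Longrightarrow> \<Psi> (\<lambda>k. a k * (\<gamma> k x - \<gamma> k (r x))) \<le> e"
        by (rule \<Psi>.rounding[where \<gamma> = \<gamma>, OF _ e]) (rule \<gamma>d, assumption, rule that)
      define w where "w v = measure \<mu> (r -` {v})" for v
      have w: "0 \<le> w v" for v by (simp add: w_def)
      have w1: "(\<Sum>v\<in>range r. w v) = 1"
        unfolding w_def by (rule haar_sum_fibres[OF \<mu> r])
      define Q where "Q a = lpn (range r) w s (\<lambda>v. \<Psi> (\<lambda>k. a k * \<gamma> k v))" for a
      have Q0: "0 \<le> Q a" for a by (simp add: Q_def lpn_nonneg)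

      have translate: "lpn (range r) w s (\<lambda>v. \<Psi> (\<lambda>k. \<gamma> k g * (a k * \<gamma> k v))) \<le> c * (Q a + 2 * K * e)"
        if a: "\<And>k. k < n \<Longrightarrow> cmod (a k) \<le> 1" for a g
      proof -
        have "lpn (range r) w s (\<lambda>v. \<Psi> (\<lambda>k. \<gamma> k g * (a k * \<gamma> k v)))
            \<le> lpn (range r) w s (\<lambda>v. K * (\<Psi> (\<lambda>k. a k * \<gamma> k v) + 2 * K * e))"
          unfolding w_def
        proof (rule lpn_translate_mono[OF \<mu> r s, where g = g])
          fix x
          \<comment> \<open>both \<open>r x\<close> and \<open>r (g + x)\<close> have to be compared with unrounded points\<close>
          have "\<Psi> (\<lambda>k. \<gamma> k g * (a k * \<gamma> k (r x))) = \<Psi> (\<lambda>k. a k * \<gamma> k (r (g + x)) +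
              (a k * (\<gamma> k (g + x) - \<gamma> k (r (g + x))) + (- 1) * ((a k * \<gamma> k g) * (\<gamma> k x - \<gamma> k (r x)))))"
            by (rule \<Psi>.local) (simp add: \<gamma>_add algebra_simps)
          also have "\<dots> \<le> K * (\<Psi> (\<lambda>k. a k * \<gamma> k (r (g + x))) + K * (\<Psi> (\<lambda>k. a k * (\<gamma> k (g + x) - \<gamma> k (r (g + x))))
              + \<Psi> (\<lambda>k. (- 1) * ((a k * \<gamma> k g) * (\<gamma> k x - \<gamma> k (r x))))))"
            using const_ge_1 by (intro order_trans[OF \<Psi>.triangle] mult_left_mono add_left_mono \<Psi>.triangle) simp
          also have "\<Psi> (\<lambda>k. (- 1) * ((a k * \<gamma> k g) * (\<gamma> k x - \<gamma> k (r x)))) = \<Psi> (\<lambda>k. (a k * \<gamma> k g) * (\<gamma> k x - \<gamma> k (r x)))"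
            by (subst \<Psi>.scale) simp
          also have "K * (\<Psi> (\<lambda>k. a k * \<gamma> k (r (g + x))) + K * (\<Psi> (\<lambda>k. a k * (\<gamma> k (g + x) - \<gamma> k (r (g + x))))
              + \<Psi> (\<lambda>k. (a k * \<gamma> k g) * (\<gamma> k x - \<gamma> k (r x))))) \<le> K * (\<Psi> (\<lambda>k. a k * \<gamma> k (r (g + x))) + K * (e + e))"
            using const_ge_1 a \<gamma>1
            by (intro mult_left_mono add_left_mono add_mono close) (auto simp: norm_mult)
          also have "K * (e + e) = 2 * K * e" by simp
          finally show "\<Psi> (\<lambda>k. \<gamma> k g * (a k * \<gamma> k (r x))) \<le> K * (\<Psi> (\<lambda>k. a k * \<gamma> k (r (g + x))) + 2 * K * e)" .
        qed (rule \<Psi>.nonneg)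
        also have "\<dots> \<le> c * (Q a + 2 * K * e)"
          unfolding Q_def c_def using s const_ge_1 w w1 \<Psi>.nonneg e by (intro lpn_add_const) auto
        finally show ?thesis .
      qed
      \<comment> \<open>domination for the vectors \<open>a k \<gamma> k y k\<close>, at the coefficients \<open>b k a k\<close>\<close>
      have signs: "Q b \<le> D * (c * (Q a + 2 * K * e))"
        if a: "\<And>k. k < n \<Longrightarrow> a k * a k = 1 \<and> cmod (a k) = 1" and b: "\<And>k. k < n \<Longrightarrow> cmod (b k) = 1" for a b
      proof -
        have eq: "(\<Sum>k<n. smul (d k) (smul (a k * \<gamma> k v) (y k))) = (\<Sum>k<n. smul (d k * (a k * \<gamma> k v)) (y k))" for d v
          by simp
        have "lpn (range r) w s (\<lambda>v. N (\<Sum>k<n. smul (b k * a k) (smul (a k * \<gamma> k v) (y k)))) \<le> D * (c * (Q a + 2 * K * e))"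
        proof (rule dominated[OF \<gamma>])
          show "\<forall>g. lpn (range r) w s (\<lambda>v. N (\<Sum>k<n. smul (\<gamma> k g) (smul (a k * \<gamma> k v) (y k)))) \<le> c * (Q a + 2 * K * e)"
            unfolding eq using translate[of a] a by (simp add: \<Psi>_def)
          show "0 \<le> c * (Q a + 2 * K * e)" using c Q0 const_ge_1 e by simp
        qed (use w a b in \<open>auto simp: norm_mult\<close>)
        also have "lpn (range r) w s (\<lambda>v. N (\<Sum>k<n. smul (b k * a k) (smul (a k * \<gamma> k v) (y k)))) = Q b"
        proof -
          have "N (\<Sum>k<n. smul (b k * a k) (smul (a k * \<gamma> k v) (y k))) = \<Psi> (\<lambda>k. b k * \<gamma> k v)" for v
          proof -
            have "\<Psi> (\<lambda>k. (b k * a k) * (a k * \<gamma> k v)) = \<Psi> (\<lambda>k. b k * \<gamma> k v)"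
            proof (rule \<Psi>.local)
              fix k assume "k < n"
              have "(b k * a k) * (a k * \<gamma> k v) = b k * (a k * a k) * \<gamma> k v" by (simp only: mult_ac)
              then show "(b k * a k) * (a k * \<gamma> k v) = b k * \<gamma> k v" using a[OF \<open>k < n\<close>] by simp
            qed
            then show ?thesis unfolding eq by (simp add: \<Psi>_def)
          qed
          then show ?thesis by (simp only: Q_def)
        qed
        finally show ?thesis .
      qed
      have cube1: "a k * a k = 1 \<and> cmod (a k) = 1" if "a \<in> cube n" "k < n" for a k
        using cube_sign[OF that] by auto

      have average: "(\<Sum>a\<in>cube n. 1 / 2 ^ n * Q a powr s) = (\<Sum>v\<in>range r. w v * R v powr s)"
      proof -
        have Qs: "Q a powr s = (\<Sum>v\<in>range r. w v * \<Psi> (\<lambda>k. a k * \<gamma> k v) powr s)" for a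
          unfolding Q_def by (rule lpn_powr[OF s w])
        have Rs: "R v powr s = (\<Sum>a\<in>cube n. 1 / 2 ^ n * \<Psi> (\<lambda>k. a k * \<gamma> k v) powr s)" for v
        proof -
          have "R v powr s = (\<Sum>a\<in>cube n. 1 / 2 ^ n * N (\<Sum>k<n. smul (a k) (smul (\<gamma> k v) (y k))) powr s)"
            unfolding R_def by (rule lpn_powr[OF s]) simp
          then show ?thesis by (simp add: \<Psi>_def)
        qed
        show ?thesis
          unfolding Qs Rs sum_distrib_left by (subst sum.swap) (simp only: mult_ac)
      qed
      have mean_w: "(\<Sum>v\<in>range r. w v * d) = d" for d
        by (simp add: w1 flip: sum_distrib_right)
      have mean_cube: "(\<Sum>a\<in>cube n. 1 / 2 ^ n * d) = d" for d :: real
        by (simp add: card_cube)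
      have cube_ne: "cube n \<noteq> {}" using card_cube[of n] by (intro notI) simp

      \<comment> \<open>some sign vector is at most, and some is at least, as large as the average\<close>
      have "\<exists>a\<in>cube n. Q a \<le> B * S"
      proof (rule ccontr)
        assume "\<not> ?thesis"
        then have "(\<Sum>a\<in>cube n. 1 / 2 ^ n * (B * S) powr s) < (\<Sum>a\<in>cube n. 1 / 2 ^ n * Q a powr s)"
          using s B S0 cube_ne
          by (intro sum_strict_mono finite_cube mult_strict_left_mono powr_less_mono2) (auto simp: not_le)
        also have "\<dots> \<le> (\<Sum>v\<in>range r. w v * (B * S) powr s)"
          unfolding average using w s RS R0 by (intro sum_mono mult_left_mono powr_mono2) auto
        finally show False unfolding mean_w mean_cube by simp
      qed
      then obtain a where a: "a \<in> cube n" "Q a \<le> B * S" by blast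
      have "\<exists>a\<in>cube n. S \<le> B * Q a"
      proof (rule ccontr)
        assume *: "\<not> ?thesis"
        have "(\<Sum>a\<in>cube n. 1 / 2 ^ n * (B * Q a) powr s) < (\<Sum>a\<in>cube n. 1 / 2 ^ n * S powr s)"
          using s B Q0 cube_ne *
          by (intro sum_strict_mono finite_cube mult_strict_left_mono powr_less_mono2) (auto simp: not_le)
        also have "\<dots> = (\<Sum>v\<in>range r. w v * S powr s)" unfolding mean_w mean_cube ..
        also have "\<dots> \<le> (\<Sum>v\<in>range r. w v * (B * R v) powr s)"
          using w s SR S0 by (intro sum_mono mult_left_mono powr_mono2) auto
        also have "\<dots> = B powr s * (\<Sum>v\<in>range r. w v * R v powr s)"
          unfolding sum_distrib_left using B R0 by (intro sum.cong refl) (simp add: powr_mult)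
        also have "\<dots> = (\<Sum>a\<in>cube n. 1 / 2 ^ n * (B * Q a) powr s)"
          unfolding average[symmetric] sum_distrib_left using B Q0
          by (intro sum.cong refl) (simp add: powr_mult)
        finally show False by simp
      qed
      then obtain b where b: "b \<in> cube n" "S \<le> B * Q b" by blast

      define Q1 where "Q1 = lpn (range r) w s (\<lambda>v. \<Psi> (\<lambda>k. \<gamma> k v))"
      have Q1: "Q (\<lambda>k. 1) = Q1" by (simp add: Q_def Q1_def)
      have Q1a: "Q1 \<le> D * (c * (Q a + 2 * K * e))"
        unfolding Q1[symmetric] using cube1[OF a(1)] by (intro signs) auto
      have bQ1: "Q b \<le> D * (c * (Q1 + 2 * K * e))"
        unfolding Q1[symmetric] using cube1[OF b(1)] by (intro signs) auto
      have near: "\<Psi> (\<lambda>k. \<gamma> k x) \<le> K * (\<Psi> (\<lambda>k. \<gamma> k (r x)) + e)" "\<Psi> (\<lambda>k. \<gamma> k (r x)) \<le> K * (\<Psi> (\<lambda>k. \<gamma> k x) + e)" for x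
      proof -
        have d: "\<Psi> (\<lambda>k. z * (\<gamma> k x - \<gamma> k (r x))) \<le> e" if "cmod z = 1" for z
          using that by (intro close) auto
        have "\<Psi> (\<lambda>k. \<gamma> k x) = \<Psi> (\<lambda>k. \<gamma> k (r x) + 1 * (\<gamma> k x - \<gamma> k (r x)))"
          by (rule \<Psi>.local) simp
        also have "\<dots> \<le> K * (\<Psi> (\<lambda>k. \<gamma> k (r x)) + e)"
          using const_ge_1 by (intro order_trans[OF \<Psi>.triangle] mult_left_mono add_left_mono d) auto
        finally show "\<Psi> (\<lambda>k. \<gamma> k x) \<le> K * (\<Psi> (\<lambda>k. \<gamma> k (r x)) + e)" .
        have "\<Psi> (\<lambda>k. \<gamma> k (r x)) = \<Psi> (\<lambda>k. \<gamma> k x + (- 1) * (\<gamma> k x - \<gamma> k (r x)))"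
          by (rule \<Psi>.local) simp
        also have "\<dots> \<le> K * (\<Psi> (\<lambda>k. \<gamma> k x) + e)"
          using const_ge_1 by (intro order_trans[OF \<Psi>.triangle] mult_left_mono add_left_mono d) auto
        finally show "\<Psi> (\<lambda>k. \<gamma> k (r x)) \<le> K * (\<Psi> (\<lambda>k. \<gamma> k x) + e)" .
      qed
      have "\<exists>j\<ge>0. J = ennreal j \<and> j \<le> c * (Q1 + e) \<and> Q1 \<le> c * (j + e)"
        unfolding J_def Q1_def w_def[abs_def] c_def s_def
        by (rule Lp_qnorm_rounding[OF \<mu> r p const_ge_1])
          (use e near N_nonneg \<Psi>.nonneg in \<open>simp_all add: \<Psi>_def\<close>)
      then obtain j where j: "0 \<le> j" "J = ennreal j" "j \<le> c * (Q1 + e)" "Q1 \<le> c * (j + e)" by blast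
      have "j \<le> M1 * (S + e)"
      proof -
        have "Q1 \<le> D * (c * (B * S + 2 * K * e))"
          using Q1a a(2) D c by (elim order_trans) (intro mult_left_mono add_right_mono, auto)
        also have "\<dots> \<le> D * (c * ((B + 2 * K) * (S + e)))"
          using B D c S0 e const_ge_1 by (intro mult_left_mono) (auto simp: algebra_simps)
        finally have "c * (Q1 + e) \<le> c * (D * (c * ((B + 2 * K) * (S + e))) + (S + e))"
          using c S0 by (intro mult_left_mono add_mono) auto
        also have "\<dots> = M1 * (S + e)" by (simp add: M1_def algebra_simps)
        finally show ?thesis using j(3) by linarith
      qed
      moreover have "S \<le> M2 * (j + e)"
      proof -
        have "S \<le> B * (D * (c * (Q1 + 2 * K * e)))"
          using b(2) bQ1 B by (elim order_trans) (intro mult_left_mono, auto)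
        also have "\<dots> \<le> B * (D * (c * (c * (j + e) + 2 * K * (j + e))))"
          using j B D c e const_ge_1 by (intro mult_left_mono add_mono) auto
        also have "\<dots> = M2 * (j + e)" by (simp add: M2_def algebra_simps)
        finally show ?thesis .
      qed
      ultimately show ?thesis using j by blast
    qed
    note approx = this
    define j where "j = enn2real J"
    have J: "J = ennreal j" "0 \<le> j"
      using approx[of 1] by (auto simp: j_def)
    have "j \<le> M1 * (S + e)" "S \<le> M2 * (j + e)" if "0 < e" for e
      using approx[OF that] by (auto simp: j_def)
    then have "j \<le> M1 * S" "S \<le> M2 * j"
      using M12 by (auto intro: le_of_le_add_multiple)
    then show ?thesis using J unfolding J_def S_def by blast
  qed
  show ?thesis
    unfolding property_C_def Let_def
  proof (rule exI[of _ M], intro conjI allI impI)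
    show "0 < M" by (rule M)
    fix n :: nat and \<gamma> y assume \<gamma>: "inj_on \<gamma> {..<n} \<and> \<gamma> ` {..<n} \<subseteq> E"
    obtain j where j: "0 \<le> j" "Lp_qnorm \<mu> p N (\<lambda>t. \<Sum>k<n. smul (\<gamma> k t) (y k)) = ennreal j"
      "j \<le> M1 * rademacher_norm smul N s n y" "rademacher_norm smul N s n y \<le> M2 * j"
      using main[of \<gamma> n y] \<gamma> by blast
    have S: "Lp_qnorm (sign_cube n) p N (\<lambda>t. \<Sum>k<n. smul (t k) (y k)) = ennreal (rademacher_norm smul N s n y)"
      unfolding s_def by (rule Lp_qnorm_sign_cube[OF p N_nonneg])
    have S0: "0 \<le> rademacher_norm smul N s n y" by (rule lpn_nonneg)
    have "M2 * j \<le> M * j" "M1 * rademacher_norm smul N s n y \<le> M * rademacher_norm smul N s n y"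
      using j(1) S0 M12 by (auto simp: M_def intro!: mult_right_mono)
    then have "inverse M * rademacher_norm smul N s n y \<le> j" "j \<le> M * rademacher_norm smul N s n y"
      using j M by (auto simp: field_simps)
    then show "ennreal (inverse M) * Lp_qnorm (sign_cube n) p N (\<lambda>t. \<Sum>k<n. smul (t k) (y k))
        \<le> Lp_qnorm \<mu> p N (\<lambda>t. \<Sum>k<n. smul (\<gamma> k t) (y k))"
      and "Lp_qnorm \<mu> p N (\<lambda>t. \<Sum>k<n. smul (\<gamma> k t) (y k))
        \<le> ennreal M * Lp_qnorm (sign_cube n) p N (\<lambda>t. \<Sum>k<n. smul (t k) (y k))"
      using M S0 unfolding S j(2) by (simp_all add: ennreal_mult[symmetric] ennreal_leI)
  qed
qed

lemma Lp_qnorm_sign_cube_infinity: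
  "Lp_qnorm (sign_cube n) \<infinity> N f = ennreal (Max ((\<lambda>t. N (f t)) ` cube n))"
proof -
  define R where "R = Max ((\<lambda>t. N (f t)) ` cube n)"
  have ne: "cube n \<noteq> {}" using card_cube[of n] by (intro notI) simp
  have AE: "(AE t in sign_cube n. P t) \<longleftrightarrow> (\<forall>t\<in>cube n. P t)" for P
    unfolding sign_cube_def cube_def[symmetric] uniform_count_measure_def AE_point_measure
    by (simp add: card_cube)
  have "Limsup (ae_filter (sign_cube n)) (\<lambda>t. ennreal (N (f t))) = ennreal R"
  proof (rule antisym)
    show "Limsup (ae_filter (sign_cube n)) (\<lambda>t. ennreal (N (f t))) \<le> ennreal R"
      unfolding R_def by (intro Limsup_bounded AE[THEN iffD2] ballI ennreal_leI Max_ge) (auto simp: finite_cube)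
    have "R \<in> (\<lambda>t. N (f t)) ` cube n"
      unfolding R_def using ne finite_cube by (intro Max_in) auto
    then obtain t where t: "t \<in> cube n" "R = N (f t)" by blast
    show "ennreal R \<le> Limsup (ae_filter (sign_cube n)) (\<lambda>t. ennreal (N (f t)))"
    proof (rule ccontr)
      assume "\<not> ?thesis"
      then have "AE x in sign_cube n. ennreal (N (f x)) < ennreal R"
        by (intro Limsup_lessD) (simp add: not_le)
      then have "ennreal (N (f t)) < ennreal R" unfolding AE using t(1) by (rule bspec)
      then show False unfolding t(2) by simp
    qed
  qed
  then show ?thesis by (simp add: Lp_qnorm_def R_def)
qed

text \<open>
  A trigonometric polynomial stays close to its value at \<open>g\<close> on a translate of an atom of the
  rounding; some atom has positive measure, and Haar measure is invariant.
\<close>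

lemma (in coefficient_quasi_seminorm) pointwise_le_essential_bound:
  fixes \<mu> :: "'g::{topological_ab_group_add, t2_space} measure" and \<gamma> :: "nat \<Rightarrow> 'g \<Rightarrow> complex"
  assumes \<mu>: "normalized_haar \<mu>" and \<gamma>: "\<And>k. k < n \<Longrightarrow> \<gamma> k \<in> dual_group" and e: "0 < e"
    and bound: "AE x in \<mu>. \<Psi> (\<lambda>k. \<gamma> k x) \<le> \<tau>"
  shows "\<Psi> (\<lambda>k. \<gamma> k g) \<le> K * (\<tau> + e)"
proof -
  obtain r :: "'g \<Rightarrow> 'g" where r: "finite (range r)" "\<And>y. r -` {y} \<in> sets borel"
    and close: "\<And>x a. \<forall>k<n. cmod (a k) \<le> 1 \<Longrightarrow> \<Psi> (\<lambda>k. a k * (\<gamma> k x - \<gamma> k (r x))) \<le> e"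
    by (rule rounding[where \<gamma> = \<gamma>, OF _ e]) (rule \<gamma>, assumption, rule that)
  note haar = normalized_haar_finite[OF \<mu>]
  interpret finite_measure \<mu> by (rule haar)
  have "\<exists>v\<in>range r. measure \<mu> (r -` {v}) \<noteq> 0"
  proof (rule ccontr)
    assume "\<not> ?thesis"
    then have "(\<Sum>v\<in>range r. measure \<mu> (r -` {v})) = 0" by (intro sum.neutral) auto
    then show False using haar_sum_fibres[OF \<mu> r] by simp
  qed
  then obtain v where v: "measure \<mu> (r -` {v}) \<noteq> 0" by blast
  define A where "A = (\<lambda>x. (v - g) + x) -` (r -` {v})"
  have "(\<lambda>x. (v - g) + x) \<in> borel_measurable borel"
    by (intro borel_measurable_continuous_onI continuous_intros)
  then have shift: "(\<lambda>x. (v - g) + x) \<in> measurable \<mu> borel"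
    by (simp add: measurable_cong_sets[OF haar(2) refl])
  have "measure \<mu> (r -` {v}) = measure (distr \<mu> borel (\<lambda>x. (v - g) + x)) (r -` {v})"
    using \<mu> by (simp add: normalized_haar_def)
  also have "\<dots> = measure \<mu> A"
    using measure_distr[OF shift r(2)[of v]] by (simp add: A_def haar)
  finally have "measure \<mu> A \<noteq> 0" using v by simp
  have "\<exists>x\<in>A. \<Psi> (\<lambda>k. \<gamma> k x) \<le> \<tau>"
  proof (rule ccontr)
    assume "\<not> ?thesis"
    then have "AE x in \<mu>. x \<notin> A"
      using bound by (auto elim!: eventually_mono)
    moreover have "A \<in> sets \<mu>"
      using measurable_sets[OF shift r(2)[of v]] by (simp add: A_def haar)
    ultimately have "emeasure \<mu> A = 0"
      by (subst (asm) AE_iff_measurable[of A]) (auto simp: haar)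
    then show False using \<open>measure \<mu> A \<noteq> 0\<close> by (simp add: measure_def)
  qed
  then obtain x where x: "r ((v - g) + x) = v" "\<Psi> (\<lambda>k. \<gamma> k x) \<le> \<tau>" by (auto simp: A_def)
  have mult: "\<gamma> k a * \<gamma> k b = \<gamma> k (a + b)" if "k < n" for k a b
    using dual_group_add[OF \<gamma>[OF that], of a b] by simp
  have "\<Psi> (\<lambda>k. \<gamma> k g) = \<Psi> (\<lambda>k. \<gamma> k x + (- \<gamma> k (g - v)) * (\<gamma> k ((v - g) + x) - \<gamma> k (r ((v - g) + x))))"
    by (rule local) (simp add: x(1) right_diff_distrib mult)
  also have "\<dots> \<le> K * (\<tau> + e)"
  proof (intro order_trans[OF triangle] mult_left_mono add_mono x(2) close allI impI)
    fix k assume "k < n"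
    from dual_group_norm[OF \<gamma>[OF this], of "g - v"] show "cmod (- \<gamma> k (g - v)) \<le> 1" by simp
  qed (use K_ge_1 in simp)
  finally show ?thesis .
qed

text \<open>
  For the supremum norm a single atom suffices: domination compares the maximum over the signs with
  the supremum over the group directly.
\<close>

theorem property_C_infinity:
  fixes \<mu> :: "'g::{topological_ab_group_add, t2_space} measure" and E :: "('g \<Rightarrow> complex) set"
  assumes \<mu>: "normalized_haar \<mu>" and E: "E \<subseteq> dual_group" and Y: "quasi_normed smul N K"
    and dom: "sidon_dominated E 1 smul N"
  shows "property_C \<mu> E \<infinity> smul N"
proof -
  interpret quasi_normed smul N K by fact
  obtain D where D: "0 \<le> D" and dominated: "\<And>n \<gamma> (W :: 'g set) w y S a. inj_on \<gamma> {..<n::nat} \<Longrightarrow> \<gamma> ` {..<n} \<subseteq> E \<Longrightarrow>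
      (\<forall>v\<in>W. 0 \<le> w v) \<Longrightarrow> 0 \<le> S \<Longrightarrow> (\<forall>g. lpn W w 1 (\<lambda>v. N (\<Sum>k<n. smul (\<gamma> k g) (y k v))) \<le> S) \<Longrightarrow>
      (\<forall>k<n. cmod (a k) \<le> 1) \<Longrightarrow> lpn W w 1 (\<lambda>v. N (\<Sum>k<n. smul (a k) (y k v))) \<le> D * S"
    by (rule sidon_dominatedE[OF dom]) (rule that)
  have atom: "lpn {0} (\<lambda>_. 1) 1 (\<lambda>v::'g. N (z v)) = N (z 0)" for z
    by (simp add: lpn_def N_nonneg)
  obtain B where B: "0 \<le> B" and contraction: "\<forall>n \<Psi> R a. coefficient_quasi_seminorm n K \<Psi> \<and>
           (\<forall>\<theta>. (\<forall>k. \<theta> k \<in> {-1, 1}) \<longrightarrow> \<Psi> \<theta> \<le> R) \<and> (\<forall>k<n. cmod (a k) \<le> 1) \<longrightarrow> \<Psi> a \<le> B * R"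
    using contraction_principle[OF const_ge_1] by (elim exE conjE) (rule that)
  define M where "M = B + D * K + 1"
  have M: "0 < M" using B D const_ge_1 by (simp add: M_def add_nonneg_pos)
  show ?thesis
    unfolding property_C_def Let_def
  proof (rule exI[of _ M], intro conjI allI impI)
    show "0 < M" by (rule M)
    fix n :: nat and \<gamma> y assume "inj_on \<gamma> {..<n} \<and> \<gamma> ` {..<n} \<subseteq> E"
    then have \<gamma>: "inj_on \<gamma> {..<n}" "\<gamma> ` {..<n} \<subseteq> E" by (rule conjunct1, rule conjunct2)
    define \<Psi> where "\<Psi> a = N (\<Sum>k<n. smul (a k) (y k))" for a
    have qs: "coefficient_quasi_seminorm n K \<Psi>"
      unfolding \<Psi>_def by (rule linear_combination_quasi_seminorm)
    interpret \<Psi>: coefficient_quasi_seminorm n K \<Psi> by (rule qs)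
    have \<gamma>d: "\<gamma> k \<in> dual_group" if "k < n" for k using \<gamma>(2) E that by auto
    define R where "R = Max (\<Psi> ` cube n)"
    define T where "T = Lp_qnorm \<mu> \<infinity> N (\<lambda>t. \<Sum>k<n. smul (\<gamma> k t) (y k))"
    have T_def': "T = Limsup (ae_filter \<mu>) (\<lambda>x. ennreal (\<Psi> (\<lambda>k. \<gamma> k x)))"
      by (simp add: T_def Lp_qnorm_def \<Psi>_def)
    have R_upper: "\<Psi> t \<le> R" if "t \<in> cube n" for t
      unfolding R_def using that finite_cube by (intro Max_ge) auto
    have ne: "cube n \<noteq> {}" using card_cube[of n] by (intro notI) simp
    have "R \<in> \<Psi> ` cube n"
      unfolding R_def using ne finite_cube by (intro Max_in) auto
    then obtain t where t: "t \<in> cube n" "R = \<Psi> t" by blast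
    have R0: "0 \<le> R" unfolding t(2) by (rule \<Psi>.nonneg)
    have sup: "\<Psi> (\<lambda>k. \<gamma> k g) \<le> B * R" for g
    proof (rule contraction[THEN spec, THEN spec, THEN spec, THEN spec, THEN mp], intro conjI allI impI)
      fix \<theta> :: "nat \<Rightarrow> complex" assume \<theta>: "\<forall>k. \<theta> k \<in> {-1, 1}"
      have "\<Psi> \<theta> = \<Psi> (\<lambda>k\<in>{..<n}. \<theta> k)" by (rule \<Psi>.local) simp
      also have "\<dots> \<le> R"
        by (rule R_upper, rule cube_I) (use \<theta> in simp_all)
      finally show "\<Psi> \<theta> \<le> R" .
    next
      fix k assume "k < n"
      from dual_group_norm[OF \<gamma>d[OF this], of g] show "cmod (\<gamma> k g) \<le> 1" by simp
    qed (rule qs)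
    have T_le: "T \<le> ennreal (B * R)"
      unfolding T_def' by (intro Limsup_bounded always_eventually allI ennreal_leI sup)
    then have T_fin: "T < \<infinity>" by (rule order_le_less_trans) simp
    define \<tau> where "\<tau> = enn2real T"
    have T: "T = ennreal \<tau>" and \<tau>0: "0 \<le> \<tau>" using T_fin by (simp_all add: \<tau>_def)
    have "\<Psi> (\<lambda>k. \<gamma> k g) \<le> K * \<tau>" for g
    proof (rule le_of_le_add_multiple)
      fix e :: real assume e: "0 < e"
      have "T < ennreal (\<tau> + e / 2)" unfolding T using e \<tau>0 by (subst ennreal_less_iff) auto
      then have "AE x in \<mu>. ennreal (\<Psi> (\<lambda>k. \<gamma> k x)) < ennreal (\<tau> + e / 2)"
        unfolding T_def' by (rule Limsup_lessD)
      then have "AE x in \<mu>. \<Psi> (\<lambda>k. \<gamma> k x) \<le> \<tau> + e / 2"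
        by (rule eventually_mono) (simp add: ennreal_less_iff \<Psi>.nonneg)
      from \<Psi>.pointwise_le_essential_bound[OF \<mu> \<gamma>d _ this, of "e / 2" g]
      have "\<Psi> (\<lambda>k. \<gamma> k g) \<le> K * (\<tau> + e / 2 + e / 2)" using e by simp
      then show "\<Psi> (\<lambda>k. \<gamma> k g) \<le> K * (\<tau> + e)" by (simp add: add.assoc)
    qed (use const_ge_1 in simp)
    then have le: "\<forall>g. lpn {0} (\<lambda>_. 1) 1 (\<lambda>v::'g. N (\<Sum>k<n. smul (\<gamma> k g) (y k))) \<le> K * \<tau>"
      unfolding atom \<Psi>_def by blast
    have "lpn {0} (\<lambda>_. 1) 1 (\<lambda>v::'g. N (\<Sum>k<n. smul (t k) (y k))) \<le> D * (K * \<tau>)"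
    proof (rule dominated[OF \<gamma> _ _ le])
      show "\<forall>k<n. cmod (t k) \<le> 1" using cube_sign[OF t(1)] by fastforce
    qed (use const_ge_1 \<tau>0 in auto)
    then have R_le: "R \<le> D * (K * \<tau>)" unfolding atom t(2) \<Psi>_def .
    have \<tau>_le: "\<tau> \<le> B * R" using T_le B R0 unfolding T by (subst (asm) ennreal_le_iff) auto
    have "B * R \<le> M * R" "D * (K * \<tau>) \<le> M * \<tau>"
      using B D R0 \<tau>0 const_ge_1 unfolding mult.assoc[symmetric] by (auto simp: M_def intro!: mult_right_mono)
    then have "inverse M * R \<le> \<tau>" "\<tau> \<le> M * R"
      using R_le \<tau>_le M by (auto simp: field_simps)
    moreover have S: "Lp_qnorm (sign_cube n) \<infinity> N (\<lambda>t. \<Sum>k<n. smul (t k) (y k)) = ennreal R"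
      unfolding Lp_qnorm_sign_cube_infinity R_def \<Psi>_def ..
    ultimately show "ennreal (inverse M) * Lp_qnorm (sign_cube n) \<infinity> N (\<lambda>t. \<Sum>k<n. smul (t k) (y k))
        \<le> Lp_qnorm \<mu> \<infinity> N (\<lambda>t. \<Sum>k<n. smul (\<gamma> k t) (y k))"
      and "Lp_qnorm \<mu> \<infinity> N (\<lambda>t. \<Sum>k<n. smul (\<gamma> k t) (y k))
        \<le> ennreal M * Lp_qnorm (sign_cube n) \<infinity> N (\<lambda>t. \<Sum>k<n. smul (t k) (y k))"
      using M R0 unfolding S T_def[symmetric] T by (simp_all add: ennreal_mult[symmetric] ennreal_leI)
  qed
qed

section \<open>Subordinate spaces\<close>

lemma quasi_banach_quasi_normed:
  assumes "quasi_banach smul N"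
  shows "\<exists>K. quasi_normed smul N K"
proof -
  interpret quasi_banach smul N by fact
  obtain K0 where K0: "\<And>x y. N (x + y) \<le> K0 * (N x + N y)" using qnorm_add by blast
  have "quasi_normed smul N (max K0 1)"
  proof
    fix x y
    have "N (x + y) \<le> K0 * (N x + N y)" by (rule K0)
    also have "\<dots> \<le> max K0 1 * (N x + N y)"
      using qnorm_nonneg by (intro mult_right_mono) auto
    finally show "N (x + y) \<le> max K0 1 * (N x + N y)" .
  qed (auto simp: qnorm_nonneg qnorm_scale)
  then show ?thesis by blast
qed

text \<open>
  The coordinates of an embedding into \<open>\<ell>\<^sub>\<infinity>(I; X)\<close> form a norming family of operators into \<open>X\<close>; for
  \<open>Y = X\<close> the identity is one.
\<close>

theorem norming_family_sidon_regular:
  fixes T :: "'i \<Rightarrow> 'y::ab_group_add \<Rightarrow> 'x::ab_group_add"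
  assumes X: "quasi_banach sX NX" and cotype: "has_cotype q sX NX" and q: "0 < q" and Y: "quasi_banach sY NY"
    and T: "\<And>i u v. T i (u + v) = T i u + T i v" "\<And>i c u. T i (sY c u) = sX c (T i u)"
    and c: "0 \<le> c" "\<And>i u. NX (T i u) \<le> c * NY u" "\<And>u. \<exists>i. NY u \<le> c * NX (T i u)"
  shows "sidon_regular TYPE('g::{topological_ab_group_add, t2_space}) sY NY"
  unfolding sidon_regular_def
proof (intro impI allI)
  fix \<mu> :: "'g measure" and E :: "('g \<Rightarrow> complex) set" and p :: ennreal
  assume *: "normalized_haar \<mu> \<and> sidon_set E \<and> 0 < p"
  then have \<mu>: "normalized_haar \<mu>" and E: "sidon_set E" and p: "0 < p" by auto
  have Ed: "E \<subseteq> dual_group" using E by (simp add: sidon_set_def)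
  obtain KX where KX: "quasi_normed sX NX KX" using quasi_banach_quasi_normed[OF X] by blast
  obtain KY where KY: "quasi_normed sY NY KY" using quasi_banach_quasi_normed[OF Y] by blast
  have dom: "sidon_dominated E s sY NY" if "0 < s" for s
    by (rule sidon_dominated_norming[OF cotype_sidon_dominated[OF \<mu> E KX cotype q that] that
        quasi_normed.N_nonneg[OF KX] quasi_normed.N_nonneg[OF KY] T c])
  show "property_C \<mu> E p sY NY"
  proof (cases "p = \<infinity>")
    case True
    then show ?thesis using property_C_infinity[OF \<mu> Ed KY dom] by simp
  next
    case False
    then have s: "0 < enn2real p" using p by (simp add: enn2real_positive_iff less_top)
    show ?thesis by (rule property_C_finite_exponent[OF \<mu> Ed KY False s dom[OF s]])
  qed
qed

theorem theorem10:
  fixes sX :: "complex \<Rightarrow> 'x::ab_group_add \<Rightarrow> 'x" and NX :: "'x \<Rightarrow> real" and q :: real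
  assumes "quasi_banach sX NX" and "2 \<le> q" and "has_cotype q sX NX"
  shows "(\<forall>(sY :: complex \<Rightarrow> 'y::ab_group_add \<Rightarrow> 'y) (NY :: 'y \<Rightarrow> real).
            quasi_banach sY NY \<and> subordinate TYPE('i) sY NY sX NX
              \<longrightarrow> sidon_regular TYPE('g::{topological_ab_group_add, t2_space}) sY NY)
         \<and> sidon_regular TYPE('g) sX NX"
proof (intro conjI allI impI)
  interpret X: quasi_banach sX NX by fact
  have q: "0 < q" using assms(2) by simp
  show "sidon_regular TYPE('g) sX NX"
    by (rule norming_family_sidon_regular[OF assms(1,3) q assms(1), where T = "\<lambda>_::unit. \<lambda>x. x" and c = 1]) auto
  fix sY :: "complex \<Rightarrow> 'y \<Rightarrow> 'y" and NY :: "'y \<Rightarrow> real"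
  assume *: "quasi_banach sY NY \<and> subordinate TYPE('i) sY NY sX NX"
  then have Y: "quasi_banach sY NY" by blast
  interpret Y: quasi_banach sY NY by (rule Y)
  obtain Z :: "('i \<Rightarrow> 'x) set" and T C where Z: "closed_subspace_linf sX NX Z"
    and lin: "Vector_Spaces.linear sY (fun_scale sX) T" and bij: "bij_betw T UNIV Z" and C: "0 < C"
    and T_le: "\<And>y. linf_qnorm NX (T y) \<le> C * NY y" and le_T: "\<And>y. NY y \<le> C * linf_qnorm NX (T y)"
    using * unfolding subordinate_def by blast
  interpret T: Vector_Spaces.linear sY "fun_scale sX" T by (rule lin)
  have bdd: "bdd_above (range (\<lambda>i. NX (T y i)))" for y
  proof -
    have "T y \<in> Z" using bij by (auto simp: bij_betw_def)
    then show ?thesis using Z by (auto simp: closed_subspace_linf_def linf_def)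
  qed
  show "sidon_regular TYPE('g) sY NY"
  proof (rule norming_family_sidon_regular[OF assms(1,3) q Y, where T = "\<lambda>i y. T y i" and c = "2 * C"])
    show "T (u + v) i = T u i + T v i" for i u v by (simp add: T.add)
    show "T (sY a u) i = sX a (T u i)" for i a u by (simp add: T.scale fun_scale_def)
    show "0 \<le> 2 * C" using C by simp
    show "NX (T u i) \<le> 2 * C * NY u" for i u
    proof -
      have "NX (T u i) \<le> linf_qnorm NX (T u)"
        unfolding linf_qnorm_def using bdd by (intro cSUP_upper) auto
      also have "\<dots> \<le> C * NY u" by (rule T_le)
      also have "\<dots> \<le> 2 * C * NY u" using C Y.qnorm_nonneg[of u] by simp
      finally show ?thesis .
    qed
    show "\<exists>i. NY u \<le> 2 * C * NX (T u i)" for u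
    proof (cases "NY u = 0")
      case True
      then show ?thesis using C X.qnorm_nonneg by simp
    next
      case False
      then have "0 < NY u" using Y.qnorm_nonneg[of u] by simp
      then have "NY u / (2 * C) < NY u / C" using C by (simp add: field_simps)
      also have "\<dots> \<le> linf_qnorm NX (T u)" using le_T[of u] C by (simp add: field_simps)
      finally obtain i where "NY u / (2 * C) < NX (T u i)"
        unfolding linf_qnorm_def using bdd[of u] by (subst (asm) less_cSUP_iff) auto
      then have "NY u \<le> 2 * C * NX (T u i)" using C by (simp add: field_simps)
      then show ?thesis by blast
    qed
  qed
qed

end
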